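(* Let $\Gamma=\mathrm{SL}_2(\mathbb{Z})$ and for $\gamma=\begin{pmatrix}a&b\\c&d\end{pmatrix}\in\Gamma$ put $\nu_{\mathbb H}(\gamma)=a^2+b^2+c^2+d^2$. Let $\pi_E(x)=\#\{\gamma\in\Gamma:\ \nu_{\mathbb H}(\gamma)=p\le x,\ p \text{ prime}\}$. Assume that $\pi_E(x)\asymp \frac{x}{\log x}$, i.e. there are constants $0<c_1\le c_2$ with $c_1\frac{x}{\log x}\le \pi_E(x)\le c_2\frac{x}{\log x}$ for all sufficiently large $x$. Then the sequence $E=\big((\theta_1(\gamma)/\pi,\ \theta_2(\gamma)/\pi)\big)\subseteq(\mathbb R/\mathbb Z)^2$, indexed by $\gamma\in\Gamma$ with size function $\nu_{\mathbb H}$, is equidistributed on $(\mathbb R/\mathbb Z)^2$ over primes: for every continuous $f$ on $(\mathbb R/\mathbb Z)^2$, $$\frac{1}{\pi_E(x)}\sum_{\substack{\gamma\in\Gamma\\ \nu_{\mathbb H}(\gamma)=p\le x,\ p\text{ prime}}} f\big(\theta_1(\gamma)/\pi,\theta_2(\gamma)/\pi\big)\longrightarrow \int_{(\mathbb R/\mathbb Z)^2} f\,d\mu\quad (x\to\infty),$$ with $\mu$ the Lebesgue measure.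
   Context: For $\theta\in\mathbb R$ and $r\ge0$ let $k(\theta)=\begin{pmatrix}\cos\theta&\sin\theta\\-\sin\theta&\cos\theta\end{pmatrix}$ and $a(e^{-r})=\begin{pmatrix}e^{-r/2}&0\\0&e^{r/2}\end{pmatrix}$. Every $\gamma\in\mathrm{SL}_2(\mathbb R)$ can be written (Cartan decomposition) as $\gamma=k(\theta_1(\gamma))\,a(e^{-r})\,k(\theta_2(\gamma))$, where $r=d_{\mathbb H}(\gamma i,i)$ is the hyperbolic distance in the upper half-plane; when $r>0$ the angles $\theta_1(\gamma),\theta_2(\gamma)$ are determined modulo $\pi$, so $\theta_j(\gamma)/\pi\in\mathbb R/\mathbb Z$ is well defined. (Only finitely many $\gamma\in\Gamma$ have $\gamma i=i$; they do not affect the limit.) *)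

theory Defs
  imports "HOL-Analysis.Analysis"
begin

definition SL2Z :: "(int \<times> int \<times> int \<times> int) set" where
  "SL2Z = {(a,b,c,d). a * d - b * c = 1}"

definition nuH :: "int \<times> int \<times> int \<times> int \<Rightarrow> int" where
  "nuH g = (case g of (a,b,c,d) \<Rightarrow> a^2 + b^2 + c^2 + d^2)"

definition real_mat :: "int \<times> int \<times> int \<times> int \<Rightarrow> real^2^2" where
  "real_mat g = (case g of (a,b,c,d) \<Rightarrow>
     vector [vector [real_of_int a, real_of_int b], vector [real_of_int c, real_of_int d]])"

definition kmat :: "real \<Rightarrow> real^2^2" where
  "kmat t = vector [vector [cos t, sin t], vector [- sin t, cos t]]"

definition amat :: "real \<Rightarrow> real^2^2" where
  "amat r = vector [vector [exp (- r / 2), 0], vector [0, exp (r / 2)]]"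

definition cartan_angles :: "int \<times> int \<times> int \<times> int \<Rightarrow> real \<times> real" where
  "cartan_angles g = (SOME (t1, t2). \<exists>r\<ge>0. real_mat g = kmat t1 ** amat r ** kmat t2)"

definition theta1 :: "int \<times> int \<times> int \<times> int \<Rightarrow> real" where
  "theta1 g = fst (cartan_angles g)"

definition theta2 :: "int \<times> int \<times> int \<times> int \<Rightarrow> real" where
  "theta2 g = snd (cartan_angles g)"

definition primeSet :: "real \<Rightarrow> (int \<times> int \<times> int \<times> int) set" where
  "primeSet x = {g \<in> SL2Z. prime (nuH g) \<and> real_of_int (nuH g) \<le> x}"

definition piE :: "real \<Rightarrow> nat" where
  "piE x = card (primeSet x)"

end

theory Submission
  imports Defs "HOL-Number_Theory.Number_Theory" "HOL-Real_Asymp.Real_Asymp"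
begin

text \<open>
  For \<open>\<gamma> = (a, b; c, d)\<close> put \<open>u = (a + d) + (b - c)\<i>\<close> and \<open>v = (a - d) + (b + c)\<i>\<close>. Then
  \<open>|u|\<^sup>2 = \<nu>(\<gamma>) + 2\<close>, \<open>|v|\<^sup>2 = \<nu>(\<gamma>) - 2\<close>, and the arguments of \<open>u\<close> and \<open>v\<close> are
  \<open>\<theta>\<^sub>1 + \<theta>\<^sub>2\<close> and \<open>\<theta>\<^sub>2 - \<theta>\<^sub>1 + \<pi>\<close>. Hence the Weyl sum over \<open>\<nu>(\<gamma>) = p\<close> factors, up to a bounded
  constant, as \<open>\<lambda>\<^sub>M(p + 2) \<lambda>\<^sub>N(p - 2)\<close>, where \<open>\<lambda>\<^sub>M(n)\<close> is the sum of \<open>(z/|z|)\<^sup>M\<close> over Gaussian integers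
  of norm \<open>n\<close>; unique factorisation makes \<open>\<lambda>\<^sub>M\<close> multiplicative. Since \<open>\<pi>\<^sub>E(x)\<close> is at least of order
  \<open>x / log x\<close>, it suffices to show that the sum of \<open>|\<lambda>\<^sub>M(p + 2) \<lambda>\<^sub>N(p - 2)|\<close> over primes \<open>p \<le> x\<close> is
  \<open>o(x / log x)\<close> unless \<open>M = N = 0\<close>.

  Write \<open>p \<plusminus> 2\<close> as a smooth part times a rough part. The rough part has few prime factors and
  contributes at most \<open>(log x)\<^bsup>1/10\<^esup>\<close>; large smooth parts are rare by Rankin's trick; for small smooth
  parts Brun's sieve bounds the number of \<open>p\<close>. What remains is the product of the sums of
  \<open>|\<lambda>\<^sub>M(a)|/a\<close> and \<open>|\<lambda>\<^sub>N(a)|/a\<close>, that is, of \<open>exp\<close> of the sums of \<open>|\<lambda>(q)|/q\<close> over primes \<open>q\<close>. The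
  trivial bound is \<open>log x\<close> for each; for \<open>M \<noteq> 0\<close> the inequality \<open>2|cos t| \<le> 3/2 + (cos 2t)/2\<close> and the
  boundedness of the Dirichlet series of \<open>\<lambda>\<^sub>2\<^sub>M\<close> at \<open>s = 1\<close> improve it to \<open>(log x)\<^bsup>3/4\<^esup>\<close>.
\<close>

section \<open>Gaussian integers\<close>

text \<open>Sieving \<open>n\<close>, \<open>n + 2\<close> and \<open>n - 2\<close> saves (log log x
  / log x)^3. Measured against x / log x, the trivial bounds for the two sums over smooth parts
  already exhaust this, so a true power of log x has to come from one of the two coefficients. It is
  1/4, and it must exceed the power 1/5 lost to the two rough parts. Inside absolute values no
  cancellation of frequency M helps; the gain comes from |cos t| being smaller than 1 on average,
  which frequency 2M detects. All that enters are upper bounds for two Dirichlet series as s tends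
  to 1: a simple pole at frequency 0 and boundedness at frequency 2M. Both follow from the
  self-similarity of the lattice under multiplication by 1 + 2i. Gaussian integers of odd norm are
  normalised to be 1 modulo 2. This leaves only the units 1 and -1, is closed under products, and is
  still a translated lattice. The coefficients are unbounded, so rarity of the exceptional primes
  must be paired with a moment bound; a fourth moment with a crude power of log x is enough because
  Rankin's trick saves an even larger power.\<close>

definition gauss :: "complex set" where
  "gauss = {z. Re z \<in> \<int> \<and> Im z \<in> \<int>}"

lemma gauss_simps [simp, intro]:
  "0 \<in> gauss" "1 \<in> gauss" "\<i> \<in> gauss" "of_nat n \<in> gauss" "of_int k \<in> gauss"
  "z \<in> gauss \<Longrightarrow> - z \<in> gauss" "z \<in> gauss \<Longrightarrow> cnj z \<in> gauss"
  "z \<in> gauss \<Longrightarrow> w \<in> gauss \<Longrightarrow> z + w \<in> gauss"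
  "z \<in> gauss \<Longrightarrow> w \<in> gauss \<Longrightarrow> z - w \<in> gauss"
  "z \<in> gauss \<Longrightarrow> w \<in> gauss \<Longrightarrow> z * w \<in> gauss"
  by (auto simp: gauss_def)

section \<open>Norms, division with remainder and greatest common divisors\<close>

lemma gauss_norm_nat:
  assumes "z \<in> gauss" obtains k :: nat where "(cmod z)^2 = real k"
proof -
  from assms obtain a b :: int where "Re z = a" "Im z = b"
    by (auto simp: gauss_def elim!: Ints_cases)
  hence "(cmod z)^2 = real (nat (a^2 + b^2))" by (simp add: cmod_power2)
  thus ?thesis using that by blast
qed

text \<open>Rounding both coordinates of \<open>z / w\<close> moves it by at most sqrt(1/2) < 1;
  multiplying back by \<open>w\<close> gives the remainder.\<close>

lemma gauss_euclid:
  assumes "z \<in> gauss" "w \<in> gauss" "w \<noteq> 0"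
  shows "\<exists>q\<in>gauss. cmod (z - q * w) < cmod w"
proof -
  define t where "t = z / w"
  define q where "q = Complex (of_int (round (Re t))) (of_int (round (Im t)))"
  have q: "q \<in> gauss" by (simp add: q_def gauss_def)
  have "\<bar>Re (t - q)\<bar> \<le> 1/2" "\<bar>Im (t - q)\<bar> \<le> 1/2"
    using of_int_round_abs_le[of "Re t"] of_int_round_abs_le[of "Im t"]
    by (simp_all add: q_def abs_minus_commute)
  hence "(Re (t - q))^2 \<le> (1/2)^2" "(Im (t - q))^2 \<le> (1/2)^2"
    by (metis abs_ge_zero power2_abs power_mono)+
  hence "(cmod (t - q))^2 < 1^2"
    unfolding cmod_power2 by (simp add: power2_eq_square)
  hence "cmod (t - q) < 1" by (rule power2_less_imp_less) simp
  moreover have "z - q * w = (t - q) * w" using assms by (simp add: t_def field_simps)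
  ultimately show ?thesis using q assms by (auto simp: norm_mult intro!: bexI[of _ q])
qed

text \<open>A nonzero element of least norm in the ideal generated by \<open>u\<close> and
  \<open>v\<close> divides every element of it, since a nonzero remainder would have smaller
  norm.\<close>

lemma gauss_bezout:
  assumes "u \<in> gauss" "v \<in> gauss" "u \<noteq> 0"
  obtains d x y e f where "d \<in> gauss" "x \<in> gauss" "y \<in> gauss" "e \<in> gauss" "f \<in> gauss"
    "d = u * x + v * y" "u = d * e" "v = d * f" "d \<noteq> 0"
proof -
  define I where "I = {u * x + v * y | x y. x \<in> gauss \<and> y \<in> gauss}"
  define P where "P k \<longleftrightarrow> (\<exists>d\<in>I. d \<noteq> 0 \<and> (cmod d)^2 = real k)" for k
  have I: "I \<subseteq> gauss" using assms by (auto simp: I_def)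
  have uI: "u \<in> I" unfolding I_def using assms by (intro CollectI exI[of _ 1] exI[of _ 0]) auto
  have vI: "v \<in> I" unfolding I_def using assms by (intro CollectI exI[of _ 0] exI[of _ 1]) auto
  have "\<exists>k. P k" using gauss_norm_nat[OF assms(1)] uI assms(3) unfolding P_def by metis
  then obtain k where k: "P k" "\<And>m. m < k \<Longrightarrow> \<not> P m"
    using exists_least_iff[of P] by blast
  then obtain d where d: "d \<in> I" "d \<noteq> 0" "(cmod d)^2 = real k" by (auto simp: P_def)
  have Isub: "s - q * d \<in> I" if sI: "s \<in> I" and qg: "q \<in> gauss" for s q
  proof -
    obtain x y where 1: "s = u * x + v * y" "x \<in> gauss" "y \<in> gauss"
      using sI unfolding I_def by blast
    obtain x' y' where 2: "d = u * x' + v * y'" "x' \<in> gauss" "y' \<in> gauss"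
      using d unfolding I_def by blast
    have "s - q * d = u * (x - q * x') + v * (y - q * y')" by (simp add: 1(1) 2(1) algebra_simps)
    thus ?thesis using 1(2,3) 2(2,3) qg gauss_simps unfolding I_def by blast
  qed
  have dvd: "\<exists>q\<in>gauss. s = d * q" if s: "s \<in> I" for s
  proof -
    obtain q where q: "q \<in> gauss" "cmod (s - q * d) < cmod d"
      using gauss_euclid[of s d] s d I by auto
    have "s - q * d = 0"
    proof (rule ccontr)
      assume *: "s - q * d \<noteq> 0"
      have in_I: "s - q * d \<in> I" using Isub s q by auto
      obtain m where m: "(cmod (s - q * d))^2 = real m"
        using gauss_norm_nat in_I I by blast
      hence "P m" unfolding P_def using in_I * by blast
      moreover have "real m < real k"
        unfolding m[symmetric] d(3)[symmetric] using q(2) by (intro power_strict_mono) auto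
      ultimately show False using k by auto
    qed
    thus ?thesis using q by (auto simp: mult.commute)
  qed
  obtain x y where xy: "d = u * x + v * y" "x \<in> gauss" "y \<in> gauss"
    using d unfolding I_def by blast
  obtain e f where "e \<in> gauss" "f \<in> gauss" "u = d * e" "v = d * f"
    using dvd[OF uI] dvd[OF vI] by blast
  thus ?thesis using that[of d x y e f] xy d I by blast
qed

lemma gauss_of_nat_dvd:
  assumes "of_nat n = of_nat m * c" "c \<in> gauss" shows "m dvd n"
proof -
  obtain k :: int where k: "Re c = of_int k" using assms by (auto simp: gauss_def elim!: Ints_cases)
  have "real n = real m * of_int k" using arg_cong[OF assms(1), of Re] k by simp
  hence "of_int (int n) = (of_int (int m * k) :: real)" by simp
  hence "int n = int m * k" unfolding of_int_eq_iff .
  hence "int m dvd int n" by simp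
  thus ?thesis by simp
qed

lemma complex_mult_cnj_nat: "(cmod z)^2 = real n \<Longrightarrow> z * cnj z = of_nat n"
  by (metis complex_norm_square of_real_of_nat_eq)

text \<open>Here \<open>d\<close> is a greatest common divisor of \<open>u\<close> and
  \<open>a\<close>, so its norm divides the norms of both. Conversely \<open>a dvd D\<close>:
  expanding \<open>d * cnj d\<close> with \<open>d = u * x + a * y\<close>, every term carries a
  factor \<open>a\<close>, the first one because \<open>u * cnj u = a * b\<close>. Coprime splitting
  and the treatment of inert primes both rest on these divisibilities.\<close>

lemma gauss_gcd_norm:
  assumes "u \<in> gauss" "(cmod u)^2 = real (a * b)" "a > 0" "b > 0"
  obtains d e f D where "d \<in> gauss" "e \<in> gauss" "f \<in> gauss" "u = d * e" "of_nat a = d * f"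
    "(cmod d)^2 = real D" "a dvd D" "D dvd a * b" "D dvd a * a"
proof -
  have "u \<noteq> 0" using assms by auto
  then obtain d x y e f where d: "d \<in> gauss" "x \<in> gauss" "y \<in> gauss" "e \<in> gauss" "f \<in> gauss"
    "d = u * x + of_nat a * y" "u = d * e" "of_nat a = d * f" "d \<noteq> 0"
    by (rule gauss_bezout[OF assms(1) gauss_simps(4)])
  obtain D E F where D: "(cmod d)^2 = real D" "(cmod e)^2 = real E" "(cmod f)^2 = real F"
    using gauss_norm_nat d by metis
  have "real (a * b) = real (D * E)"
    unfolding assms(2)[symmetric] d(7) by (simp add: norm_mult power_mult_distrib D)
  hence 1: "a * b = D * E" by (simp only: of_nat_eq_iff)
  have "(cmod (of_nat a))^2 = real (D * F)"
    unfolding d(8) by (simp add: norm_mult power_mult_distrib D)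
  hence "real (a * a) = real (D * F)" by (simp add: power2_eq_square)
  hence 2: "a * a = D * F" by (simp only: of_nat_eq_iff)
  have "of_nat D = d * cnj d" using complex_mult_cnj_nat[OF D(1)] by simp
  also have "\<dots> = (u * cnj u) * (x * cnj x)
      + of_nat a * (u * x * cnj y + y * cnj u * cnj x + of_nat a * y * cnj y)"
    unfolding d(6) by (simp add: algebra_simps)
  also have "u * cnj u = of_nat a * of_nat b"
    using complex_mult_cnj_nat[OF assms(2)] by simp
  finally have "of_nat D = of_nat a * (of_nat b * (x * cnj x) +
      (u * x * cnj y + y * cnj u * cnj x + of_nat a * y * cnj y))"
    by (simp add: algebra_simps)
  hence aD: "a dvd D" by (rule gauss_of_nat_dvd) (use assms(1) d(1-3) in simp)
  show ?thesis by (rule that[OF d(1,4,5,7,8) D(1) aD]) (simp_all add: 1 2)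
qed

text \<open>The norm of gcd(u, a) is a multiple \<open>a * k\<close> of \<open>a\<close>, where
  \<open>k\<close> divides both \<open>a\<close> and \<open>b\<close>; hence it is exactly
  \<open>a\<close>, and the cofactor takes the rest.\<close>

lemma gauss_factor_coprime:
  assumes "u \<in> gauss" "(cmod u)^2 = real (a * b)" "a > 0" "b > 0" "coprime a b"
  obtains z w where "z \<in> gauss" "w \<in> gauss" "u = z * w" "(cmod z)^2 = real a" "(cmod w)^2 = real b"
proof -
  obtain d e f D where d: "d \<in> gauss" "e \<in> gauss" "f \<in> gauss" "u = d * e" "of_nat a = d * f"
    "(cmod d)^2 = real D" "a dvd D" "D dvd a * b" "D dvd a * a"
    using gauss_gcd_norm[OF assms(1-4)] by blast
  obtain k where k: "D = a * k" using d by auto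
  have "k dvd b" "k dvd a" using d(8,9) assms(3) unfolding k by auto
  hence "k = 1" using assms(5) by (metis coprime_common_divisor_nat nat_dvd_1_iff_1 coprime_def)
  hence D: "D = a" using k by simp
  have "real a * (cmod e)^2 = real a * real b"
    using assms(2) d(6) unfolding d(4) D by (simp add: norm_mult power_mult_distrib)
  hence "(cmod e)^2 = real b" using assms(3) by simp
  thus ?thesis using that d D by blast
qed

text \<open>An element of prime norm is irreducible, so its gcd \<open>d\<close> with
  \<open>u\<close> is a unit (\<open>D = 1\<close>, and Bezout shows that it divides
  \<open>v\<close>) or an associate of it (\<open>E = 1\<close>, and it divides
  \<open>u\<close>).\<close>

lemma gauss_prime_dvd_mult:
  assumes "\<pi> \<in> gauss" "(cmod \<pi>)^2 = real q" "prime q" "u \<in> gauss" "v \<in> gauss"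
    "t \<in> gauss" "u * v = \<pi> * t"
  shows "(\<exists>c\<in>gauss. u = \<pi> * c) \<or> (\<exists>c\<in>gauss. v = \<pi> * c)"
proof -
  have "\<pi> \<noteq> 0" using assms(2,3) by (auto simp: prime_gt_0_nat)
  then obtain d x y e f where d: "d \<in> gauss" "x \<in> gauss" "y \<in> gauss" "e \<in> gauss" "f \<in> gauss"
    "d = \<pi> * x + u * y" "\<pi> = d * e" "u = d * f" "d \<noteq> 0"
    by (rule gauss_bezout[OF assms(1,4)])
  obtain D E where D: "(cmod d)^2 = real D" "(cmod e)^2 = real E" using gauss_norm_nat d by metis
  have "real q = real (D * E)"
    unfolding assms(2)[symmetric] d(7) by (simp add: norm_mult power_mult_distrib D)
  hence "q = D * E" by (simp only: of_nat_eq_iff)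
  hence "D = 1 \<or> E = 1" using assms(3) by (metis prime_nat_iff dvd_triv_left mult.right_neutral mult_cancel1 not_prime_0)
  thus ?thesis
  proof
    assume "D = 1"
    hence 1: "d * cnj d = 1" using complex_mult_cnj_nat[OF D(1)] by simp
    have "v = v * (d * cnj d)" using 1 by simp
    also have "\<dots> = \<pi> * (x * v * cnj d + t * y * cnj d)"
      by (subst d(6)) (use assms(7) in \<open>simp add: algebra_simps\<close>)
    finally show ?thesis using d(1-5) assms(1,4-6) by (intro disjI2 bexI[of _ "x * v * cnj d + t * y * cnj d"]) auto
  next
    assume "E = 1"
    hence 1: "e * cnj e = 1" using complex_mult_cnj_nat[OF D(2)] by simp
    have "u = d * (e * cnj e) * f" using d(8) 1 by simp
    also have "\<dots> = \<pi> * (cnj e * f)" by (subst d(7)) (simp add: algebra_simps)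
    finally show ?thesis using d(1-5) assms(1,4-6) by (intro disjI1 bexI[of _ "cnj e * f"]) auto
  qed
qed

section \<open>Gaussian integers congruent to 1 modulo 2\<close>

definition odd_gauss :: "complex set" where
  "odd_gauss = {Complex (of_int (2 * a + 1)) (of_int (2 * b)) | a b. True}"

lemma odd_gaussI: "Re z = of_int a \<Longrightarrow> Im z = of_int b \<Longrightarrow> odd a \<Longrightarrow> even b \<Longrightarrow> z \<in> odd_gauss"
  unfolding odd_gauss_def by (auto simp: complex_eq_iff elim!: oddE evenE)

lemma odd_gaussE:
  assumes "z \<in> odd_gauss" obtains a b where "Re z = of_int a" "Im z = of_int b" "odd a" "even b"
  using assms that unfolding odd_gauss_def by (auto simp del: of_int_add of_int_mult)

lemma odd_gauss_imp_gauss: "z \<in> odd_gauss \<Longrightarrow> z \<in> gauss"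
  by (auto elim!: odd_gaussE simp: gauss_def)

lemma odd_gauss_simps [simp, intro]:
  "1 \<in> odd_gauss" "z \<in> odd_gauss \<Longrightarrow> - z \<in> odd_gauss" "z \<in> odd_gauss \<Longrightarrow> cnj z \<in> odd_gauss"
  "0 \<notin> odd_gauss" "odd n \<Longrightarrow> of_nat n \<in> odd_gauss"
proof -
  show "1 \<in> odd_gauss" by (rule odd_gaussI[of _ 1 0]) auto
  show "0 \<notin> odd_gauss" by (auto elim!: odd_gaussE)
  show "of_nat n \<in> odd_gauss" if "odd n" by (rule odd_gaussI[of _ "int n" 0]) (use that in auto)
  assume "z \<in> odd_gauss"
  then obtain a b where "Re z = of_int a" "Im z = of_int b" "odd a" "even b" by (elim odd_gaussE)
  thus "- z \<in> odd_gauss" "cnj z \<in> odd_gauss"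
    by (auto intro: odd_gaussI[of _ "-a" "-b"] odd_gaussI[of _ "a" "-b"])
qed

lemma odd_gauss_mult [simp, intro]:
  assumes "z \<in> odd_gauss" "w \<in> odd_gauss" shows "z * w \<in> odd_gauss"
proof -
  obtain a b where 1: "Re z = of_int a" "Im z = of_int b" "odd a" "even b" using assms by (elim odd_gaussE)
  obtain c d where 2: "Re w = of_int c" "Im w = of_int d" "odd c" "even d" using assms by (elim odd_gaussE)
  show ?thesis by (rule odd_gaussI[of _ "a * c - b * d" "a * d + b * c"]) (use 1 2 in auto)
qed

lemma odd_gauss_quotient:
  assumes "z = w * t" "z \<in> odd_gauss" "w \<in> odd_gauss" "t \<in> gauss" shows "t \<in> odd_gauss"
proof -
  obtain a b where 1: "Re z = of_int a" "Im z = of_int b" "odd a" "even b" using assms by (elim odd_gaussE)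
  obtain c d where 2: "Re w = of_int c" "Im w = of_int d" "odd c" "even d" using assms by (elim odd_gaussE)
  obtain x y where 3: "Re t = of_int x" "Im t = of_int y"
    using assms(4) by (auto simp: gauss_def elim!: Ints_cases)
  have "real_of_int a = of_int (c * x - d * y)" using 1 2 3 assms(1) by auto
  hence a: "a = c * x - d * y" by (simp only: of_int_eq_iff)
  have "real_of_int b = of_int (c * y + d * x)" using 1 2 3 assms(1) by auto
  hence b: "b = c * y + d * x" by (simp only: of_int_eq_iff)
  show ?thesis by (rule odd_gaussI[of _ x y]) (use 1 2 3 a b in auto)
qed

text \<open>An odd sum of two squares has exactly one odd summand, and multiplication by \<i>
  exchanges the coordinates up to sign.\<close>

lemma gauss_odd_norm_cases:
  assumes "z \<in> gauss" "(cmod z)^2 = real n" "odd n"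
  shows "z \<in> odd_gauss \<or> \<i> * z \<in> odd_gauss"
proof -
  obtain x y where 3: "Re z = of_int x" "Im z = of_int y"
    using assms(1) by (auto simp: gauss_def elim!: Ints_cases)
  have "of_int (x^2 + y^2) = real_of_int (int n)" using assms(2) 3 by (simp add: cmod_power2)
  hence "x^2 + y^2 = int n" by (simp only: of_int_eq_iff)
  hence "odd (x^2 + y^2)" using assms(3) by simp
  hence "odd x \<and> even y \<or> even x \<and> odd y" by auto
  thus ?thesis using 3 odd_gaussI[of z x y] odd_gaussI[of "\<i> * z" "-y" x] by auto
qed

lemma odd_gauss_unit:
  assumes "t \<in> odd_gauss" "cmod t = 1" shows "t = 1 \<or> t = -1"
proof -
  obtain a b where 1: "Re t = of_int a" "Im t = of_int b" "odd a" "even b" using assms by (elim odd_gaussE)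
  have "(cmod t)^2 = 1" using assms by simp
  hence "of_int (a^2 + b^2) = real_of_int 1" using 1 by (simp add: cmod_power2)
  hence *: "a^2 + b^2 = 1" by (simp only: of_int_eq_iff)
  have "a^2 \<ge> 1" using 1(3) by (cases "a = 0") (auto simp: int_one_le_iff_zero_less)
  hence "b^2 \<le> 0" using * by linarith
  hence "b = 0" by simp
  hence "a = 1 \<or> a = -1" using * by (simp add: power2_eq_1_iff)
  thus ?thesis using 1 \<open>b = 0\<close> by (auto simp: complex_eq_iff)
qed

lemma odd_gauss_norm_ge_1: assumes "z \<in> odd_gauss" shows "cmod z \<ge> 1"
proof -
  obtain a b where 1: "Re z = of_int a" "Im z = of_int b" "odd a" "even b" using assms by (elim odd_gaussE)
  have "\<bar>a\<bar> \<ge> 1" using 1(3) by (cases "a = 0") auto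
  hence "\<bar>Re z\<bar> \<ge> 1" using 1 by simp
  thus ?thesis using abs_Re_le_cmod[of z] by linarith
qed

section \<open>Points of given norm and their unique factorisation\<close>

definition osphere :: "nat \<Rightarrow> complex set" where
  "osphere n = {z \<in> odd_gauss. (cmod z)^2 = real n}"

lemma abs_le_square_int: "\<bar>x\<bar> \<le> x^2" for x :: int
proof (cases "x = 0")
  case False
  hence "\<bar>x\<bar> * 1 \<le> \<bar>x\<bar> * \<bar>x\<bar>" by (intro mult_left_mono) auto
  thus ?thesis by (simp add: power2_eq_square)
qed auto

lemma finite_osphere [simp, intro]: "finite (osphere n)"
proof -
  have "osphere n \<subseteq> (\<lambda>(a,b). Complex (of_int a) (of_int b)) ` ({-int n..int n} \<times> {-int n..int n})"
  proof
    fix z assume z: "z \<in> osphere n"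
    then obtain a b where 1: "Re z = of_int a" "Im z = of_int b" by (auto simp: osphere_def elim: odd_gaussE)
    have "of_int (a^2 + b^2) = real_of_int (int n)" using z 1 by (simp add: cmod_power2 osphere_def)
    hence *: "a^2 + b^2 = int n" by (simp only: of_int_eq_iff)
    have "\<bar>a\<bar> \<le> int n" "\<bar>b\<bar> \<le> int n" using abs_le_square_int[of a] abs_le_square_int[of b] * by (auto intro: order_trans)
    hence "(a,b) \<in> {-int n..int n} \<times> {-int n..int n}" by auto
    thus "z \<in> (\<lambda>(a,b). Complex (of_int a) (of_int b)) ` ({-int n..int n} \<times> {-int n..int n})"
      using 1 by (intro image_eqI[of _ _ "(a,b)"]) (auto simp: complex_eq_iff)
  qed
  thus ?thesis by (rule finite_subset) auto
qed

lemma osphere_even: "even n \<Longrightarrow> osphere n = {}"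
proof (rule ccontr)
  assume n: "even n" "osphere n \<noteq> {}"
  then obtain z where z: "z \<in> osphere n" by auto
  then obtain a b where 1: "Re z = of_int a" "Im z = of_int b" "odd a" "even b" by (auto simp: osphere_def elim: odd_gaussE)
  have "of_int (a^2 + b^2) = real_of_int (int n)" using z 1 by (simp add: cmod_power2 osphere_def)
  hence "a^2 + b^2 = int n" by (simp only: of_int_eq_iff)
  hence "even (a^2 + b^2)" using n by simp
  thus False using 1 by simp
qed

lemma osphere_1: "osphere 1 = {1, -1}"
proof -
  have "cmod z = 1" if "(cmod z)^2 = 1" for z
    using that norm_ge_zero[of z] by (auto simp: power2_eq_1_iff simp del: norm_ge_zero)
  thus ?thesis using odd_gauss_unit by (auto simp: osphere_def)
qed

lemma osphere_mult: "z \<in> osphere a \<Longrightarrow> w \<in> osphere b \<Longrightarrow> z * w \<in> osphere (a * b)"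
  by (auto simp: osphere_def norm_mult power_mult_distrib)

lemma osphere_uminus: "z \<in> osphere a \<Longrightarrow> - z \<in> osphere a"
  and osphere_cnj: "z \<in> osphere a \<Longrightarrow> cnj z \<in> osphere a"
  by (auto simp: osphere_def)

lemma osphere_nonzero: "z \<in> osphere a \<Longrightarrow> z \<noteq> 0" by (auto simp: osphere_def)

text \<open>The splitting by norms is unique up to a unit; a factor \<i> is shifted from one side to
  the other when needed, so that both factors are 1 modulo 2.\<close>

lemma osphere_factor:
  assumes "u \<in> osphere (a * b)" "a > 0" "b > 0" "coprime a b"
  obtains z w where "z \<in> osphere a" "w \<in> osphere b" "u = z * w"
proof -
  have odd: "odd (a * b)" using assms(1) osphere_even by fastforce
  obtain z w where zw: "z \<in> gauss" "w \<in> gauss" "u = z * w" "(cmod z)^2 = real a" "(cmod w)^2 = real b"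
    using gauss_factor_coprime[of u a b] assms odd_gauss_imp_gauss by (auto simp: osphere_def)
  from gauss_odd_norm_cases[OF zw(1,4)] odd consider "z \<in> odd_gauss" | "\<i> * z \<in> odd_gauss" by auto
  thus ?thesis
  proof cases
    case 1
    hence "w \<in> odd_gauss" using odd_gauss_quotient[of u z w] zw assms by (auto simp: osphere_def)
    thus ?thesis using that[of z w] zw 1 by (auto simp: osphere_def)
  next
    case 2
    have u: "u = (\<i> * z) * (- \<i> * w)" using zw by (simp add: algebra_simps)
    hence "- \<i> * w \<in> odd_gauss" using odd_gauss_quotient[of u "\<i> * z" "- \<i> * w"] zw 2 assms
      by (auto simp: osphere_def)
    thus ?thesis using that[of "\<i> * z" "- \<i> * w"] zw 2 u by (auto simp: osphere_def norm_mult)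
  qed
qed

text \<open>The integer relation \<open>x * a + y * b = 1\<close> exhibits \<open>z' / z\<close> as
  a Gaussian integer \<open>t\<close>. It has modulus 1 and is 1 modulo 2, so it is 1 or -1.\<close>

lemma osphere_factor_unique:
  assumes "z \<in> osphere a" "w \<in> osphere b" "z' \<in> osphere a" "w' \<in> osphere b" "z * w = z' * w'" "coprime a b"
  shows "(z' = z \<and> w' = w) \<or> (z' = - z \<and> w' = - w)"
proof -
  obtain x y :: int where xy: "x * int a + y * int b = 1"
    using assms(6) by (metis bezout_int coprime_iff_gcd_eq_1 coprime_int_iff)
  have 1: "of_int x * of_nat a + of_int y * of_nat b = (1 :: complex)"
    using arg_cong[OF xy, of "of_int :: int \<Rightarrow> complex"] by simp
  have a: "z * cnj z = of_nat a" and b: "w' * cnj w' = of_nat b"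
    using assms by (auto intro!: complex_mult_cnj_nat simp: osphere_def)
  define t where "t = z' * cnj z * of_int x + w * cnj w' * of_int y"
  have "z' = z' * (of_int x * (z * cnj z) + of_int y * (w' * cnj w'))" using 1 a b by simp
  also have "\<dots> = z * (z' * cnj z * of_int x) + (z' * w') * cnj w' * of_int y"
    by (simp add: algebra_simps)
  also have "\<dots> = z * t" unfolding assms(5)[symmetric] t_def by (simp add: algebra_simps)
  finally have zt: "z' = z * t" .
  have "z \<in> gauss" "z' \<in> gauss" "w \<in> gauss" "w' \<in> gauss"
    using assms(1-4) odd_gauss_imp_gauss by (auto simp: osphere_def)
  hence "t \<in> gauss" unfolding t_def by (intro gauss_simps)
  hence todd: "t \<in> odd_gauss" using odd_gauss_quotient[OF zt] assms by (auto simp: osphere_def)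
  have "cmod z' = cmod z" by (rule power2_eq_imp_eq) (use assms in \<open>auto simp: osphere_def\<close>)
  hence "cmod t = 1" using osphere_nonzero[OF assms(1)] by (simp add: zt norm_mult)
  hence "t = 1 \<or> t = -1" using odd_gauss_unit todd by auto
  thus ?thesis using zt assms(5) osphere_nonzero[OF assms(1)] by auto
qed

text \<open>Multiplication maps pairs of points onto \<open>osphere (a * b)\<close> and is exactly
  two-to-one, with fibres {(z, w), (-z, -w)}.\<close>

lemma osphere_prod_sum:
  fixes f :: "complex \<Rightarrow> complex"
  assumes "a > 0" "b > 0" "coprime a b"
  shows "(\<Sum>z\<in>osphere a. \<Sum>w\<in>osphere b. f (z * w)) = 2 * (\<Sum>u\<in>osphere (a * b). f u)"
proof -
  let ?S = "osphere a \<times> osphere b"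
  have "(\<Sum>z\<in>osphere a. \<Sum>w\<in>osphere b. f (z * w)) = (\<Sum>p\<in>?S. f (fst p * snd p))"
    by (simp add: sum.cartesian_product case_prod_unfold)
  also have "\<dots> = (\<Sum>u\<in>osphere (a * b). \<Sum>p\<in>{p\<in>?S. fst p * snd p = u}. f (fst p * snd p))"
    by (rule sum.group[symmetric]) (auto intro: osphere_mult)
  also have "\<dots> = (\<Sum>u\<in>osphere (a * b). 2 * f u)"
  proof (rule sum.cong[OF refl])
    fix u assume u: "u \<in> osphere (a * b)"
    obtain z w where zw: "z \<in> osphere a" "w \<in> osphere b" "u = z * w" using osphere_factor[OF u assms] .
    have eq: "{p\<in>?S. fst p * snd p = u} = {(z, w), (-z, -w)}"
    proof (rule Set.set_eqI)
      fix p :: "complex \<times> complex"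
      obtain z' w' where p: "p = (z', w')" by (cases p)
      show "p \<in> {p\<in>?S. fst p * snd p = u} \<longleftrightarrow> p \<in> {(z, w), (-z, -w)}"
        using zw osphere_uminus[OF zw(1)] osphere_uminus[OF zw(2)]
          osphere_factor_unique[OF zw(1,2), of z' w'] assms(3)
        unfolding p by auto
    qed
    have "(z, w) \<noteq> (-z, -w)" using osphere_nonzero[OF zw(1)] by auto
    thus "(\<Sum>p\<in>{p\<in>?S. fst p * snd p = u}. f (fst p * snd p)) = 2 * f u"
      unfolding eq by (simp add: zw(3))
  qed
  finally show ?thesis by (simp add: sum_distrib_left)
qed

section \<open>The angular coefficients\<close>

text \<open>Dividing by 2 accounts for the units 1 and -1, so that for even \<open>M\<close> the
  function is multiplicative with value 1 at 1. Passing to real parts loses nothing because the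
  points come in conjugate pairs.\<close>

definition hecke :: "nat \<Rightarrow> nat \<Rightarrow> real" where
  "hecke M n = (\<Sum>z\<in>osphere n. Re (sgn z ^ M)) / 2"

lemma sum_osphere_sgn: "(\<Sum>z\<in>osphere n. sgn z ^ M) = of_real (2 * hecke M n)"
proof -
  have "cnj (\<Sum>z\<in>osphere n. sgn z ^ M) = (\<Sum>z\<in>osphere n. sgn (cnj z) ^ M)"
    by (simp add: sgn_eq)
  also have "\<dots> = (\<Sum>z\<in>osphere n. sgn z ^ M)"
    by (rule sum.reindex_bij_witness[of _ cnj cnj]) (auto intro: osphere_cnj)
  finally have "Im (\<Sum>z\<in>osphere n. sgn z ^ M) = 0"
    by (metis complex_cnj_cancel_iff Reals_cnj_iff complex_is_Real_iff)
  thus ?thesis by (simp add: hecke_def complex_eq_iff)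
qed

lemma hecke_mult:
  assumes "a > 0" "b > 0" "coprime a b" shows "hecke M (a * b) = hecke M a * hecke M b"
proof -
  have "complex_of_real (2 * (2 * hecke M (a * b))) = 2 * (\<Sum>u\<in>osphere (a * b). sgn u ^ M)"
    by (simp add: sum_osphere_sgn)
  also have "\<dots> = (\<Sum>z\<in>osphere a. sgn z ^ M) * (\<Sum>w\<in>osphere b. sgn w ^ M)"
    by (subst osphere_prod_sum[OF assms, symmetric])
       (simp add: sgn_mult power_mult_distrib sum_product)
  also have "\<dots> = complex_of_real (2 * hecke M a * (2 * hecke M b))" by (simp add: sum_osphere_sgn)
  finally show ?thesis unfolding of_real_eq_iff by simp
qed

lemma hecke_1: "even M \<Longrightarrow> hecke M 1 = 1"
  unfolding hecke_def osphere_1 by simp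

lemma hecke_abs_le: "\<bar>hecke M n\<bar> \<le> card (osphere n) / 2"
proof -
  have "\<bar>Re (sgn z ^ M)\<bar> \<le> 1" if "z \<in> osphere n" for z
    using abs_Re_le_cmod[of "sgn z ^ M"] osphere_nonzero[OF that] by (simp add: norm_power norm_sgn)
  hence "\<bar>\<Sum>z\<in>osphere n. Re (sgn z ^ M)\<bar> \<le> (\<Sum>z\<in>osphere n. 1)"
    by (intro order_trans[OF sum_abs] sum_mono)
  thus ?thesis by (simp add: hecke_def)
qed

lemma hecke_0: "hecke 0 n = card (osphere n) / 2" by (simp add: hecke_def)

section \<open>Prime powers: split and inert primes\<close>

text \<open>The prime \<pi> divides \<open>u * cnj u\<close>, a power of \<open>q\<close>; not
  dividing \<open>u\<close>, it divides \<open>cnj u\<close>, so \<open>cnj \<pi>\<close> divides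
  \<open>u\<close>. Cancelling it lowers the exponent by one and keeps the assumption.\<close>

lemma osphere_prime_power_not_dvd:
  assumes "prime q" "\<pi> \<in> osphere q" "u \<in> osphere (q ^ k)" "\<not> (\<exists>c\<in>gauss. u = \<pi> * c)"
  shows "u = cnj \<pi> ^ k \<or> u = - (cnj \<pi> ^ k)"
  using assms(3,4)
proof (induction k arbitrary: u)
  case 0
  thus ?case using osphere_1 by auto
next
  case (Suc k)
  have \<pi>: "\<pi> \<in> gauss" "\<pi> \<in> odd_gauss" "(cmod \<pi>)^2 = real q"
    using assms(2) odd_gauss_imp_gauss by (auto simp: osphere_def)
  have u: "u \<in> gauss" "u \<in> odd_gauss" "(cmod u)^2 = real (q ^ Suc k)"
    using Suc.prems(1) odd_gauss_imp_gauss unfolding osphere_def by blast+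
  have eq: "u * cnj u = \<pi> * (cnj \<pi> * of_nat (q ^ k))"
    using complex_mult_cnj_nat[OF u(3)] complex_mult_cnj_nat[OF \<pi>(3)] by simp
  have "(\<exists>c\<in>gauss. u = \<pi> * c) \<or> (\<exists>c\<in>gauss. cnj u = \<pi> * c)"
    by (rule gauss_prime_dvd_mult[OF \<pi>(1,3) assms(1) u(1) _ _ eq])
       (use u(1) \<pi>(1) in \<open>simp_all del: of_nat_power\<close>)
  then obtain c where c: "c \<in> gauss" "cnj u = \<pi> * c" using Suc.prems(2) by blast
  have uc: "u = cnj \<pi> * cnj c" using arg_cong[OF c(2), of cnj] by simp
  have c_odd: "cnj c \<in> odd_gauss"
    by (rule odd_gauss_quotient[OF uc u(2)]) (use \<pi> c in auto)
  have "real q * (cmod (cnj c))^2 = real q * real (q ^ k)"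
    using u(3) \<pi>(3) unfolding uc by (simp add: norm_mult power_mult_distrib)
  hence "(cmod (cnj c))^2 = real (q ^ k)" using prime_gt_0_nat[OF assms(1)] by simp
  hence c_in: "cnj c \<in> osphere (q ^ k)" using c_odd by (simp add: osphere_def)
  have "\<not> (\<exists>d\<in>gauss. cnj c = \<pi> * d)"
  proof
    assume "\<exists>d\<in>gauss. cnj c = \<pi> * d"
    then obtain d where d: "d \<in> gauss" "cnj c = \<pi> * d" by blast
    have "u = \<pi> * (cnj \<pi> * d)" unfolding uc d(2) by (simp add: mult_ac)
    thus False using Suc.prems(2) d(1) \<pi>(1) by blast
  qed
  from Suc.IH[OF c_in this] show ?case unfolding uc by auto
qed

lemma osphere_mult_cancel:
  assumes "u = z * w" "u \<in> osphere (a * b)" "z \<in> osphere a" "w \<in> gauss" "a > 0"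
  shows "w \<in> osphere b"
proof -
  have "w \<in> odd_gauss" using odd_gauss_quotient[OF assms(1)] assms(2-4) by (auto simp: osphere_def)
  moreover have "real a * (cmod w)^2 = real a * real b"
    using assms(2,3) unfolding assms(1) by (simp add: osphere_def norm_mult power_mult_distrib)
  ultimately show ?thesis using assms(5) by (simp add: osphere_def)
qed

text \<open>With no element of norm \<open>q\<close> available, the gcd of \<open>u\<close> and
  \<open>q\<close> has norm \<open>q * q\<close>, hence is \<open>q\<close> up to a unit, and
  \<open>q\<close> divides \<open>u\<close>.\<close>

lemma osphere_inert:
  assumes "prime q" "odd q" "osphere q = {}" "u \<in> osphere (q ^ Suc k)"
  obtains j u' where "k = Suc j" "u' \<in> osphere (q ^ j)" "u = of_nat q * u'"
proof -
  have q: "q > 1" using assms(1) prime_gt_1_nat by blast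
  have u: "u \<in> gauss" "u \<in> odd_gauss" "(cmod u)^2 = real (q * q ^ k)"
    using assms(4) odd_gauss_imp_gauss unfolding osphere_def by auto
  have q0: "0 < q" "0 < q ^ k" using q by auto
  obtain d e f D where d: "d \<in> gauss" "e \<in> gauss" "f \<in> gauss" "u = d * e" "of_nat q = d * f"
    "(cmod d)^2 = real D" "q dvd D" "D dvd q * q ^ k" "D dvd q * q"
    by (rule gauss_gcd_norm[OF u(1,3) q0])
  obtain m where m: "D = q * m" using d(7) by blast
  have "m dvd q" using d(9) q0 unfolding m by auto
  hence "m = 1 \<or> m = q" using assms(1) by (simp add: prime_nat_iff)
  \<comment> \<open>\<open>m = 1\<close> would make the norm of \<open>d\<close> equal to
    \<open>q\<close>, and then \<open>d\<close> or \<open>\<i> * d\<close> would be a point of the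
    empty set \<open>osphere q\<close>.\<close>
  moreover have "m \<noteq> 1"
  proof
    assume "m = 1"
    hence dn: "(cmod d)^2 = real q" using d(6) m by simp
    from gauss_odd_norm_cases[OF d(1) dn assms(2)] have "d \<in> osphere q \<or> \<i> * d \<in> osphere q"
      using dn by (auto simp: osphere_def norm_mult)
    thus False using assms(3) by blast
  qed
  ultimately have D: "D = q * q" using m by simp
  have "(cmod (of_nat q))^2 = (real q)^2 * (cmod f)^2"
    unfolding d(5) using d(6) D by (simp add: norm_mult power_mult_distrib power2_eq_square)
  hence "(cmod f)^2 = real 1" using q0 by simp
  hence ff: "f * cnj f = 1" using complex_mult_cnj_nat[of f 1] by simp
  have "d = d * (f * cnj f)" using ff by simp
  also have "\<dots> = of_nat q * cnj f" unfolding d(5) by (simp add: mult_ac)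
  finally have dq: "d = of_nat q * cnj f" .
  define u' where "u' = cnj f * e"
  have uu': "u = of_nat q * u'" unfolding u'_def d(4) by (subst dq) (simp add: mult_ac)
  have u'g: "u' \<in> gauss" unfolding u'_def using d by (intro gauss_simps)
  hence u'o: "u' \<in> odd_gauss" using odd_gauss_quotient[OF uu' u(2)] assms(2) by auto
  obtain E where E: "(cmod u')^2 = real E" using gauss_norm_nat[OF u'g] .
  have "real (q * q ^ k) = real (q * (q * E))"
    unfolding u(3)[symmetric] uu' using E by (simp add: norm_mult power_mult_distrib power2_eq_square)
  hence "q ^ k = q * E" using q0 by (simp only: of_nat_eq_iff) simp
  moreover have "k \<noteq> 0" using calculation q by (cases k) auto
  ultimately obtain j where j: "k = Suc j" "q ^ j = E" using q0 by (cases k) auto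
  show ?thesis by (rule that[OF j(1) _ uu']) (use u'o E j in \<open>auto simp: osphere_def\<close>)
qed

lemma osphere_inert_Suc_Suc:
  assumes "prime q" "odd q" "osphere q = {}"
  shows "osphere (q ^ Suc (Suc k)) = (\<lambda>u. of_nat q * u) ` osphere (q ^ k)"
proof (rule Set.set_eqI, rule iffI)
  fix u assume "u \<in> osphere (q ^ Suc (Suc k))"
  from osphere_inert[OF assms this] obtain j u' where "Suc k = Suc j" "u' \<in> osphere (q ^ j)" "u = of_nat q * u'" .
  thus "u \<in> (\<lambda>u. of_nat q * u) ` osphere (q ^ k)" by auto
next
  fix u assume "u \<in> (\<lambda>u. of_nat q * u) ` osphere (q ^ k)"
  moreover have "of_nat q \<in> osphere (q * q)" using assms(2) by (auto simp: osphere_def power2_eq_square)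
  ultimately have "u \<in> osphere (q * q * q ^ k)" using osphere_mult by blast
  thus "u \<in> osphere (q ^ Suc (Suc k))" by (simp add: mult_ac)
qed

lemma hecke_inert_nonneg:
  assumes "prime q" "odd q" "osphere q = {}" "even M"
  shows "hecke M (q ^ k) \<ge> 0"
proof (induction k rule: less_induct)
  case (less k)
  consider "k = 0" | "k = 1" | j where "k = Suc (Suc j)" by (metis One_nat_def not0_implies_Suc)
  thus ?case
  proof cases
    case 1 thus ?thesis using hecke_1[OF assms(4)] by simp
  next
    case 2 thus ?thesis using assms(3) by (simp add: hecke_def)
  next
    case 3
    have q: "q \<noteq> 0" using assms(2) by (metis even_zero)
    hence sgn_q: "sgn (of_nat q :: complex) = 1" by (simp add: sgn_eq)
    have "hecke M (q ^ k) = hecke M (q ^ j)"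
      unfolding hecke_def 3 osphere_inert_Suc_Suc[OF assms(1-3)]
      using q by (subst sum.reindex) (auto simp: inj_on_def sgn_mult sgn_q)
    thus ?thesis using less[of j] 3 by simp
  qed
qed

text \<open>In the split case a point is a multiple of \<pi>, counted by the previous exponent, or
  one of two conjugate powers, so each exponent adds at most 2. In the inert case the count repeats
  every two exponents.\<close>

lemma card_osphere_prime_power:
  assumes "prime q" shows "card (osphere (q ^ k)) \<le> 2 * (k + 1)"
proof (cases "odd q")
  case False
  show ?thesis
  proof (cases "k = 0")
    case True thus ?thesis using osphere_1 by (simp add: card_insert_if)
  next
    case False thus ?thesis using osphere_even[of "q ^ k"] \<open>\<not> odd q\<close> by simp
  qed
next
  case odd: True
  show ?thesis
  proof (cases "osphere q = {}")
    case True
    show ?thesis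
    proof (induction k rule: less_induct)
      case (less k)
      consider "k = 0" | "k = 1" | j where "k = Suc (Suc j)" by (metis One_nat_def not0_implies_Suc)
      thus ?case
      proof cases
        case 1 thus ?thesis using osphere_1 by (simp add: card_insert_if)
      next
        case 2 thus ?thesis using True by simp
      next
        case 3
        have "card (osphere (q ^ k)) \<le> card (osphere (q ^ j))"
          unfolding 3 osphere_inert_Suc_Suc[OF assms odd True] by (rule card_image_le) simp
        thus ?thesis using less[of j] 3 by simp
      qed
    qed
  next
    case False
    then obtain \<pi> where \<pi>: "\<pi> \<in> osphere q" by blast
    show ?thesis
    proof (induction k)
      case 0 thus ?case using osphere_1 by (simp add: card_insert_if)
    next
      case (Suc k)
      have "osphere (q ^ Suc k) \<subseteq> (\<lambda>w. \<pi> * w) ` osphere (q ^ k) \<union> {cnj \<pi> ^ Suc k, - (cnj \<pi> ^ Suc k)}"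
      proof
        fix u assume u: "u \<in> osphere (q ^ Suc k)"
        show "u \<in> (\<lambda>w. \<pi> * w) ` osphere (q ^ k) \<union> {cnj \<pi> ^ Suc k, - (cnj \<pi> ^ Suc k)}"
        proof (cases "\<exists>c\<in>gauss. u = \<pi> * c")
          case True
          then obtain c where c: "c \<in> gauss" "u = \<pi> * c" by blast
          have "c \<in> osphere (q ^ k)"
            by (rule osphere_mult_cancel[OF c(2) _ \<pi> c(1)]) (use u prime_gt_0_nat[OF assms] in auto)
          thus ?thesis using c by blast
        next
          case False
          thus ?thesis using osphere_prime_power_not_dvd[OF assms \<pi> u] by blast
        qed
      qed
      hence "card (osphere (q ^ Suc k)) \<le> card ((\<lambda>w. \<pi> * w) ` osphere (q ^ k) \<union> {cnj \<pi> ^ Suc k, - (cnj \<pi> ^ Suc k)})"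
        by (rule card_mono[rotated]) auto
      also have "\<dots> \<le> card ((\<lambda>w. \<pi> * w) ` osphere (q ^ k)) + card {cnj \<pi> ^ Suc k, - (cnj \<pi> ^ Suc k)}"
        by (rule card_Un_le)
      also have "\<dots> \<le> card (osphere (q ^ k)) + 2"
        by (intro add_mono card_image_le) (auto simp: card_insert_if)
      finally show ?case using Suc.IH by simp
    qed
  qed
qed

lemma hecke_prime_power_le: "prime q \<Longrightarrow> \<bar>hecke M (q ^ k)\<bar> \<le> real k + 1"
  using hecke_abs_le[of M "q ^ k"] card_osphere_prime_power[of q k] by (simp add: field_simps)

text \<open>For \<open>M \<noteq> 0\<close> the last term averages to zero, so the mean of \<open>|hecke M q|\<close> is at most
  three quarters of the trivial bound.\<close>

lemma hecke_prime_bound: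
  assumes "prime q" "even M"
  shows "\<bar>hecke M q\<bar> \<le> 3/4 * hecke 0 q + 1/4 * hecke (2 * M) q"
proof (cases "osphere q = {}")
  case True thus ?thesis by (simp add: hecke_def)
next
  case False
  then obtain \<pi> where \<pi>: "\<pi> \<in> osphere q" by blast
  obtain a b where ab: "Re \<pi> = of_int a" "Im \<pi> = of_int b" "odd a"
    using \<pi> by (auto simp: osphere_def elim: odd_gaussE)
  have "Re \<pi> \<noteq> 0" using ab by auto
  have "Im \<pi> \<noteq> 0"
  proof
    assume "Im \<pi> = 0"
    hence "of_int (a^2) = real_of_int (int q)" using \<pi> ab by (simp add: osphere_def cmod_power2)
    hence "a^2 = int q" by (simp only: of_int_eq_iff)
    hence "(nat \<bar>a\<bar>)^2 = q" by (metis nat_int nat_power_eq power2_abs abs_ge_zero)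
    thus False using assms(1) by (auto simp: prime_power_iff)
  qed
  \<comment> \<open>A point divisible by \<pi> differs from it by a point of
    \<open>osphere 1\<close>; any other point is an associate of the conjugate.\<close>
  have sub: "osphere q = {\<pi>, -\<pi>, cnj \<pi>, - cnj \<pi>}"
  proof
    show "{\<pi>, -\<pi>, cnj \<pi>, - cnj \<pi>} \<subseteq> osphere q" using \<pi> osphere_uminus osphere_cnj by simp
    show "osphere q \<subseteq> {\<pi>, -\<pi>, cnj \<pi>, - cnj \<pi>}"
    proof
      fix u assume u: "u \<in> osphere q"
      show "u \<in> {\<pi>, -\<pi>, cnj \<pi>, - cnj \<pi>}"
      proof (cases "\<exists>c\<in>gauss. u = \<pi> * c")
        case True
        then obtain c where c: "c \<in> gauss" "u = \<pi> * c" by blast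
        have "c \<in> osphere 1"
          by (rule osphere_mult_cancel[OF c(2) _ \<pi> c(1)]) (use u prime_gt_0_nat[OF assms(1)] in auto)
        hence "c = 1 \<or> c = -1" unfolding osphere_1 by blast
        thus ?thesis using c(2) by auto
      next
        case False
        thus ?thesis using osphere_prime_power_not_dvd[OF assms(1) \<pi>, of u 1] u by auto
      qed
    qed
  qed
  have dist: "\<pi> \<noteq> - \<pi>" "\<pi> \<noteq> cnj \<pi>" "\<pi> \<noteq> - cnj \<pi>" "- \<pi> \<noteq> cnj \<pi>" "- \<pi> \<noteq> - cnj \<pi>" "cnj \<pi> \<noteq> - cnj \<pi>"
    using \<open>Re \<pi> \<noteq> 0\<close> \<open>Im \<pi> \<noteq> 0\<close> by (auto simp: complex_eq_iff)
  define w where "w = sgn \<pi> ^ M"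
  have hecke: "hecke K q = 2 * Re (sgn \<pi> ^ K)" if "even K" for K
  proof -
    have "sgn (cnj \<pi>) ^ K = cnj (sgn \<pi> ^ K)" by (simp add: sgn_eq)
    moreover have "(\<Sum>z\<in>osphere q. Re (sgn z ^ K)) = Re (sgn \<pi> ^ K) + Re (sgn (-\<pi>) ^ K)
        + Re (sgn (cnj \<pi>) ^ K) + Re (sgn (- cnj \<pi>) ^ K)"
      unfolding sub using dist by simp
    moreover have "Re (cnj (sgn \<pi>) ^ K) = Re (sgn \<pi> ^ K)" by (metis complex_cnj_power cnj.sel(1))
    ultimately show ?thesis using that by (simp add: hecke_def sgn_minus)
  qed
  have "cmod w = 1" using osphere_nonzero[OF \<pi>] by (simp add: w_def norm_power norm_sgn)
  hence "(Re w)^2 + (Im w)^2 = 1" by (metis cmod_power2 one_power2)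
  moreover have "sgn \<pi> ^ (2 * M) = w^2" by (simp add: w_def power_mult mult.commute)
  ultimately have "hecke (2 * M) q = 4 * (Re w)^2 - 2" "hecke M q = 2 * Re w" "hecke 0 q = 2"
    using hecke[of "2 * M"] hecke[of M] hecke[of 0] assms(2) by (auto simp: w_def[symmetric] Re_power2)
  \<comment> \<open>With x = Re w the right-hand side of the claim is 3/4 * 2 + 1/4 * (4x^2 - 2) = 1
    + x^2, so the claim is (|x| - 1)^2 \<ge> 0.\<close>
  moreover have "2 * \<bar>Re w\<bar> \<le> 1 + (Re w)^2"
    using zero_le_power2[of "\<bar>Re w\<bar> - 1"] by (simp add: power2_diff)
  ultimately show ?thesis by (simp add: abs_mult field_simps)
qed

section \<open>Lattice sums\<close>

lemma summable_on_int_powr: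
  fixes s :: real assumes "s > 1"
  shows "(\<lambda>a::int. (1 + \<bar>real_of_int a\<bar>) powr (-s)) summable_on UNIV"
proof -
  let ?f = "\<lambda>a::int. (1 + \<bar>real_of_int a\<bar>) powr (-s)"
  have "summable (\<lambda>n. real n powr (-s))" using assms by (simp add: summable_real_powr_iff)
  hence "summable (\<lambda>n. real (Suc n) powr (-s))" by (subst summable_Suc_iff)
  hence "summable (\<lambda>n. (1 + real n) powr (-s))" by simp
  hence nat: "(\<lambda>n. (1 + real n) powr (-s)) summable_on UNIV"
    by (subst summable_on_UNIV_nonneg_real_iff) auto
  have 1: "?f summable_on (range int)"
    using nat by (subst summable_on_reindex) (auto simp: o_def)
  have 2: "?f summable_on (range (\<lambda>n. - int n))"
    using nat by (subst summable_on_reindex) (auto simp: o_def inj_def)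
  have "UNIV = range int \<union> range (\<lambda>n. - int n)"
  proof (rule Set.set_eqI)
    fix a :: int show "a \<in> UNIV \<longleftrightarrow> a \<in> range int \<union> range (\<lambda>n. - int n)"
      by (cases a rule: int_cases2) auto
  qed
  moreover have "?f summable_on (range int \<union> range (\<lambda>n. - int n))"
    by (intro summable_on_union 1 2)
  ultimately show ?thesis by simp
qed

definition odd_gauss_of :: "int \<times> int \<Rightarrow> complex" where
  "odd_gauss_of = (\<lambda>(a, b). Complex (of_int (2 * a + 1)) (of_int (2 * b)))"

lemma inj_og: "inj odd_gauss_of"
  by (auto simp: inj_def odd_gauss_of_def simp del: of_int_add of_int_mult)

lemma odd_gauss_og: "odd_gauss = range odd_gauss_of"
  by (auto simp: odd_gauss_def odd_gauss_of_def image_def)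

lemma norm_og_ge: "cmod (odd_gauss_of (a, b)) \<ge> (1 + \<bar>real_of_int a\<bar>) / 2" "cmod (odd_gauss_of (a, b)) \<ge> (1 + \<bar>real_of_int b\<bar>) / 2"
proof -
  have 1: "cmod (odd_gauss_of (a, b)) \<ge> 1"
    by (rule odd_gauss_norm_ge_1) (auto simp: odd_gauss_og)
  have "\<bar>a\<bar> \<le> \<bar>2 * a + 1\<bar>" by presburger
  hence "\<bar>real_of_int a\<bar> \<le> \<bar>real_of_int (2 * a + 1)\<bar>" by (metis of_int_abs of_int_le_iff)
  also have "\<dots> = \<bar>Re (odd_gauss_of (a, b))\<bar>" by (simp add: odd_gauss_of_def)
  also have "\<dots> \<le> cmod (odd_gauss_of (a, b))" by (rule abs_Re_le_cmod)
  finally show "cmod (odd_gauss_of (a, b)) \<ge> (1 + \<bar>real_of_int a\<bar>) / 2" using 1 by simp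
  have "\<bar>real_of_int b\<bar> \<le> \<bar>Im (odd_gauss_of (a, b))\<bar>" by (simp add: odd_gauss_of_def)
  also have "\<dots> \<le> cmod (odd_gauss_of (a, b))" by (rule abs_Im_le_cmod)
  finally show "cmod (odd_gauss_of (a, b)) \<ge> (1 + \<bar>real_of_int b\<bar>) / 2" using 1 by simp
qed

text \<open>The modulus dominates both coordinates, so |z|^(-2s) is at most a constant times a
  product of one-dimensional terms with exponent -s each.\<close>

lemma summable_on_odd_gauss_powr:
  fixes s :: real assumes "s > 1"
  shows "(\<lambda>z. cmod z powr (-2 * s)) summable_on odd_gauss"
proof -
  let ?p = "\<lambda>a::int. (1 + \<bar>real_of_int a\<bar>) powr (-s)"
  note p = summable_on_int_powr[OF assms]
  have "(\<lambda>(a, b). ?p a * ?p b) summable_on (UNIV \<times> UNIV)"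
  proof (rule summable_on_SigmaI)
    fix a :: int
    show "((\<lambda>b. case (a, b) of (a, b) \<Rightarrow> ?p a * ?p b) has_sum (?p a * infsum ?p UNIV)) UNIV"
      using has_sum_cmult_right[OF has_sum_infsum[OF p], of "?p a"] by simp
  next
    show "(\<lambda>a. ?p a * infsum ?p UNIV) summable_on UNIV" using p by (rule summable_on_cmult_left)
  qed auto
  hence sum: "(\<lambda>x. 4 powr s * (case x of (a, b) \<Rightarrow> ?p a * ?p b)) summable_on UNIV"
    by (intro summable_on_cmult_right) simp
  have "(\<lambda>x. cmod (odd_gauss_of x) powr (-2 * s)) summable_on UNIV"
  proof (rule summable_on_comparison_test[OF sum])
    fix x :: "int \<times> int"
    show "0 \<le> cmod (odd_gauss_of x) powr (-2 * s)" by simp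
    obtain a b where x: "x = (a, b)" by (cases x)
    let ?a = "1 + \<bar>real_of_int a\<bar>" and ?b = "1 + \<bar>real_of_int b\<bar>"
    have "cmod (odd_gauss_of x) powr (-2 * s) = cmod (odd_gauss_of x) powr (-s) * cmod (odd_gauss_of x) powr (-s)"
      by (simp flip: powr_add)
    also have "\<dots> \<le> (?a / 2) powr (-s) * (?b / 2) powr (-s)"
      unfolding x using assms norm_og_ge[where a=a and b=b] by (intro mult_mono powr_mono2') auto
    also have "\<dots> = 4 powr s * (?p a * ?p b)"
    proof -
      have "(4::real) powr s = 2 powr s * 2 powr s" by (simp flip: powr_mult)
      thus ?thesis by (simp add: powr_divide powr_minus field_simps)
    qed
    finally show "cmod (odd_gauss_of x) powr (-2 * s) \<le> 4 powr s * (case x of (a, b) \<Rightarrow> ?p a * ?p b)"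
      by (simp add: x)
  qed
  thus ?thesis unfolding odd_gauss_og using inj_og by (subst summable_on_reindex) (auto simp: o_def)
qed

lemma powr_minus_two_times:
  fixes x :: real assumes "x > 0" shows "x powr (-2 * s) = (x ^ 2) powr (-s)"
proof -
  have "(x ^ 2) powr (-s) = (x powr 2) powr (-s)" using assms by simp
  thus ?thesis unfolding powr_powr by simp
qed

section \<open>Characters on the lattice and their variation under bounded shifts\<close>

definition lattice_term :: "nat \<Rightarrow> real \<Rightarrow> complex \<Rightarrow> complex" where
  "lattice_term M s z = sgn z ^ M * of_real (cmod z powr (-2 * s))"

definition lattice_sum :: "nat \<Rightarrow> real \<Rightarrow> complex" where
  "lattice_sum M s = infsum (lattice_term M s) odd_gauss"

lemma norm_hterm: "z \<noteq> 0 \<Longrightarrow> cmod (lattice_term M s z) = cmod z powr (-2 * s)"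
  by (simp add: lattice_term_def norm_mult norm_power norm_sgn)

lemma hterm_mult: "lattice_term M s (z * w) = lattice_term M s z * lattice_term M s w"
  by (simp add: lattice_term_def sgn_mult power_mult_distrib norm_mult powr_mult)

lemma hterm_abs_summable:
  assumes "s > 1" shows "(\<lambda>z. norm (lattice_term M s z)) summable_on odd_gauss"
proof -
  have "norm (lattice_term M s z) = cmod z powr (-2 * s)" if "z \<in> odd_gauss" for z
    by (rule norm_hterm) (use that in auto)
  thus ?thesis using summable_on_odd_gauss_powr[OF assms] by (simp cong: summable_on_cong)
qed

text \<open>A mean value estimate read off from 1 - tu \<le> (1 + u)^(-t), where b = a(1 + u); it
  combines ln(1 + u) \<le> u with 1 + x \<le> exp x.\<close>

lemma powr_neg_diff_le:
  fixes a b t :: real assumes "0 < a" "a \<le> b" "t \<ge> 0"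
  shows "a powr (-t) - b powr (-t) \<le> t * (b - a) * a powr (-t - 1)"
proof -
  define u where "u = (b - a) / a"
  have u: "u \<ge> 0" "b = a * (1 + u)" using assms by (auto simp: u_def field_simps)
  have "1 - t * u \<le> 1 + (- t * ln (1 + u))" using ln_add_one_self_le_self[OF u(1)] assms(3)
    by (simp add: mult_left_mono)
  also have "\<dots> \<le> exp (- t * ln (1 + u))" by (rule exp_ge_add_one_self)
  also have "\<dots> = (1 + u) powr (-t)" using u by (simp add: powr_def)
  finally have "a powr (-t) * (1 - t * u) \<le> a powr (-t) * (1 + u) powr (-t)" by (intro mult_left_mono) auto
  also have "\<dots> = b powr (-t)" using u assms by (simp add: powr_mult)
  finally have "a powr (-t) - b powr (-t) \<le> a powr (-t) * t * u" by (simp add: algebra_simps)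
  also have "\<dots> = t * (b - a) * a powr (-t - 1)" using assms by (simp add: u_def powr_diff)
  finally show ?thesis .
qed

text \<open>The 32 is 4 * 8, from 2s \<le> 4 and the distance 8. The 729 is 9^3: as \<open>y\<close>
  is at least 1, x \<le> y + 8 \<le> 9y, which lets the smaller point be replaced by
  \<open>x\<close>.\<close>

lemma powr_neg_diff_abs_le:
  fixes x y s :: real assumes "1 \<le> x" "1 \<le> y" "\<bar>x - y\<bar> \<le> 8" "1 < s" "s \<le> 2"
  shows "\<bar>x powr (-2 * s) - y powr (-2 * s)\<bar> \<le> 32 * 729 * x powr (-3)"
proof -
  have main: "a powr (-2 * s) - b powr (-2 * s) \<le> 32 * a powr (-3)" "b powr (-2 * s) \<le> a powr (-2 * s)"
    if "1 \<le> a" "a \<le> b" "b - a \<le> 8" for a b :: real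
  proof -
    have "a powr (-2 * s) - b powr (-2 * s) \<le> (2 * s) * (b - a) * a powr (- (2 * s) - 1)"
      using powr_neg_diff_le[of a b "2 * s"] that assms by simp
    also have "\<dots> \<le> 4 * 8 * a powr (-3)"
      using that assms by (intro mult_mono powr_mono) auto
    finally show "a powr (-2 * s) - b powr (-2 * s) \<le> 32 * a powr (-3)" by simp
    show "b powr (-2 * s) \<le> a powr (-2 * s)" using that assms by (intro powr_mono2') auto
  qed
  have p: "x powr (-3) \<ge> 0" by simp
  show ?thesis
  proof (cases "x \<le> y")
    case True
    thus ?thesis using main[of x y] assms p by auto
  next
    case False
    have "y powr (-3) \<le> (x / 9) powr (-3)" using assms by (intro powr_mono2') auto
    also have "\<dots> = 729 * x powr (-3)" using assms by (simp add: powr_divide powr_minus powr_numeral field_simps)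
    finally show ?thesis using main[of y x] assms False by auto
  qed
qed

text \<open>A bounded shift changes the angle and the relative size by O(1/|z|). The difference is
  thus O(|z|^(-3)), which is summable over the plane uniformly in \<open>s\<close>, unlike the terms
  themselves. The 8 is the largest shift 2c with c < 5 that occurs.\<close>

lemma hterm_diff_le:
  assumes "1 \<le> cmod z" "1 \<le> cmod w" "cmod (z - w) \<le> 8" "1 < s" "s \<le> 2"
  shows "cmod (lattice_term M s z - lattice_term M s w) \<le> (16 * real M + 32 * 729) * cmod z powr (-3)"
proof -
  have nz: "cmod z > 0" "cmod w > 0" "z \<noteq> 0" "w \<noteq> 0" using assms by auto
  have ab: "\<bar>cmod z - cmod w\<bar> \<le> 8" using norm_triangle_ineq3[of z w] assms(3) by linarith
  have eq: "sgn z - sgn w = (z - w) / of_real (cmod z) + w * of_real (1 / cmod z - 1 / cmod w)"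
    using nz by (simp add: sgn_eq field_simps)
  have "cmod (sgn z - sgn w) \<le> cmod (z - w) / cmod z + cmod w * \<bar>1 / cmod z - 1 / cmod w\<bar>"
    unfolding eq using nz
    by (intro order_trans[OF norm_triangle_ineq] add_mono) (auto simp: norm_divide norm_mult simp del: of_real_diff of_real_divide)
  also have "cmod w * \<bar>1 / cmod z - 1 / cmod w\<bar> = \<bar>cmod w * (1 / cmod z - 1 / cmod w)\<bar>"
    by (simp add: abs_mult)
  also have "cmod w * (1 / cmod z - 1 / cmod w) = (cmod w - cmod z) / cmod z"
    using nz by (simp add: field_simps)
  also have "cmod (z - w) / cmod z + \<bar>(cmod w - cmod z) / cmod z\<bar> \<le> 8 / cmod z + 8 / cmod z"
    using assms(3) ab nz by (intro add_mono) (auto simp: divide_right_mono abs_minus_commute)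
  finally have sg: "cmod (sgn z - sgn w) \<le> 16 / cmod z" by simp
  have "cmod (sgn z ^ M - sgn w ^ M) \<le> real M * cmod (sgn z - sgn w)"
    by (rule norm_power_diff) (auto simp: norm_sgn)
  also have "\<dots> \<le> real M * (16 / cmod z)" by (intro mult_left_mono sg) auto
  finally have sgM: "cmod (sgn z ^ M - sgn w ^ M) \<le> 16 * real M / cmod z" by (simp add: mult.commute)
  have "lattice_term M s z - lattice_term M s w = (sgn z ^ M - sgn w ^ M) * of_real (cmod z powr (-2 * s))
      + sgn w ^ M * of_real (cmod z powr (-2 * s) - cmod w powr (-2 * s))"
    by (simp add: lattice_term_def algebra_simps)
  hence "cmod (lattice_term M s z - lattice_term M s w) \<le> cmod (sgn z ^ M - sgn w ^ M) * cmod z powr (-2 * s)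
      + \<bar>cmod z powr (-2 * s) - cmod w powr (-2 * s)\<bar>"
    using nz by (auto intro!: order_trans[OF norm_triangle_ineq] add_mono
      simp: norm_mult norm_power norm_sgn simp del: of_real_diff)
  also have "\<dots> \<le> 16 * real M / cmod z * cmod z powr (-2) + 32 * 729 * cmod z powr (-3)"
    using assms ab by (intro add_mono mult_mono sgM powr_neg_diff_abs_le powr_mono) auto
  also have "16 * real M / cmod z * cmod z powr (-2) = 16 * real M * cmod z powr (-3)"
    using nz powr_diff[of "cmod z" "-2" 1] by simp
  finally show ?thesis by (simp add: algebra_simps)
qed

section \<open>Behaviour near s = 1 through multiplication by 1 + 2i\<close>

definition alpha :: complex where "alpha = Complex 1 2"

lemma norm_alpha: "cmod alpha ^ 2 = 5"
  by (simp add: alpha_def cmod_power2)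

lemma alpha_og: "alpha * odd_gauss_of (a, b) + 2 * of_nat c = odd_gauss_of (a - 2 * b + int c, b + 2 * a + 1)"
  by (simp add: alpha_def odd_gauss_of_def complex_eq_iff algebra_simps)

text \<open>\<open>alpha\<close> has norm 5, and the numbers 2c with c < 5 represent the five
  residue classes modulo \<open>alpha\<close>. Even shifts keep points 1 modulo 2.\<close>

lemma alpha_bij:
  "bij_betw (\<lambda>(c, z). alpha * z + 2 * of_nat c) ({..<5} \<times> odd_gauss) odd_gauss"
proof (rule bij_betwI')
  fix x y :: "nat \<times> complex" assume "x \<in> {..<5} \<times> odd_gauss" "y \<in> {..<5} \<times> odd_gauss"
  then obtain c a b c' a' b' where xy: "x = (c, odd_gauss_of (a, b))" "y = (c', odd_gauss_of (a', b'))" "c < 5" "c' < 5"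
    by (auto simp: odd_gauss_og)
  show "((case x of (c, z) \<Rightarrow> alpha * z + 2 * of_nat c) = (case y of (c, z) \<Rightarrow> alpha * z + 2 * of_nat c)) = (x = y)"
  proof
    assume "(case x of (c, z) \<Rightarrow> alpha * z + 2 * of_nat c) = (case y of (c, z) \<Rightarrow> alpha * z + 2 * of_nat c)"
    hence "odd_gauss_of (a - 2 * b + int c, b + 2 * a + 1) = odd_gauss_of (a' - 2 * b' + int c', b' + 2 * a' + 1)"
      by (simp add: xy alpha_og)
    hence eq: "a - 2 * b + int c = a' - 2 * b' + int c'" "b + 2 * a + 1 = b' + 2 * a' + 1"
      using inj_og by (auto dest: injD)
    hence "5 * a + int c = 5 * a' + int c'" by linarith
    moreover have "int c < 5" "int c' < 5" using xy(3,4) by simp_all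
    ultimately have "a \<le> a'" "a' \<le> a" by linarith+
    hence "a = a'" "c = c'" using \<open>5 * a + int c = 5 * a' + int c'\<close> by simp_all
    moreover have "b = b'" using eq calculation by linarith
    ultimately show "x = y" using xy by simp
  qed simp
next
  fix x :: "nat \<times> complex" assume "x \<in> {..<5} \<times> odd_gauss"
  thus "(case x of (c, z) \<Rightarrow> alpha * z + 2 * of_nat c) \<in> odd_gauss"
    by (auto simp: odd_gauss_og alpha_og)
next
  fix w assume "w \<in> odd_gauss"
  then obtain A B where w: "w = odd_gauss_of (A, B)" by (auto simp: odd_gauss_og)
  \<comment> \<open>Solving \<open>a - 2 * b + c = A\<close> and \<open>b + 2 * a + 1 = B\<close>
    for \<open>b\<close> leaves 5a + c = A + 2B - 2, a division with remainder.\<close>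
  define a where "a = (A + 2 * B - 2) div 5"
  define c where "c = nat ((A + 2 * B - 2) mod 5)"
  have c: "c < 5" "5 * a + int c = A + 2 * B - 2" by (auto simp: a_def c_def)
  have "w = alpha * odd_gauss_of (a, B - 2 * a - 1) + 2 * of_nat c"
    unfolding alpha_og w using c(2) by (simp add: algebra_simps)
  thus "\<exists>x\<in>{..<5} \<times> odd_gauss. w = (case x of (c, z) \<Rightarrow> alpha * z + 2 * of_nat c)"
    using c by (intro bexI[of _ "(c, odd_gauss_of (a, B - 2 * a - 1))"]) (auto simp: odd_gauss_og)
qed

lemma hterm_alpha: "lattice_term M s alpha = sgn alpha ^ M * of_real (5 powr (-s))"
proof -
  have "cmod alpha > 0" using norm_alpha by (cases "cmod alpha = 0") auto
  hence "cmod alpha powr (-2 * s) = 5 powr (-s)" using powr_minus_two_times norm_alpha by metis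
  thus ?thesis by (simp add: lattice_term_def)
qed

text \<open>A translate of the lattice changes the sum only by \<open>O(1)\<close>, while multiplication by
  \<open>alpha\<close> scales it; comparing both evaluates the sum near \<open>s = 1\<close> without any integration.\<close>

lemma tsum_functional:
  "\<exists>C\<ge>0. \<forall>s. 1 < s \<longrightarrow> s \<le> 2 \<longrightarrow> cmod (lattice_sum M s * (1 - of_real (5 powr (1 - s)) * sgn alpha ^ M)) \<le> C"
proof -
  define K where "K = 16 * real M + 32 * 729"
  have K: "K \<ge> 0" by (simp add: K_def)
  define Z where "Z = infsum (\<lambda>z. cmod z powr (-3)) odd_gauss"
  \<comment> \<open>The exponent 3 is 2s at s = 3/2, inside the range of convergence.\<close>
  have sZ: "(\<lambda>z. cmod z powr (-3)) summable_on odd_gauss"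
    using summable_on_odd_gauss_powr[of "3/2"] by simp
  have Z: "Z \<ge> 0" unfolding Z_def by (rule infsum_nonneg) simp
  have al: "alpha \<in> odd_gauss" by (rule odd_gaussI[of _ 1 2]) (auto simp: alpha_def)
  have "cmod (lattice_sum M s * (1 - of_real (5 powr (1 - s)) * sgn alpha ^ M)) \<le> 5 * (K * Z)"
    if s: "1 < s" "s \<le> 2" for s
  proof -
    let ?h = "lattice_term M s"
    note abs = hterm_abs_summable[OF s(1), of M]
    note sm = abs_summable_summable[OF abs]
    have sp: "(\<lambda>(c, z). ?h (alpha * z + 2 * of_nat c)) summable_on ({..<5} \<times> odd_gauss)"
      using sm by (subst (asm) summable_on_reindex_bij_betw[OF alpha_bij, symmetric]) (simp add: case_prod_unfold)
    have "lattice_sum M s = infsum (\<lambda>(c, z). ?h (alpha * z + 2 * of_nat c)) ({..<5} \<times> odd_gauss)"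
      unfolding lattice_sum_def
      by (subst infsum_reindex_bij_betw[OF alpha_bij, symmetric]) (simp add: case_prod_unfold)
    also have "\<dots> = (\<Sum>\<^sub>\<infinity>c\<in>{..<5}. infsum (\<lambda>z. ?h (alpha * z + 2 * of_nat c)) odd_gauss)"
      by (rule infsum_Sigma'_banach[symmetric, OF sp])
    also have "\<dots> = (\<Sum>c<5. infsum (\<lambda>z. ?h (alpha * z + 2 * of_nat c)) odd_gauss)"
      by (simp add: infsum_finite)
    finally have T: "lattice_sum M s = (\<Sum>c<5. infsum (\<lambda>z. ?h (alpha * z + 2 * of_nat c)) odd_gauss)" .
    have sc: "(\<lambda>z. ?h (alpha * z + 2 * of_nat c)) summable_on odd_gauss" if "c < 5" for c
      using summable_on_SigmaD1[OF sp, of c] that by simp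
    have sa: "(\<lambda>z. ?h alpha * ?h z) summable_on odd_gauss" by (rule summable_on_cmult_right[OF sm])
    have diff: "cmod (infsum (\<lambda>z. ?h (alpha * z + 2 * of_nat c)) odd_gauss - ?h alpha * lattice_sum M s) \<le> K * Z"
      if c: "c < 5" for c
    proof -
      have "cmod (infsum (\<lambda>z. ?h (alpha * z + 2 * of_nat c)) odd_gauss - ?h alpha * lattice_sum M s)
          \<le> infsum (\<lambda>z. K * cmod z powr (-3)) odd_gauss"
      proof (rule norm_infsum_le)
        show "((\<lambda>z. ?h (alpha * z + 2 * of_nat c) - ?h alpha * ?h z) has_sum
            infsum (\<lambda>z. ?h (alpha * z + 2 * of_nat c)) odd_gauss - ?h alpha * lattice_sum M s) odd_gauss"
          using has_sum_add[OF has_sum_infsum[OF sc[OF c]] has_sum_uminusI[OF has_sum_infsum[OF sa]]]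
          by (simp add: lattice_sum_def infsum_cmult_right')
        show "((\<lambda>z. K * cmod z powr (-3)) has_sum infsum (\<lambda>z. K * cmod z powr (-3)) odd_gauss) odd_gauss"
          by (intro has_sum_infsum summable_on_cmult_right sZ)
        fix z assume z: "z \<in> odd_gauss"
        have 1: "alpha * z \<in> odd_gauss" using al z by blast
        have 2: "alpha * z + 2 * of_nat c \<in> odd_gauss"
          using bij_betwE[OF alpha_bij] c z by auto
        have "cmod (alpha * z - (alpha * z + 2 * of_nat c)) = 2 * real c" by (simp add: norm_mult)
        hence 3: "cmod (alpha * z - (alpha * z + 2 * of_nat c)) \<le> 8" using c by simp
        have "cmod (?h (alpha * z) - ?h (alpha * z + 2 * of_nat c)) \<le> K * cmod (alpha * z) powr (-3)"
          unfolding K_def using 1 2 3 s by (intro hterm_diff_le odd_gauss_norm_ge_1) auto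
        also have "\<dots> \<le> K * cmod z powr (-3)"
        proof (intro mult_left_mono K powr_mono2')
          have z1: "cmod z \<ge> 1" using z by (rule odd_gauss_norm_ge_1)
          show "cmod z > 0" using z1 by linarith
          show "cmod z \<le> cmod (alpha * z)" using mult_right_mono[OF odd_gauss_norm_ge_1[OF al], of "cmod z"] by (simp add: norm_mult)
        qed auto
        finally show "norm (?h (alpha * z + 2 * of_nat c) - ?h alpha * ?h z) \<le> K * cmod z powr (-3)"
          by (simp add: hterm_mult norm_minus_commute)
      qed
      also have "\<dots> = K * Z" unfolding Z_def by (rule infsum_cmult_right')
      finally show ?thesis .
    qed
    \<comment> \<open>Each of the five classes contributes \<open>?h alpha\<close> times the whole
      sum up to O(1), because \<open>lattice_term\<close> is completely multiplicative.\<close>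
    have "5 * ?h alpha = of_real (5 powr (1 - s)) * sgn alpha ^ M"
      by (simp add: hterm_alpha powr_diff powr_minus field_simps)
    hence "lattice_sum M s * (1 - of_real (5 powr (1 - s)) * sgn alpha ^ M) = lattice_sum M s - 5 * (?h alpha * lattice_sum M s)"
      by (simp add: algebra_simps)
    also have "\<dots> = (\<Sum>c<5. infsum (\<lambda>z. ?h (alpha * z + 2 * of_nat c)) odd_gauss - ?h alpha * lattice_sum M s)"
      by (subst (1) T) (simp add: sum_subtractf)
    also have "cmod \<dots> \<le> (\<Sum>c<(5::nat). K * Z)" by (intro sum_norm_le diff) auto
    finally show ?thesis by simp
  qed
  thus ?thesis using K Z by (intro exI[of _ "5 * (K * Z)"]) auto
qed

text \<open>At frequency 0 the factor in \<open>tsum_functional\<close> is 1 - 5^(1-s), which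
  vanishes only to first order at s = 1.\<close>

lemma tsum_0_le: "\<exists>C\<ge>0. \<forall>s. 1 < s \<longrightarrow> s \<le> 2 \<longrightarrow> cmod (lattice_sum 0 s) \<le> C / (s - 1)"
proof -
  obtain C where C: "C \<ge> 0" "\<And>s. 1 < s \<Longrightarrow> s \<le> 2 \<Longrightarrow> cmod (lattice_sum 0 s * (1 - of_real (5 powr (1 - s)))) \<le> C"
    using tsum_functional[of 0] by auto
  have "cmod (lattice_sum 0 s) \<le> 3 * C / (s - 1)" if s: "1 < s" "s \<le> 2" for s
  proof -
    have ln5: "ln 5 \<ge> (1::real)" using exp_le by (subst ln_ge_iff) auto
    define t where "t = (s - 1) * ln 5"
    have t: "t \<ge> s - 1" "t > 0" using s ln5 by (auto simp: t_def)
    have "5 powr (1 - s) = exp (-t)" by (simp add: powr_def t_def algebra_simps)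
    moreover have "exp (-t) \<le> 1 / (1 + t)"
    proof -
      have "(1 + t) * exp (-t) \<le> exp t * exp (-t)" by (intro mult_right_mono exp_ge_add_one_self) auto
      thus ?thesis using t by (simp add: exp_minus field_simps)
    qed
    moreover have "1 - 1 / (1 + t) \<ge> (s - 1) / 3"
    proof -
      have "(s - 1) / 3 \<le> (s - 1) / (1 + (s - 1))" using s by (intro divide_left_mono) auto
      also have "\<dots> \<le> t / (1 + t)" using s t by (simp add: field_simps)
      also have "\<dots> = 1 - 1 / (1 + t)" using t by (simp add: field_simps)
      finally show ?thesis .
    qed
    ultimately have lower: "1 - 5 powr (1 - s) \<ge> (s - 1) / 3" by linarith
    have "cmod (lattice_sum 0 s) * ((s - 1) / 3) \<le> cmod (lattice_sum 0 s) * (1 - 5 powr (1 - s))"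
      by (intro mult_left_mono lower) auto
    also have "\<dots> = cmod (lattice_sum 0 s) * cmod (of_real (1 - 5 powr (1 - s)))"
      using lower s by (simp del: of_real_diff)
    also have "\<dots> = cmod (lattice_sum 0 s * (1 - of_real (5 powr (1 - s))))" by (simp add: norm_mult)
    also have "\<dots> \<le> C" using C s by auto
    finally show ?thesis using s by (simp add: field_simps)
  qed
  thus ?thesis using C by (intro exI[of _ "3 * C"]) auto
qed

text \<open>\<open>alpha ^ 4\<close> is -7 - 24i, congruent to 3 + i modulo 5, and 3 + i is
  idempotent modulo 5 since its square is 8 + 6i. Hence no such power is real.\<close>

lemma alpha_power_mod5:
  "\<exists>x y :: int. alpha ^ (4 * Suc k) = Complex (of_int (5 * x + 3)) (of_int (5 * y + 1))"
proof (induction k)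
  case 0
  have "alpha ^ 4 = Complex (-7) (-24)"
    by (simp add: alpha_def power4_eq_xxxx complex_eq_iff)
  thus ?case by (intro exI[of _ "-2"] exI[of _ "-5"]) simp
next
  case (Suc k)
  then obtain x y where xy: "alpha ^ (4 * Suc k) = Complex (of_int (5 * x + 3)) (of_int (5 * y + 1))" by blast
  have a4: "alpha ^ 4 = Complex (-7) (-24)"
    by (simp add: alpha_def power4_eq_xxxx complex_eq_iff)
  have "alpha ^ (4 * Suc (Suc k)) = alpha ^ (4 * Suc k) * alpha ^ 4"
    unfolding power_add[symmetric] by (rule arg_cong[of _ _ "\<lambda>n. alpha ^ n"]) simp
  also have "\<dots> = Complex (of_int (5 * (-7 * x + 24 * y) + 3)) (of_int (5 * (-24 * x - 7 * y - 16) + 1))"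
    unfolding xy a4 by (simp add: complex_eq_iff algebra_simps)
  finally show ?case by blast
qed

text \<open>The imaginary part of \<open>alpha ^ M\<close> is 1 modulo 5, so
  \<open>sgn alpha ^ M\<close> is not real. As 5^(1-s) \<ge> 1/5 for s \<le> 2, the imaginary part
  of the factor in \<open>tsum_functional\<close> alone keeps that factor away from 0.\<close>

lemma tsum_bounded:
  assumes "M > 0" "4 dvd M"
  shows "\<exists>C\<ge>0. \<forall>s. 1 < s \<longrightarrow> s \<le> 2 \<longrightarrow> cmod (lattice_sum M s) \<le> C"
proof -
  obtain k where "M = 4 * Suc k" using assms by (metis dvdE mult_0_right not0_implies_Suc not_less_zero)
  then obtain x y :: int where xy: "alpha ^ M = Complex (of_int (5 * x + 3)) (of_int (5 * y + 1))"
    using alpha_power_mod5 by blast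
  have "5 * y + 1 \<noteq> 0" by presburger
  hence "Im (alpha ^ M) \<noteq> 0" unfolding xy complex.sel by (simp only: of_int_eq_0_iff not_False_eq_True)
  moreover have "sgn alpha ^ M = of_real (1 / cmod alpha ^ M) * alpha ^ M"
    by (simp add: sgn_eq power_divide)
  hence "Im (sgn alpha ^ M) = 1 / cmod alpha ^ M * Im (alpha ^ M)" by simp
  moreover have "cmod alpha \<noteq> 0" using norm_alpha by auto
  ultimately have I: "Im (sgn alpha ^ M) \<noteq> 0" by simp
  define c where "c = \<bar>Im (sgn alpha ^ M)\<bar> / 5"
  have c: "c > 0" using I by (simp add: c_def)
  obtain C where C: "C \<ge> 0" "\<And>s. 1 < s \<Longrightarrow> s \<le> 2 \<Longrightarrow>
      cmod (lattice_sum M s * (1 - of_real (5 powr (1 - s)) * sgn alpha ^ M)) \<le> C"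
    using tsum_functional[of M] by auto
  have "cmod (lattice_sum M s) \<le> C / c" if s: "1 < s" "s \<le> 2" for s
  proof -
    have "(5::real) powr (1 - s) \<ge> 5 powr (-1)" using s by (intro powr_mono) auto
    hence p: "(5::real) powr (1 - s) \<ge> 1/5" by (simp add: powr_minus)
    have "c \<le> 5 powr (1 - s) * \<bar>Im (sgn alpha ^ M)\<bar>"
      using mult_right_mono[OF p, of "\<bar>Im (sgn alpha ^ M)\<bar>"] by (simp add: c_def)
    also have "\<dots> = \<bar>Im (1 - of_real (5 powr (1 - s)) * sgn alpha ^ M)\<bar>" by (simp add: abs_mult)
    also have "\<dots> \<le> cmod (1 - of_real (5 powr (1 - s)) * sgn alpha ^ M)" by (rule abs_Im_le_cmod)
    finally have "cmod (lattice_sum M s) * c \<le> cmod (lattice_sum M s) * cmod (1 - of_real (5 powr (1 - s)) * sgn alpha ^ M)"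
      by (intro mult_left_mono) auto
    also have "\<dots> \<le> C" using C(2)[OF s] by (simp add: norm_mult)
    finally show ?thesis using c by (simp add: field_simps)
  qed
  thus ?thesis using C c by (intro exI[of _ "C / c"]) auto
qed

section \<open>From lattice sums to Dirichlet series\<close>

text \<open>Absolute convergence allows the lattice points to be sorted by norm; norm
  \<open>n\<close> contributes \<open>2 * hecke M n\<close>.\<close>

lemma hecke_dirichlet:
  fixes s :: real
  assumes "s > 1"
  shows "(\<lambda>n. \<bar>hecke M n * real n powr (-s)\<bar>) summable_on {0<..}"
    and "cmod (lattice_sum M s) = 2 * \<bar>infsum (\<lambda>n. hecke M n * real n powr (-s)) {0<..}\<bar>"
proof -
  have bij: "bij_betw snd (Sigma {0<..} osphere) odd_gauss"
  proof (rule bij_betw_imageI)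
    show "inj_on snd (Sigma {0<..} osphere)" by (auto simp: inj_on_def osphere_def)
    show "snd ` (Sigma {0<..} osphere) = odd_gauss"
    proof (rule subset_antisym)
      show "odd_gauss \<subseteq> snd ` (Sigma {0<..} osphere)"
      proof
        fix z assume z: "z \<in> odd_gauss"
        obtain n where n: "cmod z ^ 2 = real n" using gauss_norm_nat[OF odd_gauss_imp_gauss[OF z]] .
        have "z \<noteq> 0" using z by auto
        hence "n > 0" using n by (cases n) auto
        hence "(n, z) \<in> Sigma {0<..} osphere" using z n by (auto simp: osphere_def)
        thus "z \<in> snd ` (Sigma {0<..} osphere)" by force
      qed
    qed (auto simp: osphere_def)
  qed
  have pw: "cmod z powr (-2 * s) = real n powr (-s)" if "z \<in> osphere n" for z n
  proof -
    have z: "cmod z > 0" "cmod z ^ 2 = real n" using that osphere_nonzero by (auto simp: osphere_def)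
    show ?thesis using powr_minus_two_times[OF z(1), of s] z(2) by simp
  qed
  note abs = hterm_abs_summable[OF assms, of M]
  have 1: "(\<lambda>(n, z). norm (lattice_term M s z)) summable_on (Sigma {0<..} osphere)"
    using abs by (subst (asm) summable_on_reindex_bij_betw[OF bij, symmetric]) (simp add: case_prod_unfold)
  have 2: "(\<lambda>n. infsum (\<lambda>z. norm (lattice_term M s z)) (osphere n)) summable_on {0<..}"
    by (rule summable_on_Sigma_banach[OF 1])
  show sm: "(\<lambda>n. \<bar>hecke M n * real n powr (-s)\<bar>) summable_on {0<..}"
  proof (rule summable_on_comparison_test[OF 2])
    fix n :: nat
    show "0 \<le> \<bar>hecke M n * real n powr (-s)\<bar>" by simp
    have "infsum (\<lambda>z. norm (lattice_term M s z)) (osphere n) = (\<Sum>z\<in>osphere n. norm (lattice_term M s z))"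
      by (simp add: infsum_finite)
    also have "\<dots> = (\<Sum>z\<in>osphere n. real n powr (-s))"
      by (intro sum.cong refl) (metis norm_hterm osphere_nonzero pw)
    also have "\<dots> = real (card (osphere n)) * real n powr (-s)" by simp
    finally have *: "infsum (\<lambda>z. norm (lattice_term M s z)) (osphere n) = real (card (osphere n)) * real n powr (-s)" .
    have "\<bar>hecke M n\<bar> * real n powr (-s) \<le> real (card (osphere n)) * real n powr (-s)"
      using hecke_abs_le[of M n] by (intro mult_right_mono) auto
    thus "\<bar>hecke M n * real n powr (-s)\<bar> \<le> infsum (\<lambda>z. norm (lattice_term M s z)) (osphere n)"
      unfolding * by (simp add: abs_mult)
  qed
  have "(\<lambda>n. norm (hecke M n * real n powr (-s))) summable_on {0<..}" using sm by simp
  hence sm2: "(\<lambda>n. 2 * (hecke M n * real n powr (-s))) summable_on {0<..}"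
    by (rule summable_on_cmult_right[OF abs_summable_summable])
  have 3: "(\<lambda>(n, z). lattice_term M s z) summable_on (Sigma {0<..} osphere)"
    using abs_summable_summable[OF abs]
    by (subst (asm) summable_on_reindex_bij_betw[OF bij, symmetric]) (simp add: case_prod_unfold)
  have "lattice_sum M s = infsum (\<lambda>(n, z). lattice_term M s z) (Sigma {0<..} osphere)"
    unfolding lattice_sum_def by (subst infsum_reindex_bij_betw[OF bij, symmetric]) (simp add: case_prod_unfold)
  also have "\<dots> = (\<Sum>\<^sub>\<infinity>n\<in>{0<..}. infsum (lattice_term M s) (osphere n))"
    using infsum_Sigma'_banach[OF 3] by simp
  also have "\<dots> = (\<Sum>\<^sub>\<infinity>n\<in>{0<..}. of_real (2 * (hecke M n * real n powr (-s))))"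
  proof (rule infsum_cong)
    fix n :: nat
    have "infsum (lattice_term M s) (osphere n) = (\<Sum>z\<in>osphere n. sgn z ^ M * of_real (real n powr (-s)))"
      unfolding infsum_finite[OF finite_osphere] by (intro sum.cong refl) (simp only: lattice_term_def pw)
    also have "\<dots> = of_real (2 * hecke M n) * of_real (real n powr (-s))"
      by (simp add: sum_distrib_right[symmetric] sum_osphere_sgn)
    finally show "infsum (lattice_term M s) (osphere n) = of_real (2 * (hecke M n * real n powr (-s)))" by simp
  qed
  also have "\<dots> = of_real (\<Sum>\<^sub>\<infinity>n\<in>{0<..}. 2 * (hecke M n * real n powr (-s)))"
    by (rule infsumI, subst has_sum_of_real_iff, rule has_sum_infsum[OF sm2])
  finally show "cmod (lattice_sum M s) = 2 * \<bar>infsum (\<lambda>n. hecke M n * real n powr (-s)) {0<..}\<bar>"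
    by (simp add: infsum_cmult_right' abs_mult del: of_real_mult)
qed

no_notation Infinite_Set_Sum.abs_summable_on (infix \<open>abs'_summable'_on\<close> 50)

section \<open>Euler products and sums over primes\<close>

definition mult_fun :: "(nat \<Rightarrow> real) \<Rightarrow> bool" where
  "mult_fun f \<longleftrightarrow> f 1 = 1 \<and> (\<forall>a b. a > 0 \<longrightarrow> b > 0 \<longrightarrow> coprime a b \<longrightarrow> f (a * b) = f a * f b)"

definition smooth :: "nat set \<Rightarrow> nat set" where
  "smooth P = {n. n > 0 \<and> prime_factors n \<subseteq> P}"

definition primes_upto :: "nat \<Rightarrow> nat set" where
  "primes_upto N = {q. prime q \<and> q \<le> N}"

lemma finite_primes_upto [simp, intro]: "finite (primes_upto N)"
  by (rule finite_subset[of _ "{..N}"]) (auto simp: primes_upto_def)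

lemma mult_funD: "mult_fun f \<Longrightarrow> a > 0 \<Longrightarrow> b > 0 \<Longrightarrow> coprime a b \<Longrightarrow> f (a * b) = f a * f b"
  and mult_fun_1: "mult_fun f \<Longrightarrow> f 1 = 1"
  by (auto simp: mult_fun_def)

lemma mult_fun_times: "mult_fun f \<Longrightarrow> mult_fun g \<Longrightarrow> mult_fun (\<lambda>n. f n * g n)"
  by (auto simp: mult_fun_def)

lemma mult_fun_abs: "mult_fun f \<Longrightarrow> mult_fun (\<lambda>n. \<bar>f n\<bar>)"
  by (auto simp: mult_fun_def abs_mult)

lemma mult_fun_power: "mult_fun f \<Longrightarrow> mult_fun (\<lambda>n. f n ^ k)"
  by (auto simp: mult_fun_def power_mult_distrib)

lemma mult_fun_powr: "mult_fun (\<lambda>n. real n powr s)"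
  by (auto simp: mult_fun_def powr_mult)

text \<open>Each step splits off a full prime power, so the cofactor is coprime to it and a
  multiplicative function factors.\<close>

lemma prime_power_induct [consumes 1, case_names one mult]:
  fixes n :: nat
  assumes "n > 0" "P 1"
    and "\<And>q k m. prime q \<Longrightarrow> k > 0 \<Longrightarrow> m > 0 \<Longrightarrow> \<not> q dvd m \<Longrightarrow> P m \<Longrightarrow> P (q ^ k * m)"
  shows "P n"
  using assms(1)
proof (induction n rule: less_induct)
  case (less n)
  show ?case
  proof (cases "n = 1")
    case True thus ?thesis using assms(2) by simp
  next
    case False
    then obtain q where q: "prime q" "q dvd n" using prime_factor_nat by blast
    have nu: "\<not> is_unit q" using q by auto
    obtain m where m: "n = q ^ multiplicity q n * m" "\<not> q dvd m"
      using multiplicity_decompose'[of n q] less.prems nu by auto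
    have k: "multiplicity q n > 0" using q less.prems by (simp add: prime_multiplicity_gt_zero_iff)
    have m0: "m > 0" using m(2) by (cases m) auto
    have "m < q ^ multiplicity q n * m"
      using m0 one_less_power[OF prime_gt_1_nat[OF q(1)] k] by simp
    hence "m < n" using m(1) by simp
    thus ?thesis using less.IH[of m] m0 assms(3)[OF q(1) k m0 m(2)] m(1) by simp
  qed
qed

lemma coprime_prime_power_nat: "prime (q::nat) \<Longrightarrow> \<not> q dvd m \<Longrightarrow> coprime (q ^ k) m"
  by (simp add: prime_imp_coprime_nat)

lemma mult_fun_le:
  assumes "mult_fun f" "mult_fun g" "\<And>n. 0 \<le> f n" "\<And>n. 0 \<le> g n" "n > 0"
    and "\<And>q k. prime q \<Longrightarrow> k > 0 \<Longrightarrow> q dvd n \<Longrightarrow> f (q ^ k) \<le> g (q ^ k)"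
  shows "f n \<le> g n"
  using assms(5,6)
proof (induction n rule: prime_power_induct)
  case one
  thus ?case using assms(1,2) by (simp add: mult_fun_def)
next
  case (mult q k m)
  have q: "q ^ k > 0" using mult prime_gt_0_nat by simp
  have "f (q ^ k * m) = f (q ^ k) * f m" "g (q ^ k * m) = g (q ^ k) * g m"
    using assms(1,2) mult_funD q mult(3) coprime_prime_power_nat[OF mult(1,4)] by auto
  moreover have "f (q ^ k) \<le> g (q ^ k)" using mult by (auto intro: mult.prems)
  moreover have "f m \<le> g m" by (rule mult.IH) (use mult.prems in auto)
  ultimately show ?case using assms(3,4) by (simp add: mult_mono)
qed

lemma smooth_insert_bij:
  assumes "prime q" "q \<notin> P"
  shows "bij_betw (\<lambda>(n,k). n * q ^ k) (smooth P \<times> UNIV) (smooth (insert q P))"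
proof (rule bij_betw_byWitness[where f' = "\<lambda>m. (m div q ^ multiplicity q m, multiplicity q m)"])
  have q0: "q > 0" and nu: "\<not> is_unit q" using assms(1) prime_gt_0_nat by auto
  have ndvd: "\<not> q dvd n" if "n \<in> smooth P" for n
    using that assms by (auto simp: smooth_def prime_factors_dvd)
  have mul: "multiplicity q (n * q ^ k) = k" if "n \<in> smooth P" for n k
  proof -
    have "n > 0" using that by (simp add: smooth_def)
    hence "multiplicity q (n * q ^ k) = multiplicity q n + multiplicity q (q ^ k)"
      using q0 assms(1) by (intro prime_elem_multiplicity_mult_distrib) auto
    thus ?thesis using ndvd[OF that] assms(1) by (simp add: not_dvd_imp_multiplicity_0)
  qed
  show "\<forall>a\<in>smooth P \<times> UNIV. (\<lambda>m. (m div q ^ multiplicity q m, multiplicity q m)) (case a of (n, k) \<Rightarrow> n * q ^ k) = a"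
    using mul q0 by auto
  show "\<forall>m\<in>smooth (insert q P). (case (m div q ^ multiplicity q m, multiplicity q m) of (n, k) \<Rightarrow> n * q ^ k) = m"
    by (auto simp: multiplicity_dvd)
  show "(\<lambda>(n, k). n * q ^ k) ` (smooth P \<times> UNIV) \<subseteq> smooth (insert q P)"
  proof clarify
    fix n k assume n: "n \<in> smooth P"
    have "prime_factors (n * q ^ k) \<subseteq> insert q P"
    proof
      fix p assume "p \<in> prime_factors (n * q ^ k)"
      hence p: "prime p" "p dvd n * q ^ k" by (auto simp: prime_factors_dvd)
      hence "p dvd n \<or> p dvd q" using prime_dvd_mult_iff prime_dvd_power by blast
      thus "p \<in> insert q P" using p n assms(1) primes_dvd_imp_eq
        by (auto simp: smooth_def prime_factors_dvd)
    qed
    thus "n * q ^ k \<in> smooth (insert q P)" using n q0 by (auto simp: smooth_def)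
  qed
  show "(\<lambda>m. (m div q ^ multiplicity q m, multiplicity q m)) ` smooth (insert q P) \<subseteq> smooth P \<times> UNIV"
  proof clarify
    fix m assume m: "m \<in> smooth (insert q P)"
    hence m0: "m > 0" by (simp add: smooth_def)
    obtain m' where m': "m = q ^ multiplicity q m * m'" "\<not> q dvd m'"
      using multiplicity_decompose'[of m q] m0 nu by auto
    have eq: "m div q ^ multiplicity q m = m'" using q0 by (subst m'(1)) simp
    have m'0: "m' > 0" using m'(2) by (cases m') auto
    have "m' dvd m" by (subst m'(1)) simp
    have "prime_factors m' \<subseteq> P"
    proof
      fix p assume "p \<in> prime_factors m'"
      hence p: "prime p" "p dvd m'" by (auto simp: prime_factors_dvd)
      hence "p dvd m" using \<open>m' dvd m\<close> dvd_trans by blast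
      hence "p \<in> insert q P" using m p m0 by (auto simp: smooth_def prime_factors_dvd)
      thus "p \<in> P" using p m'(2) by auto
    qed
    thus "m div q ^ multiplicity q m \<in> smooth P \<and> multiplicity q m \<in> UNIV"
      unfolding eq using m'0 by (simp add: smooth_def)
  qed
qed

lemma has_sum_nat_suminf:
  fixes f :: "nat \<Rightarrow> real"
  assumes "summable (\<lambda>k. \<bar>f k\<bar>)"
  shows "infsum f UNIV = (\<Sum>k. f k)" "f abs_summable_on UNIV"
proof -
  have "f sums (\<Sum>k. f k)" using assms summable_rabs_cancel by blast
  from norm_summable_imp_has_sum[OF _ this] assms show "infsum f UNIV = (\<Sum>k. f k)"
    by (intro infsumI) simp
  show "f abs_summable_on UNIV" using assms by (subst summable_on_UNIV_nonneg_real_iff) auto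
qed

text \<open>Primes are adjoined one at a time: unique factorisation makes the new index set a
  product, and absolute convergence separates the double sum. Signs are allowed, as the Dirichlet
  series of \<open>hecke\<close> is later bounded from below through its Euler product.\<close>

lemma euler_product:
  assumes "finite P" "\<And>q. q \<in> P \<Longrightarrow> prime q" "mult_fun f"
    "\<And>q. q \<in> P \<Longrightarrow> summable (\<lambda>k. \<bar>f (q ^ k)\<bar>)"
  shows "f abs_summable_on smooth P \<and> infsum f (smooth P) = (\<Prod>q\<in>P. \<Sum>k. f (q ^ k))"
  using assms(1,2,4)
proof (induction P rule: finite_induct)
  case empty
  have "smooth {} = {1}" by (auto simp: smooth_def prime_factorization_empty_iff)
  thus ?case using assms(3) by (simp add: mult_fun_def)
next
  case (insert q P)
  let ?g = "\<lambda>k. f (q ^ k)"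
  let ?h = "\<lambda>(n,k). f n * ?g k"
  have q: "prime q" using insert by auto
  have IH: "f abs_summable_on smooth P" "infsum f (smooth P) = (\<Prod>q\<in>P. \<Sum>k. f (q ^ k))"
    using insert.IH insert.prems by auto
  have sg: "summable (\<lambda>k. \<bar>?g k\<bar>)" using insert by auto
  note g = has_sum_nat_suminf[OF sg]
  have h: "?h abs_summable_on smooth P \<times> UNIV"
  proof (subst Infinite_Sum.abs_summable_on_Sigma_iff, intro conjI ballI)
    fix n
    show "(\<lambda>k. case (n, k) of (n, k) \<Rightarrow> f n * ?g k) abs_summable_on UNIV"
      using g(2) by (simp add: abs_mult summable_on_cmult_right)
  next
    have "(\<Sum>\<^sub>\<infinity>k. norm (case (n, k) of (n, k) \<Rightarrow> f n * ?g k)) = \<bar>f n\<bar> * (\<Sum>\<^sub>\<infinity>k. \<bar>?g k\<bar>)" for n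
      by (simp add: abs_mult infsum_cmult_right')
    thus "(\<lambda>n. \<Sum>\<^sub>\<infinity>k. norm (case (n, k) of (n, k) \<Rightarrow> f n * ?g k)) abs_summable_on smooth P"
      using IH(1) by (simp add: abs_mult summable_on_cmult_left)
  qed
  have feq: "f (case x of (n,k) \<Rightarrow> n * q ^ k) = ?h x" if x: "x \<in> smooth P \<times> UNIV" for x
  proof -
    obtain n k where nk: "x = (n, k)" "n \<in> smooth P" using x by auto
    have "n > 0" "\<not> q dvd n" using nk(2) insert.hyps q by (auto simp: smooth_def prime_factors_dvd)
    hence "f (n * q ^ k) = f n * ?g k" using prime_gt_0_nat[OF q] coprime_prime_power_nat[OF q]
      by (intro mult_funD[OF assms(3)]) (auto simp: coprime_commute)
    thus ?thesis by (simp add: nk(1))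
  qed
  note bij = smooth_insert_bij[OF q \<open>q \<notin> P\<close>]
  have "f abs_summable_on smooth (insert q P)"
    using h feq by (subst summable_on_reindex_bij_betw[OF bij, symmetric])
      (simp cong: summable_on_cong)
  moreover have "infsum f (smooth (insert q P)) = infsum ?h (smooth P \<times> UNIV)"
    using feq by (subst infsum_reindex_bij_betw[OF bij, symmetric]) (rule infsum_cong, simp)
  moreover have "\<dots> = (\<Sum>\<^sub>\<infinity>n\<in>smooth P. \<Sum>\<^sub>\<infinity>k. f n * ?g k)"
    using abs_summable_summable[OF h] by (subst infsum_Sigma'_banach) auto
  moreover have "\<dots> = infsum f (smooth P) * infsum ?g UNIV"
    by (simp add: infsum_cmult_right' infsum_cmult_left')
  ultimately show ?case using g(1) IH(2) insert.hyps by (simp add: mult.commute)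
qed

lemma upto_subset_smooth: "{1..N} \<subseteq> smooth (primes_upto N)"
proof
  fix n assume n: "n \<in> {1..N}"
  hence "q \<le> N" if "q dvd n" for q using dvd_imp_le[OF that] by auto
  thus "n \<in> smooth (primes_upto N)" using n by (auto simp: smooth_def primes_upto_def prime_factors_dvd)
qed

lemma euler_product_upper:
  assumes "mult_fun f" "\<And>n. 0 \<le> f n" "\<And>q. prime q \<Longrightarrow> summable (\<lambda>k. f (q ^ k))"
  shows "(\<Sum>n=1..N. f n) \<le> (\<Prod>q\<in>primes_upto N. \<Sum>k. f (q ^ k))"
proof -
  have *: "f abs_summable_on smooth (primes_upto N) \<and>
     infsum f (smooth (primes_upto N)) = (\<Prod>q\<in>primes_upto N. \<Sum>k. f (q ^ k))"
    by (rule euler_product) (use assms in \<open>auto simp: primes_upto_def\<close>)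
  have "(\<Sum>n=1..N. f n) \<le> infsum f (smooth (primes_upto N))"
    using * assms(2) upto_subset_smooth by (intro finite_sum_le_infsum) (auto dest: abs_summable_summable)
  thus ?thesis using * by simp
qed

subsection \<open>Chebyshev- and Mertens-type bounds\<close>

text \<open>The \<open>k\<close> multiples of \<open>q\<close> among 1, ..., qk each supply one
  factor.\<close>

lemma prime_power_dvd_fact: "(q::nat) > 0 \<Longrightarrow> q ^ k dvd fact (q * k)"
proof (induction k)
  case (Suc k)
  have "fact (q * Suc k) = q * Suc k * fact (q * Suc k - 1)"
    using Suc.prems by (subst fact_reduce) auto
  moreover have "q ^ k dvd fact (q * Suc k - 1)"
    by (rule dvd_trans[OF Suc.IH]) (use Suc.prems in \<open>auto intro!: fact_dvd\<close>)
  ultimately show ?case by (simp add: mult_dvd_mono)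
qed auto

lemma prod_prime_power_dvd:
  fixes m :: nat
  assumes "finite P" "\<And>q. q \<in> P \<Longrightarrow> prime q" "\<And>q. q \<in> P \<Longrightarrow> q ^ e q dvd m"
  shows "(\<Prod>q\<in>P. q ^ e q) dvd m"
  using assms
proof (induction P rule: finite_induct)
  case (insert q P)
  have "coprime (q ^ e q) (\<Prod>q\<in>P. q ^ e q)"
  proof (rule prod_coprime_right)
    fix p assume p: "p \<in> P"
    hence "coprime q p" using insert by (intro primes_coprime) auto
    thus "coprime (q ^ e q) (p ^ e p)" by simp
  qed
  thus ?case using insert by (simp add: divides_mult)
qed auto

text \<open>The product of q^(N div q) divides N! \<le> N^N, which accounts for one ln N after
  taking logarithms. The second one pays crudely for rounding N/q down.\<close>

lemma sum_ln_div_primes_le: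
  assumes "N \<ge> 1" shows "(\<Sum>q\<in>primes_upto N. ln (real q) / real q) \<le> 2 * ln (real N)"
proof -
  let ?P = "primes_upto N"
  have q0: "q > 0" if "q \<in> ?P" for q using that prime_gt_0_nat by (auto simp: primes_upto_def)
  have "(\<Prod>q\<in>?P. q ^ (N div q)) dvd fact N"
    by (rule prod_prime_power_dvd)
       (auto simp: primes_upto_def prime_gt_0_nat intro!: dvd_trans[OF prime_power_dvd_fact] fact_dvd)
  hence "(\<Prod>q\<in>?P. q ^ (N div q)) \<le> fact N" by (rule dvd_imp_le) simp
  also have "\<dots> \<le> N ^ N" using fact_le_power[of N] by (metis of_nat_fact of_nat_id of_nat_le_iff)
  finally have "real (\<Prod>q\<in>?P. q ^ (N div q)) \<le> real (N ^ N)" by (simp only: of_nat_le_iff)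
  hence "ln (real (\<Prod>q\<in>?P. q ^ (N div q))) \<le> ln (real (N ^ N))"
    using q0 assms by (subst ln_le_cancel_iff) (auto intro!: prod_pos)
  moreover have "ln (real (\<Prod>q\<in>?P. q ^ (N div q))) = (\<Sum>q\<in>?P. real (N div q) * ln (real q))"
    using q0 by (simp add: ln_prod ln_realpow)
  ultimately have 1: "(\<Sum>q\<in>?P. real (N div q) * ln (real q)) \<le> real N * ln (real N)"
    using assms by (simp add: ln_realpow)
  have "real N * (\<Sum>q\<in>?P. ln (real q) / real q) = (\<Sum>q\<in>?P. real N / real q * ln (real q))"
    by (simp add: sum_distrib_left)
  also have "\<dots> \<le> (\<Sum>q\<in>?P. (real (N div q) + 1) * ln (real q))"
  proof (intro sum_mono mult_right_mono)
    fix q assume q: "q \<in> ?P"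
    show "ln (real q) \<ge> 0" using q0[OF q] by simp
    show "real N / real q \<le> real (N div q) + 1"
    proof -
      have "N mod q < q" using q0[OF q] by simp
      hence "N < (N div q + 1) * q" using div_mult_mod_eq[of N q] by (simp only: add_mult_distrib)
      hence "real N \<le> real ((N div q + 1) * q)" by (simp only: of_nat_le_iff)
      thus ?thesis using q0[OF q] by (simp add: field_simps)
    qed
  qed
  also have "\<dots> = (\<Sum>q\<in>?P. real (N div q) * ln (real q)) + (\<Sum>q\<in>?P. ln (real q))"
    by (simp add: algebra_simps sum.distrib)
  also have "(\<Sum>q\<in>?P. ln (real q)) \<le> (\<Sum>q\<in>{1..N}. ln (real N))"
  proof -
    have "(\<Sum>q\<in>?P. ln (real q)) \<le> (\<Sum>q\<in>?P. ln (real N))"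
    proof (rule sum_mono)
      fix q assume "q \<in> ?P"
      thus "ln (real q) \<le> ln (real N)" using q0[of q] by (simp add: primes_upto_def)
    qed
    also have "\<dots> \<le> (\<Sum>q\<in>{1..N}. ln (real N))"
    proof (rule sum_mono2)
      show "?P \<subseteq> {1..N}" using prime_ge_1_nat by (auto simp: primes_upto_def)
    qed (use assms in auto)
    finally show ?thesis .
  qed
  finally have "real N * (\<Sum>q\<in>?P. ln (real q) / real q) \<le> real N * (2 * ln (real N))"
    using 1 by (simp add: algebra_simps)
  thus ?thesis using assms by simp
qed

text \<open>Comparison with the integral of t^(-s) up to \<open>m\<close>; carrying the subtracted
  tail of that integral makes the induction close.\<close>

lemma sum_powr_le:
  fixes s :: real
  assumes "s > 1" "m \<ge> 1"
  shows "(\<Sum>n=1..m. real n powr (-s)) \<le> 1 + 1 / (s - 1) - real m powr (1 - s) / (s - 1)"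
  using assms(2)
proof (induction m rule: nat_induct_at_least)
  case base
  show ?case using assms by simp
next
  case (Suc m)
  define t where "t = 1 / real (Suc m)"
  have t: "0 < t" "t < 1" using Suc by (auto simp: t_def)
  have "1 + (s - 1) * t \<le> 1 + (s - 1) * (- ln (1 - t))"
    using assms(1) t ln_le_minus_one[of "1 - t"] by (intro add_left_mono mult_left_mono) auto
  also have "\<dots> \<le> exp ((s - 1) * (- ln (1 - t)))" by (rule exp_ge_add_one_self)
  also have "\<dots> = (1 - t) powr (1 - s)" using t by (simp add: powr_def algebra_simps)
  finally have "real (Suc m) powr (1 - s) * (1 + (s - 1) * t) \<le> real (Suc m) powr (1 - s) * (1 - t) powr (1 - s)"
    by (intro mult_left_mono) auto
  also have "\<dots> = (real (Suc m) * (1 - t)) powr (1 - s)" using t by (subst powr_mult) auto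
  also have "real (Suc m) * (1 - t) = real m" by (simp add: t_def field_simps)
  finally have "real (Suc m) powr (1 - s) + (s - 1) * (real (Suc m) powr (1 - s) * t) \<le> real m powr (1 - s)"
    by (simp add: algebra_simps)
  moreover have "real (Suc m) powr (1 - s) * t = real (Suc m) powr (- s)"
    by (simp add: t_def powr_diff powr_minus field_simps)
  ultimately have "real (Suc m) powr (- s) \<le> (real m powr (1 - s) - real (Suc m) powr (1 - s)) / (s - 1)"
    using assms(1) by (simp add: field_simps)
  thus ?case using Suc.IH by (simp add: diff_divide_distrib)
qed

text \<open>At s = 1 + 1/ln N the sum over all n is at most 1 + ln N, so its Euler product bounds
  the sum of q^(-s) by ln(1 + ln N). For q \<le> N passing from q^(-s) to 1/q costs at most the
  factor e.\<close>

lemma sum_inverse_primes_le: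
  assumes "N \<ge> 2" shows "(\<Sum>q\<in>primes_upto N. 1 / real q) \<le> exp 1 * ln (1 + ln (real N))"
proof -
  let ?P = "primes_upto N"
  have lnN: "ln (real N) > 0" using assms by simp
  define s where "s = 1 + 1 / ln (real N)"
  have s: "s > 1" using lnN by (simp add: s_def)
  define f where "f n = real n powr (-s)" for n
  have q2: "q \<ge> 2" if "q \<in> ?P" for q using that prime_ge_2_nat by (auto simp: primes_upto_def)
  have fq: "f (q ^ k) = (f q) ^ k" for q k
    by (induction k) (auto simp: f_def powr_mult)
  have f1: "0 < f q" "f q < 1" if "q \<in> ?P" for q
    using q2[OF that] s powr_less_mono[of "-s" 0 "real q"] by (auto simp: f_def)
  have *: "f abs_summable_on smooth ?P \<and> infsum f (smooth ?P) = (\<Prod>q\<in>?P. \<Sum>k. f (q ^ k))"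
  proof (rule euler_product)
    show "mult_fun f" unfolding f_def by (rule mult_fun_powr)
    show "summable (\<lambda>k. \<bar>f (q ^ k)\<bar>)" if "q \<in> ?P" for q
      using f1[OF that] by (auto simp: fq summable_geometric power_abs)
  qed (auto simp: primes_upto_def)
  have "infsum f (smooth ?P) \<le> 1 + ln (real N)"
  proof (rule infsum_le_finite_sums)
    show "f summable_on smooth ?P" using * abs_summable_summable by blast
    fix F assume F: "finite F" "F \<subseteq> smooth ?P"
    define m where "m = Max (insert 1 F)"
    have "F \<subseteq> {1..m}" using F by (auto simp: m_def smooth_def Suc_le_eq)
    hence "sum f F \<le> (\<Sum>n=1..m. f n)" by (intro sum_mono2) (auto simp: f_def)
    also have "\<dots> \<le> 1 + 1 / (s - 1) - real m powr (1 - s) / (s - 1)"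
      unfolding f_def using s F by (intro sum_powr_le) (auto simp: m_def)
    also have "\<dots> \<le> 1 + 1 / (s - 1)" using s by simp
    finally show "sum f F \<le> 1 + ln (real N)" by (simp add: s_def)
  qed
  moreover have "exp (\<Sum>q\<in>?P. f q) \<le> (\<Prod>q\<in>?P. \<Sum>k. f (q ^ k))"
    unfolding exp_sum[OF finite_primes_upto]
  proof (intro prod_mono conjI)
    fix q assume q: "q \<in> ?P"
    have "exp (f q) * (1 - f q) \<le> exp (f q) * exp (- f q)"
      using exp_ge_add_one_self[of "- f q"] by (intro mult_left_mono) auto
    hence "exp (f q) \<le> 1 / (1 - f q)" using f1[OF q] by (simp add: exp_minus field_simps)
    also have "\<dots> = (\<Sum>k. f (q ^ k))" using f1[OF q] by (simp add: fq suminf_geometric)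
    finally show "exp (f q) \<le> (\<Sum>k. f (q ^ k))" .
  qed auto
  ultimately have "exp (\<Sum>q\<in>?P. f q) \<le> 1 + ln (real N)" using * by simp
  hence 1: "(\<Sum>q\<in>?P. f q) \<le> ln (1 + ln (real N))" using lnN by (subst ln_ge_iff) auto
  have "(\<Sum>q\<in>?P. 1 / real q) \<le> (\<Sum>q\<in>?P. exp 1 * f q)"
  proof (rule sum_mono)
    fix q assume q: "q \<in> ?P"
    have "f q = 1 / real q * real q powr (- 1 / ln (real N))"
      using q2[OF q] by (simp add: f_def s_def powr_diff powr_minus field_simps flip: powr_add)
    also have "real q powr (- 1 / ln (real N)) = exp (- (ln (real q) / ln (real N)))"
      using q2[OF q] by (simp add: powr_def)
    finally have "f q = 1 / real q * exp (- (ln (real q) / ln (real N)))" .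
    moreover have "exp (-1) \<le> exp (- (ln (real q) / ln (real N)))"
      using q q2[OF q] lnN by (auto simp: primes_upto_def)
    ultimately have "1 / real q * exp (-1) \<le> f q" using q2[OF q] by (simp add: divide_right_mono)
    hence "exp 1 * (1 / real q * exp (-1)) \<le> exp 1 * f q" by (intro mult_left_mono) auto
    moreover have "exp 1 * (1 / real q * exp (-1)) = 1 / real q" by (simp add: exp_minus)
    ultimately show "1 / real q \<le> exp 1 * f q" by linarith
  qed
  also have "\<dots> \<le> exp 1 * ln (1 + ln (real N))"
    unfolding sum_distrib_left[symmetric] using 1 by (intro mult_left_mono) auto
  finally show ?thesis .
qed

text \<open>The reciprocal is the Euler product at s = 1, which dominates the harmonic sum up to
  \<open>N\<close>.\<close>

lemma prod_one_minus_inverse_primes_le: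
  assumes "N \<ge> 1" shows "(\<Prod>q\<in>primes_upto N. 1 - 1 / real q) \<le> 1 / ln (real N + 1)"
proof -
  let ?P = "primes_upto N"
  have q2: "q \<ge> 2" if "q \<in> ?P" for q using that prime_ge_2_nat by (auto simp: primes_upto_def)
  define f where "f n = real n powr (-1)" for n
  have fq: "f (q ^ k) = (1 / real q) ^ k" if "q > 0" for q k
    using that by (simp add: f_def powr_minus field_simps)
  have "(\<Sum>n=1..N. f n) \<le> (\<Prod>q\<in>?P. \<Sum>k. f (q ^ k))"
  proof (rule euler_product_upper)
    show "mult_fun f" unfolding f_def by (rule mult_fun_powr)
    show "summable (\<lambda>k. f (q ^ k))" if "prime q" for q
      using prime_ge_2_nat[OF that] by (simp add: fq summable_geometric)
  qed (auto simp: f_def)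
  also have "(\<Prod>q\<in>?P. \<Sum>k. f (q ^ k)) = (\<Prod>q\<in>?P. 1 / (1 - 1 / real q))"
  proof (rule prod.cong[OF refl])
    fix q assume q: "q \<in> ?P"
    show "(\<Sum>k. f (q ^ k)) = 1 / (1 - 1 / real q)"
      using q2[OF q] by (simp add: fq suminf_geometric)
  qed
  also have "(\<Sum>n=1..N. f n) = harm N"
    by (simp add: harm_def f_def powr_minus)
  finally have "ln (real N + 1) \<le> (\<Prod>q\<in>?P. 1 / (1 - 1 / real q))" using ln_le_harm[of N] by simp
  also have "\<dots> = 1 / (\<Prod>q\<in>?P. 1 - 1 / real q)" by (simp add: prod_dividef)
  finally have *: "ln (real N + 1) \<le> 1 / (\<Prod>q\<in>?P. 1 - 1 / real q)" .
  have "(\<Prod>q\<in>?P. 1 - 1 / real q) > 0" using q2 by (intro prod_pos) force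
  moreover have "ln (real N + 1) > 0" using assms by simp
  ultimately show ?thesis using * by (simp add: field_simps)
qed

lemma sum_inverse_square_primes_le: "(\<Sum>q\<in>primes_upto N. 1 / real q ^ 2) \<le> (\<Sum>n. 1 / real n ^ 2)"
  by (intro sum_le_suminf) (use inverse_power_summable[of 2, where 'a = real] in \<open>auto simp: field_simps\<close>)

section \<open>Means of nonnegative multiplicative functions\<close>

text \<open>Each Euler factor is 1 + f(q)/q + O(1/q^2) and is bounded by an exponential; the
  constant depends on \<open>A\<close> alone. The fourth power is dictated by the fourth moment of
  \<open>hecke\<close>, whose value at q^k is at most k + 1.\<close>

lemma euler_upper_bound:
  assumes "A \<ge> 0"
  shows "\<exists>C>0. \<forall>f N. mult_fun f \<longrightarrow> (\<forall>n. 0 \<le> f n) \<longrightarrow>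
     (\<forall>q k. prime q \<longrightarrow> f (q ^ k) \<le> A * (real k + 1) ^ 4) \<longrightarrow>
     (\<Sum>n=1..N. f n / real n) \<le> C * exp (\<Sum>q\<in>primes_upto N. f q / real q)"
proof -
  define K where "K = (\<Sum>k. (real k + 3) ^ 4 / 2 ^ k)"
  have sK: "summable (\<lambda>k. (real k + 3) ^ 4 / 2 ^ k :: real)"
  proof (rule summable_ratio_test[of "3/4" 10])
    fix k :: nat assume k: "10 \<le> k"
    \<comment> \<open>From k = 10 on consecutive values of k + 3 have ratio at most 14/13, and
      (14/13)^4 < 3/2 leaves the ratio 3/4 after halving.\<close>
    have "real (Suc k) + 3 \<le> 14/13 * (real k + 3)" using k by simp
    hence "(real (Suc k) + 3) ^ 4 \<le> (14/13 * (real k + 3)) ^ 4" by (intro power_mono) auto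
    also have "\<dots> = (14/13) ^ 4 * (real k + 3) ^ 4" by (rule power_mult_distrib)
    also have "\<dots> \<le> 3/2 * (real k + 3) ^ 4" by (intro mult_right_mono) (auto simp: power4_eq_xxxx)
    finally show "norm ((real (Suc k) + 3) ^ 4 / 2 ^ Suc k) \<le> 3/4 * norm ((real k + 3) ^ 4 / 2 ^ k)"
      by (simp add: field_simps)
  qed auto
  have K0: "K \<ge> 0" unfolding K_def by (rule suminf_nonneg[OF sK]) auto
  define S where "S = (\<Sum>n. 1 / real n ^ 2)"
  have "(\<Sum>n=1..N. f n / real n) \<le> exp (A * K * S) * exp (\<Sum>q\<in>primes_upto N. f q / real q)"
    if f: "mult_fun f" "\<And>n. 0 \<le> f n" "\<And>q k. prime q \<Longrightarrow> f (q ^ k) \<le> A * (real k + 1) ^ 4" for f N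
  proof -
    define g where "g n = f n * real n powr (-1)" for n
    have g: "g n = f n / real n" for n by (simp add: g_def powr_minus divide_inverse)
    have mg: "mult_fun g" unfolding g_def by (intro mult_fun_times f mult_fun_powr)
    have tail: "summable (\<lambda>k. g (q ^ (k + 2)))" "(\<Sum>k. g (q ^ (k + 2))) \<le> A * K / real q ^ 2"
      if q: "prime q" for q
    proof -
      have q2: "real q \<ge> 2" using prime_ge_2_nat[OF q] by simp
      have b: "g (q ^ (k + 2)) \<le> A / real q ^ 2 * ((real k + 3) ^ 4 / 2 ^ k)" for k
      proof -
        have "g (q ^ (k + 2)) \<le> A * (real (k + 2) + 1) ^ 4 / real q ^ (k + 2)"
          unfolding g using f(3)[OF q, of "k + 2"] by (simp add: divide_right_mono)
        also have "\<dots> \<le> A * (real (k + 2) + 1) ^ 4 / (2 ^ k * real q ^ 2)"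
          unfolding power_add using q2 assms
          by (intro divide_left_mono mult_right_mono power_mono) auto
        finally show ?thesis by (simp add: add_ac mult_ac)
      qed
      have s: "summable (\<lambda>k. A / real q ^ 2 * ((real k + 3) ^ 4 / 2 ^ k))"
        by (rule summable_mult[OF sK])
      show 1: "summable (\<lambda>k. g (q ^ (k + 2)))"
        by (rule summable_comparison_test'[OF s, of 0]) (use b f(2) in \<open>simp add: g\<close>)
      have "(\<Sum>k. g (q ^ (k + 2))) \<le> (\<Sum>k. A / real q ^ 2 * ((real k + 3) ^ 4 / 2 ^ k))"
        by (rule suminf_le[OF b 1 s])
      also have "\<dots> = A / real q ^ 2 * K" unfolding K_def by (rule suminf_mult[OF sK])
      finally show "(\<Sum>k. g (q ^ (k + 2))) \<le> A * K / real q ^ 2" by simp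
    qed
    have sg: "summable (\<lambda>k. g (q ^ k))" if "prime q" for q
      using tail(1)[OF that] summable_iff_shift[of "\<lambda>k. g (q ^ k)" 2] by simp
    have "(\<Sum>n=1..N. g n) \<le> (\<Prod>q\<in>primes_upto N. \<Sum>k. g (q ^ k))"
      by (rule euler_product_upper[OF mg _ sg]) (use f in \<open>auto simp: g\<close>)
    also have "\<dots> \<le> (\<Prod>q\<in>primes_upto N. exp (g q + A * K * (1 / real q ^ 2)))"
    proof (intro prod_mono conjI)
      fix q assume "q \<in> primes_upto N"
      hence q: "prime q" by (simp add: primes_upto_def)
      show "0 \<le> (\<Sum>k. g (q ^ k))" using sg[OF q] f(2) by (intro suminf_nonneg) (auto simp: g)
      have "(\<Sum>k. g (q ^ k)) = (\<Sum>k. g (q ^ (k + 2))) + (\<Sum>k<2. g (q ^ k))"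
        by (rule suminf_split_initial_segment[OF sg[OF q]])
      also have "(\<Sum>k<2. g (q ^ k)) = 1 + g q"
        using mult_fun_1[OF mg] by (simp add: numeral_2_eq_2)
      also have "(\<Sum>k. g (q ^ (k + 2))) + (1 + g q) \<le> 1 + (g q + A * K * (1 / real q ^ 2))"
        using tail(2)[OF q] by simp
      also have "\<dots> \<le> exp (g q + A * K * (1 / real q ^ 2))" by (rule exp_ge_add_one_self)
      finally show "(\<Sum>k. g (q ^ k)) \<le> exp (g q + A * K * (1 / real q ^ 2))" .
    qed
    also have "\<dots> = exp ((\<Sum>q\<in>primes_upto N. g q) + A * K * (\<Sum>q\<in>primes_upto N. 1 / real q ^ 2))"
      by (simp add: exp_sum[symmetric] sum.distrib sum_distrib_left)
    also have "\<dots> \<le> exp ((\<Sum>q\<in>primes_upto N. g q) + A * K * S)"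
      using sum_inverse_square_primes_le[of N] K0 assms unfolding S_def
      by (simp add: mult_left_mono)
    also have "\<dots> = exp (A * K * S) * exp (\<Sum>q\<in>primes_upto N. g q)"
      by (simp add: exp_add)
    finally show ?thesis by (simp add: g)
  qed
  thus ?thesis by (intro exI[of _ "exp (A * K * S)"]) auto
qed

section \<open>The sums over primes attached to the angular characters\<close>

lemma mult_fun_hecke: "even M \<Longrightarrow> mult_fun (hecke M)"
  using hecke_mult hecke_1 by (auto simp: mult_fun_def)

section \<open>Lower bounds for Euler factors and sums of coefficients over primes\<close>

text \<open>The factor is 1 + t with t = g(1)X + E, and ln(1 + t) \<ge> t - t^2/(1 + t). Here |E|
  \<le> 5X^2, t^2 \<le> 9X^2 and 1 + t \<ge> 2/5, so the loss is at most 5 + 9 * 5/2 < 28 times X^2.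
  The restriction X \<le> 1/5 keeps 1 + t positive.\<close>

lemma suminf_ge_exp:
  fixes g :: "nat \<Rightarrow> real" and X :: real
  assumes "g 0 = 1" "\<And>k. \<bar>g k\<bar> \<le> real k + 1" "0 \<le> X" "X \<le> 1/5"
  shows "exp (g 1 * X - 28 * X^2) \<le> (\<Sum>k. g k * X ^ k)"
proof -
  have geo: "(\<lambda>k. real (Suc k) * X ^ k) sums (1 / (1 - X)^2)"
    using assms by (intro geometric_deriv_sums) auto
  have ab: "\<bar>g k * X ^ k\<bar> \<le> real (Suc k) * X ^ k" for k
    using assms(2)[of k] assms(3) by (simp add: abs_mult mult_right_mono add.commute)
  have sm: "summable (\<lambda>k. g k * X ^ k)"
    by (rule summable_comparison_test'[OF sums_summable[OF geo], of 0]) (use ab in simp)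
  define E where "E = (\<Sum>k. g (k + 2) * X ^ (k + 2))"
  have split: "(\<Sum>k. g k * X ^ k) = 1 + g 1 * X + E"
    using suminf_split_initial_segment[OF sm, of 2] assms(1) by (simp add: E_def numeral_2_eq_2)
  have sm2: "summable (\<lambda>k. g (k + 2) * X ^ (k + 2))" using sm by (subst summable_iff_shift)
  have geo2: "(\<lambda>k. real (Suc (k + 2)) * X ^ (k + 2)) sums (1 / (1 - X)^2 - 1 - 2 * X)"
    using sums_split_initial_segment[OF geo, of 2] by (simp add: numeral_2_eq_2 algebra_simps)
  have sm3: "summable (\<lambda>k. \<bar>g (k + 2) * X ^ (k + 2)\<bar>)"
  proof (rule summable_comparison_test'[OF sums_summable[OF geo2], of 0])
    fix k show "norm \<bar>g (k + 2) * X ^ (k + 2)\<bar> \<le> real (Suc (k + 2)) * X ^ (k + 2)"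
      using ab[of "k + 2"] unfolding real_norm_def abs_idempotent .
  qed
  have "\<bar>E\<bar> \<le> 1 / (1 - X)^2 - 1 - 2 * X"
  proof -
    have "\<bar>E\<bar> \<le> (\<Sum>k. \<bar>g (k + 2) * X ^ (k + 2)\<bar>)"
      unfolding E_def by (rule summable_rabs[OF sm3])
    also have "\<dots> \<le> (\<Sum>k. real (Suc (k + 2)) * X ^ (k + 2))"
      by (rule suminf_le[OF ab sm3 sums_summable[OF geo2]])
    also have "\<dots> = 1 / (1 - X)^2 - 1 - 2 * X" using geo2 by (simp add: sums_iff)
    finally show ?thesis .
  qed
  also have "\<dots> \<le> 5 * X^2"
  proof -
    have "(1 - X)^2 \<ge> (4/5)^2" using assms by (intro power_mono) auto
    hence "(1 + 2 * X + 5 * X^2) * (1 - X)^2 \<ge> 1"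
    proof -
      have "(1 + 2 * X + 5 * X^2) * (1 - X)^2 - 1 = X^2 * (2 - 8 * X + 5 * X^2)"
        by (simp add: power2_eq_square algebra_simps)
      moreover have "2 - 8 * X + 5 * X^2 \<ge> 0"
      proof -
        have "5 * (X - 1/5)^2 \<ge> 0" by simp
        hence "5 * X^2 \<ge> 2 * X - 1/5" by (simp add: power2_eq_square algebra_simps)
        thus ?thesis using assms(4) by linarith
      qed
      ultimately show ?thesis by (metis diff_ge_0_iff_ge mult_nonneg_nonneg zero_le_power2)
    qed
    thus ?thesis using assms by (simp add: field_simps)
  qed
  finally have E: "\<bar>E\<bar> \<le> 5 * X^2" .
  define t where "t = g 1 * X + E"
  have g1: "\<bar>g 1 * X\<bar> \<le> 2 * X" using ab[of 1] by simp
  have X2: "5 * X^2 \<le> X"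
    using mult_left_mono[of "5 * X" 1 X] assms(3,4) by (simp add: power2_eq_square mult_ac)
  have t1: "\<bar>t\<bar> \<le> 3 * X" using g1 E X2 unfolding t_def by linarith
  hence t: "\<bar>t\<bar> \<le> 3 * X" "\<bar>t\<bar> \<le> 3/5" using assms(4) by linarith+
  have "t^2 \<le> (3 * X)^2" using t(1) by (metis abs_ge_zero power2_abs power_mono)
  hence t2: "t^2 \<le> 9 * X^2" by (simp add: power_mult_distrib)
  have pos: "1 + t \<ge> 2/5" using t(2) by linarith
  have "t^2 / (1 + t) \<le> t^2 / (2/5)" using pos by (intro divide_left_mono) auto
  hence "g 1 * X - 28 * X^2 \<le> t - t^2 / (1 + t)"
    using E t2 by (auto simp: t_def)
  also have "\<dots> = 1 - 1 / (1 + t)" using pos by (simp add: field_simps power2_eq_square)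
  also have "\<dots> \<le> ln (1 + t)" using ln_le_minus_one[of "1 / (1 + t)"] pos by (simp add: ln_div)
  finally have "exp (g 1 * X - 28 * X^2) \<le> exp (ln (1 + t))" by (subst exp_le_cancel_iff)
  also have "\<dots> = 1 + t" by (rule exp_ln) (use pos in linarith)
  finally show ?thesis using split by (simp only: t_def add.assoc)
qed

lemma osphere_3: "osphere 3 = {}"
proof (rule ccontr)
  assume "osphere 3 \<noteq> {}"
  then obtain z where z: "z \<in> osphere 3" by auto
  then obtain a b where 1: "Re z = of_int a" "Im z = of_int b" "odd a" "even b"
    by (auto simp: osphere_def elim: odd_gaussE)
  have "of_int (a^2 + b^2) = real_of_int 3" using z 1 by (simp add: cmod_power2 osphere_def)
  hence *: "a^2 + b^2 = 3" by (simp only: of_int_eq_iff)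
  obtain x y where "a = 2 * x + 1" "b = 2 * y" using 1(3,4) by (auto elim!: oddE evenE)
  hence "2 * (2 * (x^2 + x + y^2)) = 2" using * by (simp add: power2_eq_square algebra_simps)
  thus False by presburger
qed

text \<open>For q \<ge> 5 the logarithmic estimate applies. At 2 and 3 all coefficients are
  nonnegative, so the Euler factor is at least 1, while the subtracted 28/q^2 makes the left-hand
  factor at most 1.\<close>

lemma hecke_euler_lower:
  assumes "even M" "1 < s" "s \<le> 2"
  shows "exp (\<Sum>q\<in>primes_upto N. hecke M q * real q powr (-s) - 28 / real q ^ 2)
     \<le> infsum (\<lambda>n. hecke M n * real n powr (-s)) (smooth (primes_upto N))"
proof -
  let ?P = "primes_upto N"
  let ?f = "\<lambda>n. hecke M n * real n powr (-s)"
  have X: "0 < real q powr (-s)" "real q powr (-s) \<le> 1 / real q" "real q powr (-s) \<le> 1/2"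
    if "prime q" for q :: nat
  proof -
    have q: "real q \<ge> 2" using prime_ge_2_nat[OF that] by simp
    show "0 < real q powr (-s)" using q by simp
    have "real q powr (-s) \<le> real q powr (-1)" using q assms by (intro powr_mono) auto
    thus 1: "real q powr (-s) \<le> 1 / real q" by (simp add: powr_minus divide_inverse)
    have "1 / real q \<le> 1 / 2" using q by (intro divide_left_mono) auto
    thus "real q powr (-s) \<le> 1/2" using 1 by linarith
  qed
  have fq: "?f (q ^ k) = hecke M (q ^ k) * (real q powr (-s)) ^ k" if "prime q" for q k
    using prime_gt_0_nat[OF that] by (simp add: powr_realpow[symmetric] powr_powr mult.commute)
  have sm: "summable (\<lambda>k. \<bar>?f (q ^ k)\<bar>)" if q: "prime q" for q
  proof -
    have "summable (\<lambda>k. real (Suc k) * (real q powr (-s)) ^ k)"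
      by (rule sums_summable[OF geometric_deriv_sums]) (use X[OF q] in auto)
    thus ?thesis
    proof (rule summable_comparison_test'[of _ 0])
      fix k :: nat
      have "\<bar>hecke M (q ^ k)\<bar> * (real q powr (-s)) ^ k \<le> real (Suc k) * (real q powr (-s)) ^ k"
        using hecke_prime_power_le[OF q, of M k] by (intro mult_right_mono) auto
      thus "norm \<bar>?f (q ^ k)\<bar> \<le> real (Suc k) * (real q powr (-s)) ^ k"
        unfolding fq[OF q] by (simp add: abs_mult power_abs)
    qed
  qed
  have euler: "infsum ?f (smooth ?P) = (\<Prod>q\<in>?P. \<Sum>k. ?f (q ^ k))"
  proof (rule conjunct2[OF euler_product])
    show "mult_fun ?f" by (rule mult_fun_times[OF mult_fun_hecke[OF assms(1)] mult_fun_powr])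
    show "summable (\<lambda>k. \<bar>?f (q ^ k)\<bar>)" if "q \<in> ?P" for q
      by (rule sm) (use that in \<open>simp add: primes_upto_def\<close>)
  qed (simp_all add: primes_upto_def)
  have "exp (\<Sum>q\<in>?P. hecke M q * real q powr (-s) - 28 / real q ^ 2)
      = (\<Prod>q\<in>?P. exp (hecke M q * real q powr (-s) - 28 / real q ^ 2))"
    by (rule exp_sum) simp
  also have "\<dots> \<le> (\<Prod>q\<in>?P. \<Sum>k. ?f (q ^ k))"
  proof (intro prod_mono conjI)
    fix q assume "q \<in> ?P"
    hence q: "prime q" by (simp add: primes_upto_def)
    let ?X = "real q powr (-s)"
    have eq: "(\<Sum>k. ?f (q ^ k)) = (\<Sum>k. hecke M (q ^ k) * ?X ^ k)" by (simp only: fq[OF q])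
    show "exp (hecke M q * ?X - 28 / real q ^ 2) \<le> (\<Sum>k. ?f (q ^ k))"
    proof (cases "q \<ge> 5")
      case True
      have X5: "?X \<le> 1/5"
      proof -
        have "1 / real q \<le> 1 / 5" using True by (intro divide_left_mono) auto
        thus ?thesis using X(2)[OF q] by linarith
      qed
      have "?X ^ 2 \<le> (1 / real q) ^ 2" using X[OF q] by (intro power_mono) auto
      hence "exp (hecke M q * ?X - 28 / real q ^ 2) \<le> exp (hecke M (q ^ 1) * ?X - 28 * ?X ^ 2)"
        by (simp add: power_divide)
      also have "\<dots> \<le> (\<Sum>k. hecke M (q ^ k) * ?X ^ k)"
        by (rule suminf_ge_exp) (use hecke_prime_power_le[OF q] hecke_1[OF assms(1)] X5 in auto)
      finally show ?thesis unfolding eq .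
    next
      case False
      have "q = 2 \<or> q = 3"
      proof -
        have "q \<ge> 2" "q \<noteq> 4" using q prime_ge_2_nat by auto
        thus ?thesis using False by linarith
      qed
      \<comment> \<open>No point has even norm, which settles q = 2, and 3 is inert.\<close>
      hence nn: "hecke M (q ^ k) \<ge> 0" for k
      proof
        assume "q = 2"
        show ?thesis
        proof (cases "k = 0")
          case True thus ?thesis using hecke_1[OF assms(1)] by simp
        next
          case False
          thus ?thesis using osphere_even[of "q ^ k"] \<open>q = 2\<close> by (simp add: hecke_def)
        qed
      next
        assume "q = 3"
        thus ?thesis using hecke_inert_nonneg[OF q, of M k] osphere_3 assms(1) by simp
      qed
      have "(\<Sum>k<1. ?f (q ^ k)) \<le> (\<Sum>k. ?f (q ^ k))"
        by (rule sum_le_suminf[OF summable_rabs_cancel[OF sm[OF q]]])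
           (simp_all add: mult_nonneg_nonneg[OF nn])
      hence 1: "1 \<le> (\<Sum>k. ?f (q ^ k))" using hecke_1[OF assms(1)] by simp
      have "\<bar>hecke M q\<bar> \<le> 2" using hecke_prime_power_le[OF q, of M 1] by simp
      hence "hecke M q * ?X \<le> 2 * (1/2)" using X[OF q] by (intro mult_mono) auto
      \<comment> \<open>28/16 exceeds the bound 1 for the first term of the exponent.\<close>
      moreover have "real q ^ 2 \<le> 4 ^ 2" using False by (intro power_mono) auto
      hence "28 / real q ^ 2 \<ge> 28 / 16" using prime_gt_0_nat[OF q] by (intro divide_left_mono) auto
      ultimately have "exp (hecke M q * ?X - 28 / real q ^ 2) \<le> exp 0" by (subst exp_le_cancel_iff) linarith
      hence "exp (hecke M q * ?X - 28 / real q ^ 2) \<le> 1" by (simp only: exp_zero)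
      thus ?thesis using 1 by (rule order_trans)
    qed
  qed auto
  finally show ?thesis unfolding euler .
qed

text \<open>Once \<open>N\<close> passes a finite set carrying all but 1 of the absolute mass, the
  integers outside \<open>smooth (primes_upto N)\<close> contribute at most 1.\<close>

lemma infsum_smooth_le:
  fixes f :: "nat \<Rightarrow> real"
  assumes "(\<lambda>n. \<bar>f n\<bar>) summable_on {0<..}"
  shows "\<exists>N0. \<forall>N\<ge>N0. infsum f (smooth (primes_upto N)) \<le> \<bar>infsum f {0<..}\<bar> + 1"
proof -
  let ?A = "infsum (\<lambda>n. \<bar>f n\<bar>) {0<..}"
  have "((\<lambda>n. \<bar>f n\<bar>) has_sum ?A) {0<..}" using assms by (rule has_sum_infsum)
  hence "(sum (\<lambda>n. \<bar>f n\<bar>) \<longlongrightarrow> ?A) (finite_subsets_at_top {0<..})" by (simp add: has_sum_def)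
  hence "eventually (\<lambda>F. sum (\<lambda>n. \<bar>f n\<bar>) F > ?A - 1) (finite_subsets_at_top {0<..})"
    by (rule order_tendstoD) simp
  then obtain F where F: "finite F" "F \<subseteq> {0<..}" "sum (\<lambda>n. \<bar>f n\<bar>) F > ?A - 1"
    unfolding eventually_finite_subsets_at_top by blast
  have "infsum f (smooth (primes_upto N)) \<le> \<bar>infsum f {0<..}\<bar> + 1" if N: "N \<ge> Max (insert 1 F)" for N
  proof -
    let ?B = "smooth (primes_upto N)"
    have B: "?B \<subseteq> {0<..}" by (auto simp: smooth_def)
    have "F \<subseteq> {1..N}" using F N by (auto simp: Suc_le_eq)
    hence FB: "F \<subseteq> ?B" using upto_subset_smooth by blast
    have sB: "(\<lambda>n. \<bar>f n\<bar>) summable_on ?B" and sD: "(\<lambda>n. \<bar>f n\<bar>) summable_on ({0<..} - ?B)"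
      using summable_on_subset_banach[OF assms] B by auto
    have sf: "f summable_on {0<..}" "f summable_on ?B" "f summable_on ({0<..} - ?B)"
      using abs_summable_summable[of f] assms sB sD by auto
    have "sum (\<lambda>n. \<bar>f n\<bar>) F \<le> infsum (\<lambda>n. \<bar>f n\<bar>) ?B"
      using F FB sB by (intro finite_sum_le_infsum) auto
    moreover have "infsum (\<lambda>n. \<bar>f n\<bar>) ({0<..} - ?B) = ?A - infsum (\<lambda>n. \<bar>f n\<bar>) ?B"
      by (rule infsum_Diff[OF assms sB B])
    moreover have "infsum f ({0<..} - ?B) = infsum f {0<..} - infsum f ?B"
      by (rule infsum_Diff[OF sf(1,2) B])
    moreover have "\<bar>infsum f ({0<..} - ?B)\<bar> \<le> infsum (\<lambda>n. \<bar>f n\<bar>) ({0<..} - ?B)"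
      using norm_infsum_bound[of f "{0<..} - ?B"] sD by simp
    ultimately show ?thesis using F(3) by linarith
  qed
  thus ?thesis by blast
qed

text \<open>The logarithm of the Euler product. The terms have both signs, so the bound is asserted
  only for cutoffs beyond some \<open>N0\<close>, which may depend on \<open>s\<close>.\<close>

lemma hecke_prime_sum_le:
  assumes "even M" "1 < s" "s \<le> 2"
  shows "\<exists>N0. \<forall>N\<ge>N0. (\<Sum>q\<in>primes_upto N. hecke M q * real q powr (-s))
     \<le> ln (cmod (lattice_sum M s) + 1) + 28 * (\<Sum>n. 1 / real n ^ 2)"
proof -
  let ?f = "\<lambda>n. hecke M n * real n powr (-s)"
  obtain N0 where N0: "\<And>N. N \<ge> N0 \<Longrightarrow> infsum ?f (smooth (primes_upto N)) \<le> \<bar>infsum ?f {0<..}\<bar> + 1"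
    using infsum_smooth_le[OF hecke_dirichlet(1)[OF assms(2), of M]] by blast
  have "(\<Sum>q\<in>primes_upto N. hecke M q * real q powr (-s))
     \<le> ln (cmod (lattice_sum M s) + 1) + 28 * (\<Sum>n. 1 / real n ^ 2)" if N: "N \<ge> N0" for N
  proof -
    have "exp (\<Sum>q\<in>primes_upto N. ?f q - 28 / real q ^ 2) \<le> cmod (lattice_sum M s) + 1"
      using hecke_euler_lower[OF assms, of N] N0[OF N] hecke_dirichlet(2)[OF assms(2), of M] by linarith
    hence "(\<Sum>q\<in>primes_upto N. ?f q - 28 / real q ^ 2) \<le> ln (cmod (lattice_sum M s) + 1)"
      by (subst ln_ge_iff) (auto intro: add_nonneg_pos)
    moreover have "(\<Sum>q\<in>primes_upto N. ?f q - 28 / real q ^ 2)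
        = (\<Sum>q\<in>primes_upto N. ?f q) - 28 * (\<Sum>q\<in>primes_upto N. 1 / real q ^ 2)"
      by (simp add: sum_subtractf sum_distrib_left)
    ultimately show ?thesis using sum_inverse_square_primes_le[of N] by linarith
  qed
  thus ?thesis by blast
qed

text \<open>The power of ln N that bounds the sum of |hecke M n|/n up to N. The 3/4 is the weight of
  \<open>hecke 0\<close> in \<open>hecke_prime_bound\<close>; the other term there has a bounded
  Dirichlet series and adds nothing.\<close>

definition log_exponent :: "nat \<Rightarrow> real" where "log_exponent M = (if M = 0 then 1 else 3/4)"

lemma hecke_abs_prime_sum_le:
  assumes "even M"
  shows "\<exists>C. \<forall>N\<ge>3. (\<Sum>q\<in>primes_upto N. \<bar>hecke M q\<bar> / real q) \<le> log_exponent M * ln (ln (real N)) + C"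
proof -
  obtain C0 where C0: "C0 \<ge> 0" "\<And>s. 1 < s \<Longrightarrow> s \<le> 2 \<Longrightarrow> cmod (lattice_sum 0 s) \<le> C0 / (s - 1)"
    using tsum_0_le by blast
  have "\<exists>C\<ge>0. M > 0 \<longrightarrow> (\<forall>s. 1 < s \<longrightarrow> s \<le> 2 \<longrightarrow> cmod (lattice_sum (2 * M) s) \<le> C)"
  proof (cases "M > 0")
    case True
    \<comment> \<open>The frequency doubled by the inequality for |cos t| is divisible by 4 because
      \<open>M\<close> is even, as \<open>tsum_bounded\<close> demands.\<close>
    have "4 dvd 2 * M" using assms by (auto elim!: evenE)
    thus ?thesis using tsum_bounded[of "2 * M"] True by auto
  qed auto
  then obtain C1 where C1: "C1 \<ge> 0" "\<And>s. M > 0 \<Longrightarrow> 1 < s \<Longrightarrow> s \<le> 2 \<Longrightarrow> cmod (lattice_sum (2 * M) s) \<le> C1"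
    by blast
  define S where "S = 28 * (\<Sum>n. 1 / real n ^ 2)"
  define C where "C = \<bar>ln (C0 + 1)\<bar> + \<bar>S\<bar> + (ln (C1 + 1) + \<bar>S\<bar>) + 4"
  have "(\<Sum>q\<in>primes_upto N. \<bar>hecke M q\<bar> / real q) \<le> log_exponent M * ln (ln (real N)) + C" if N: "N \<ge> 3" for N
  proof -
    have "exp 1 \<le> real N" using exp_le N by (metis of_nat_numeral of_nat_le_iff order_trans)
    hence lnN: "ln (real N) \<ge> 1" using N by (subst ln_ge_iff) auto
    define s where "s = 1 + 1 / ln (real N)"
    have s: "1 < s" "s \<le> 2" using lnN by (auto simp: s_def)
    define A where "A N' = (\<Sum>q\<in>primes_upto N'. hecke 0 q * real q powr (-s))" for N'
    define B where "B N' = (\<Sum>q\<in>primes_upto N'. hecke (2 * M) q * real q powr (-s))" for N'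
    obtain N1 where N1: "\<And>N'. N' \<ge> N1 \<Longrightarrow> A N' \<le> ln (cmod (lattice_sum 0 s) + 1) + S"
      using hecke_prime_sum_le[of 0 s] s unfolding A_def S_def by auto
    obtain N2 where N2: "\<And>N'. N' \<ge> N2 \<Longrightarrow> B N' \<le> ln (cmod (lattice_sum (2 * M) s) + 1) + S"
      using hecke_prime_sum_le[of "2 * M" s] s unfolding B_def S_def by auto
    \<comment> \<open>The signed bounds hold only for large cutoffs depending on \<open>s\<close>,
      hence on \<open>N\<close>. Enlarging the cutoff is harmless for the sum of absolute
      values.\<close>
    define N' where "N' = max N (max N1 N2)"
    have N': "N' \<ge> N1" "N' \<ge> N2" "N' \<ge> N" by (simp_all add: N'_def)
    have "ln (cmod (lattice_sum 0 s) + 1) \<le> ln ((C0 + 1) * ln (real N))"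
    proof (subst ln_le_cancel_iff)
      show "cmod (lattice_sum 0 s) + 1 \<le> (C0 + 1) * ln (real N)"
        using C0(2)[OF s] lnN C0(1) by (simp add: s_def algebra_simps)
    qed (use C0 lnN in \<open>auto intro: add_nonneg_pos\<close>)
    also have "\<dots> = ln (C0 + 1) + ln (ln (real N))" using C0 lnN by (subst ln_mult) auto
    finally have A: "A N' \<le> ln (ln (real N)) + (ln (C0 + 1) + S)"
      using N1[OF N'(1)] by linarith
    have mono: "(\<Sum>q\<in>primes_upto N. \<bar>hecke M q\<bar> * real q powr (-s))
        \<le> (\<Sum>q\<in>primes_upto N'. \<bar>hecke M q\<bar> * real q powr (-s))"
      by (rule sum_mono2) (use N'(3) in \<open>auto simp: primes_upto_def\<close>)
    have main: "(\<Sum>q\<in>primes_upto N'. \<bar>hecke M q\<bar> * real q powr (-s)) \<le> log_exponent M * ln (ln (real N)) + (C - 4)"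
    proof (cases "M = 0")
      case True
      have "(\<Sum>q\<in>primes_upto N'. \<bar>hecke M q\<bar> * real q powr (-s)) = A N'"
        by (simp add: A_def True hecke_0)
      also have "\<dots> \<le> ln (ln (real N)) + (C - 4)"
        using A C1(1) ln_ge_zero[of "C1 + 1"] abs_ge_self[of "ln (C0 + 1)"] abs_ge_self[of S] abs_ge_zero[of S]
        unfolding C_def by linarith
      finally show ?thesis by (simp add: log_exponent_def True)
    next
      case False
      have "(\<Sum>q\<in>primes_upto N'. \<bar>hecke M q\<bar> * real q powr (-s))
          \<le> (\<Sum>q\<in>primes_upto N'. (3/4 * hecke 0 q + 1/4 * hecke (2 * M) q) * real q powr (-s))"
        using hecke_prime_bound assms by (intro sum_mono mult_right_mono) (auto simp: primes_upto_def)
      also have "\<dots> = 3/4 * A N' + 1/4 * B N'"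
        by (simp add: A_def B_def sum_distrib_left sum.distrib algebra_simps)
      also have "B N' \<le> ln (C1 + 1) + S"
      proof -
        have "ln (cmod (lattice_sum (2 * M) s) + 1) \<le> ln (C1 + 1)"
          using C1 False s by (subst ln_le_cancel_iff) (auto intro: add_nonneg_pos)
        thus ?thesis using N2[OF N'(2)] by linarith
      qed
      also have "3/4 * A N' + 1/4 * (ln (C1 + 1) + S) \<le> 3/4 * ln (ln (real N)) + (C - 4)"
        using A C1(1) ln_ge_zero[of "C1 + 1"] abs_ge_self[of "ln (C0 + 1)"] abs_ge_self[of S] abs_ge_zero[of S]
          abs_ge_zero[of "ln (C0 + 1)"]
        unfolding C_def by argo
      finally show ?thesis using False by (simp add: log_exponent_def)
    qed
    \<comment> \<open>Replacing q^(-s) by 1/q costs at most (s - 1) ln q / q times |hecke M q| \<le>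
      2, a total of 4 with s - 1 = 1/ln N.\<close>
    have "(\<Sum>q\<in>primes_upto N. \<bar>hecke M q\<bar> / real q)
        \<le> (\<Sum>q\<in>primes_upto N. \<bar>hecke M q\<bar> * real q powr (-s) + 2 / ln (real N) * (ln (real q) / real q))"
    proof (rule sum_mono)
      fix q assume "q \<in> primes_upto N"
      hence q: "prime q" by (simp add: primes_upto_def)
      have q0: "real q \<ge> 1" using prime_ge_1_nat[OF q] by simp
      have "real q powr (-s) = 1 / real q * exp (- (ln (real q) / ln (real N)))"
        using q0 by (simp add: s_def powr_def exp_diff exp_minus algebra_simps inverse_eq_divide flip: exp_add)
      also have "\<dots> \<ge> 1 / real q * (1 - ln (real q) / ln (real N))"
        using exp_ge_add_one_self[of "- (ln (real q) / ln (real N))"] by (intro mult_left_mono) auto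
      finally have "1 / real q - real q powr (-s) \<le> 1 / real q * (ln (real q) / ln (real N))"
        by (simp add: algebra_simps)
      hence "\<bar>hecke M q\<bar> * (1 / real q - real q powr (-s)) \<le> \<bar>hecke M q\<bar> * (1 / real q * (ln (real q) / ln (real N)))"
        by (intro mult_left_mono) auto
      also have "\<dots> \<le> 2 * (1 / real q * (ln (real q) / ln (real N)))"
        using hecke_prime_power_le[OF q, of M 1] q0 lnN by (intro mult_right_mono) auto
      finally show "\<bar>hecke M q\<bar> / real q \<le> \<bar>hecke M q\<bar> * real q powr (-s) + 2 / ln (real N) * (ln (real q) / real q)"
        by (simp add: algebra_simps)
    qed
    also have "\<dots> = (\<Sum>q\<in>primes_upto N. \<bar>hecke M q\<bar> * real q powr (-s))
        + 2 / ln (real N) * (\<Sum>q\<in>primes_upto N. ln (real q) / real q)"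
      by (simp add: sum.distrib sum_distrib_left)
    also have "2 / ln (real N) * (\<Sum>q\<in>primes_upto N. ln (real q) / real q) \<le> 2 / ln (real N) * (2 * ln (real N))"
      using lnN N by (intro mult_left_mono sum_ln_div_primes_le) auto
    also have "2 / ln (real N) * (2 * ln (real N)) = 4" using lnN by simp
    finally show ?thesis using main mono by linarith
  qed
  thus ?thesis by blast
qed

section \<open>Weighted mean values and the fourth moment\<close>

text \<open>Compensates for the primes dividing a smooth part, which cannot be sieved by: (1 -
  3/q)(1 + 8/q) \<ge> 1 for q \<ge> 5. At q = 5 the smallest admissible constant is 7.5.\<close>

definition sieve_weight :: "nat \<Rightarrow> real" where
  "sieve_weight n = (\<Prod>q\<in>prime_factors n. 1 + 8 / real q)"

lemma hfac_pos: "sieve_weight n > 0" unfolding sieve_weight_def by (rule prod_pos) (auto intro: add_pos_nonneg)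

lemma hfac_prime_power: "prime q \<Longrightarrow> k > 0 \<Longrightarrow> sieve_weight (q ^ k) = 1 + 8 / real q"
  by (simp add: sieve_weight_def prime_factorization_prime_power)

lemma mult_fun_hfac: "mult_fun sieve_weight"
  unfolding mult_fun_def
proof (intro conjI allI impI)
  show "sieve_weight 1 = 1" by (simp add: sieve_weight_def)
  fix a b :: nat assume ab: "a > 0" "b > 0" "coprime a b"
  have "prime_factors (a * b) = prime_factors a \<union> prime_factors b"
    using ab by (simp add: prime_factorization_mult)
  moreover have "\<not> (x dvd a \<and> x dvd b)" if "prime x" for x
    using that ab(3) by (metis coprime_common_divisor_nat not_prime_1)
  hence "prime_factors a \<inter> prime_factors b = {}" using ab by (auto simp: prime_factors_dvd)
  ultimately show "sieve_weight (a * b) = sieve_weight a * sieve_weight b"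
    unfolding sieve_weight_def by (simp add: prod.union_disjoint)
qed

text \<open>At primes the weight changes f(q)/q only by at most 16/q^2, a convergent sum, so the
  power of ln N is that of the unweighted sum. The 5 is 1 + 8/2.\<close>

lemma hecke_hfac_sum_le:
  assumes "even M"
  shows "\<exists>C>0. \<forall>N\<ge>3. (\<Sum>n=1..N. \<bar>hecke M n\<bar> * sieve_weight n / real n) \<le> C * ln (real N) powr log_exponent M"
proof -
  obtain C where C: "\<And>N. N \<ge> 3 \<Longrightarrow> (\<Sum>q\<in>primes_upto N. \<bar>hecke M q\<bar> / real q) \<le> log_exponent M * ln (ln (real N)) + C"
    using hecke_abs_prime_sum_le[OF assms] by blast
  obtain D where D: "D > 0" "\<And>f N. mult_fun f \<Longrightarrow> (\<And>n. 0 \<le> f n) \<Longrightarrow>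
     (\<And>q k. prime q \<Longrightarrow> f (q ^ k) \<le> 5 * (real k + 1) ^ 4) \<Longrightarrow>
     (\<Sum>n=1..N. f n / real n) \<le> D * exp (\<Sum>q\<in>primes_upto N. f q / real q)"
    using euler_upper_bound[of 5] by auto
  define S where "S = (\<Sum>n. 1 / real n ^ 2)"
  define f where "f n = \<bar>hecke M n\<bar> * sieve_weight n" for n
  have f: "mult_fun f" unfolding f_def by (intro mult_fun_times mult_fun_abs mult_fun_hecke assms mult_fun_hfac)
  have f0: "0 \<le> f n" for n using hfac_pos[of n] by (simp add: f_def)
  have fq: "f (q ^ k) \<le> 5 * (real k + 1) ^ 4" if q: "prime q" for q k
  proof -
    have "sieve_weight (q ^ k) \<le> 5"
    proof (cases "k = 0")
      case False
      have "8 / real q \<le> 8 / 2" using prime_ge_2_nat[OF q] by (intro divide_left_mono) auto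
      thus ?thesis using False hfac_prime_power[OF q, of k] by simp
    qed (simp add: sieve_weight_def)
    hence "f (q ^ k) \<le> (real k + 1) * 5"
      unfolding f_def using hecke_prime_power_le[OF q, of M k] hfac_pos[of "q ^ k"] by (intro mult_mono) auto
    also have "real k + 1 \<le> (real k + 1) ^ 4" using self_le_power[of "real k + 1" 4] by simp
    finally show ?thesis by simp
  qed
  have "(\<Sum>n=1..N. \<bar>hecke M n\<bar> * sieve_weight n / real n) \<le> (D * exp (C + 16 * S)) * ln (real N) powr log_exponent M" if N: "N \<ge> 3" for N
  proof -
    have "exp 1 \<le> real N" using exp_le N by (metis of_nat_numeral of_nat_le_iff order_trans)
    hence lnN: "ln (real N) \<ge> 1" using N by (subst ln_ge_iff) auto
    have "(\<Sum>q\<in>primes_upto N. f q / real q) \<le> (\<Sum>q\<in>primes_upto N. \<bar>hecke M q\<bar> / real q + 16 * (1 / real q ^ 2))"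
    proof (rule sum_mono)
      fix q assume "q \<in> primes_upto N"
      hence q: "prime q" by (simp add: primes_upto_def)
      have "\<bar>hecke M q\<bar> * (8 / real q ^ 2) \<le> 2 * (8 / real q ^ 2)"
        using hecke_prime_power_le[OF q, of M 1] by (intro mult_right_mono) auto
      thus "f q / real q \<le> \<bar>hecke M q\<bar> / real q + 16 * (1 / real q ^ 2)"
        using hfac_prime_power[OF q, of 1] by (simp add: f_def algebra_simps add_divide_distrib power2_eq_square)
    qed
    also have "\<dots> = (\<Sum>q\<in>primes_upto N. \<bar>hecke M q\<bar> / real q) + 16 * (\<Sum>q\<in>primes_upto N. 1 / real q ^ 2)"
      by (simp add: sum.distrib sum_distrib_left)
    also have "\<dots> \<le> log_exponent M * ln (ln (real N)) + (C + 16 * S)"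
      using C[OF N] sum_inverse_square_primes_le[of N] by (simp add: S_def)
    finally have "exp (\<Sum>q\<in>primes_upto N. f q / real q) \<le> exp (log_exponent M * ln (ln (real N)) + (C + 16 * S))" by simp
    also have "\<dots> = exp (C + 16 * S) * ln (real N) powr log_exponent M" using lnN by (simp add: exp_add powr_def)
    finally have "D * exp (\<Sum>q\<in>primes_upto N. f q / real q) \<le> D * (exp (C + 16 * S) * ln (real N) powr log_exponent M)"
      using D(1) by (intro mult_left_mono) auto
    thus ?thesis using D(2)[OF f f0 fq, of N] by (simp add: f_def mult_ac)
  qed
  thus ?thesis using D(1) by (intro exI[of _ "D * exp (C + 16 * S)"]) auto
qed

text \<open>Uses only |hecke M q|^4 \<le> 16 together with the factor e of
  \<open>sum_inverse_primes_le\<close>. A crude power of ln N is acceptable since the bound is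
  applied only on the exceptional primes.\<close>

lemma hecke_fourth_moment_le:
  assumes "even M"
  shows "\<exists>C>0. \<forall>N\<ge>3. (\<Sum>n=1..N. hecke M n ^ 4) \<le> C * real N * (1 + ln (real N)) powr (16 * exp 1)"
proof -
  obtain D where D: "D > 0" "\<And>f N. mult_fun f \<Longrightarrow> (\<And>n. 0 \<le> f n) \<Longrightarrow>
     (\<And>q k. prime q \<Longrightarrow> f (q ^ k) \<le> 1 * (real k + 1) ^ 4) \<Longrightarrow>
     (\<Sum>n=1..N. f n / real n) \<le> D * exp (\<Sum>q\<in>primes_upto N. f q / real q)"
    using euler_upper_bound[of 1] by auto
  define f where "f n = hecke M n ^ 4" for n
  have f: "mult_fun f" unfolding f_def by (intro mult_fun_power mult_fun_hecke assms)
  have f0: "0 \<le> f n" for n by (simp add: f_def)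
  have fq: "f (q ^ k) \<le> 1 * (real k + 1) ^ 4" if q: "prime q" for q k
  proof -
    have "\<bar>hecke M (q ^ k)\<bar> ^ 4 \<le> (real k + 1) ^ 4"
      using hecke_prime_power_le[OF q, of M k] by (intro power_mono) auto
    thus ?thesis by (simp add: f_def)
  qed
  have "(\<Sum>n=1..N. hecke M n ^ 4) \<le> D * real N * (1 + ln (real N)) powr (16 * exp 1)" if N: "N \<ge> 3" for N
  proof -
    have "(\<Sum>q\<in>primes_upto N. f q / real q) \<le> (\<Sum>q\<in>primes_upto N. 16 * (1 / real q))"
    proof (rule sum_mono)
      fix q assume "q \<in> primes_upto N"
      hence q: "prime q" by (simp add: primes_upto_def)
      show "f q / real q \<le> 16 * (1 / real q)"
        using fq[OF q, of 1] by (simp add: divide_right_mono)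
    qed
    also have "\<dots> = 16 * (\<Sum>q\<in>primes_upto N. 1 / real q)" by (simp add: sum_distrib_left)
    also have "\<dots> \<le> 16 * (exp 1 * ln (1 + ln (real N)))"
      using sum_inverse_primes_le[of N] N by simp
    finally have "exp (\<Sum>q\<in>primes_upto N. f q / real q) \<le> exp (16 * (exp 1 * ln (1 + ln (real N))))" by simp
    also have "\<dots> = (1 + ln (real N)) powr (16 * exp 1)"
    proof -
      have "ln (real N) \<ge> 0" using N by simp
      hence "1 + ln (real N) \<noteq> 0" by linarith
      thus ?thesis by (simp add: powr_def mult.assoc)
    qed
    finally have e: "exp (\<Sum>q\<in>primes_upto N. f q / real q) \<le> (1 + ln (real N)) powr (16 * exp 1)" .
    have "(\<Sum>n=1..N. f n) \<le> (\<Sum>n=1..N. real N * (f n / real n))"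
    proof (rule sum_mono)
      fix n assume n: "n \<in> {1..N}"
      hence "f n * 1 \<le> f n * (real N / real n)" by (intro mult_left_mono f0) auto
      thus "f n \<le> real N * (f n / real n)" by (simp add: mult.commute)
    qed
    also have "\<dots> = real N * (\<Sum>n=1..N. f n / real n)" by (simp add: sum_distrib_left)
    also have "\<dots> \<le> real N * (D * (1 + ln (real N)) powr (16 * exp 1))"
      using D(2)[OF f f0 fq, of N] e D(1) by (intro mult_left_mono) (auto intro: order_trans mult_left_mono)
    finally show ?thesis by (simp add: f_def mult_ac)
  qed
  thus ?thesis using D(1) by blast
qed

section \<open>Brun's sieve\<close>

text \<open>For nonempty \<open>B\<close> with n elements the truncated alternating sum of binomials
  equals the binomial coefficient of n - 1 over 2r, up to the sign (-1)^(2r) = 1. Truncation at an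
  even level thus errs upwards.\<close>

lemma bonferroni:
  assumes "finite B"
  shows "(if B = {} then 1 else 0) \<le> (\<Sum>D\<in>{D\<in>Pow B. card D \<le> 2 * r}. (-1) ^ card D :: real)"
proof (cases "B = {}")
  case True
  hence "{D\<in>Pow B. card D \<le> 2 * r} = {{}}" by auto
  thus ?thesis using True by simp
next
  case False
  define n where "n = card B"
  have n: "n \<ge> 1" using False assms by (simp add: n_def Suc_le_eq card_gt_0_iff)
  have "(\<Sum>D\<in>{D\<in>Pow B. card D \<le> 2 * r}. (-1) ^ card D :: real)
      = (\<Sum>k\<in>{..2*r}. \<Sum>D\<in>{D\<in>{D\<in>Pow B. card D \<le> 2 * r}. card D = k}. (-1) ^ card D)"
    using assms by (intro sum.group[symmetric]) auto
  also have "\<dots> = (\<Sum>k\<in>{..2*r}. (real n gchoose k) * (-1) ^ k)"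
  proof (rule sum.cong[OF refl])
    fix k assume k: "k \<in> {..2*r}"
    have "{D\<in>{D\<in>Pow B. card D \<le> 2 * r}. card D = k} = {D. D \<subseteq> B \<and> card D = k}" using k by auto
    thus "(\<Sum>D\<in>{D\<in>{D\<in>Pow B. card D \<le> 2 * r}. card D = k}. (-1) ^ card D) = (real n gchoose k) * (-1) ^ k"
      using n_subsets[OF assms, of k] by (simp add: n_def binomial_gbinomial)
  qed
  also have "\<dots> = (-1) ^ (2 * r) * (real n - 1 gchoose (2 * r))" by (rule gbinomial_sum_lower_neg)
  also have "real n - 1 = real (n - 1)" using n by simp
  also have "(-1) ^ (2 * r) * (real (n - 1) gchoose (2 * r)) = real (n - 1 choose (2 * r))"
    by (simp add: binomial_gbinomial)
  finally show ?thesis using False by simp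
qed

section \<open>Counting in residue classes and the truncated sieve\<close>

lemma card_cong_class:
  fixes X M c :: int
  assumes "X \<ge> 0" "M > 0"
  shows "\<bar>real (card {n\<in>{1..X}. [n = c] (mod M)}) - of_int X / of_int M\<bar> \<le> 1"
proof -
  \<comment> \<open>The representative lies in 1, ..., M since the interval starts at 1; the class
    is then the progression \<open>c0 + M * k\<close> with 0 \<le> k < K.\<close>
  define c0 where "c0 = (c - 1) mod M + 1"
  have c0: "1 \<le> c0" "c0 \<le> M"
    using pos_mod_bound[OF assms(2), of "c - 1"] pos_mod_sign[OF assms(2), of "c - 1"] unfolding c0_def by linarith+
  have "[c0 = c] (mod M)" unfolding c0_def using cong_add[of "(c - 1) mod M" "c - 1" M 1 1] by simp
  hence cc: "[n = c] (mod M) \<longleftrightarrow> [n = c0] (mod M)" for n by (metis cong_sym cong_trans)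
  define K where "K = (X - c0) div M + 1"
  have K1: "M * (K - 1) \<le> X - c0" "X - c0 < M * K"
  proof -
    have e: "M * ((X - c0) div M) + (X - c0) mod M = X - c0" by simp
    have k: "M * (K - 1) = M * ((X - c0) div M)" "M * K = M * ((X - c0) div M) + M"
      by (simp_all add: K_def algebra_simps)
    show "M * (K - 1) \<le> X - c0" "X - c0 < M * K"
      using e pos_mod_bound[OF assms(2), of "X - c0"] pos_mod_sign[OF assms(2), of "X - c0"]
      unfolding k by linarith+
  qed
  have eq: "{n\<in>{1..X}. [n = c] (mod M)} = (\<lambda>k. c0 + M * k) ` {0..<K}"
  proof (rule Set.set_eqI, rule iffI)
    fix n assume n: "n \<in> {n\<in>{1..X}. [n = c] (mod M)}"
    hence "M dvd n - c0" using cc by (simp add: cong_iff_dvd_diff)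
    then obtain k where k: "n - c0 = M * k" by (elim dvdE)
    have "k \<ge> 0"
    proof (rule ccontr)
      assume "\<not> k \<ge> 0"
      hence "M * k \<le> M * (-1)" using assms by (intro mult_left_mono) auto
      thus False using k n c0 by auto
    qed
    moreover have "M * k < M * K" using k n K1 by auto
    hence "k < K" using assms by simp
    ultimately show "n \<in> (\<lambda>k. c0 + M * k) ` {0..<K}" using k by (intro image_eqI[of _ _ k]) auto
  next
    fix n assume "n \<in> (\<lambda>k. c0 + M * k) ` {0..<K}"
    then obtain k where "k \<in> {0..<K}" and k1: "n = c0 + M * k" by blast
    hence k: "n = c0 + M * k" "0 \<le> k" "k < K" by simp_all
    have "M * k \<le> M * (K - 1)" using k assms by (intro mult_left_mono) auto
    moreover have "M * k \<ge> 0" using k assms by simp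
    ultimately have "1 \<le> n" "n \<le> X" using k(1) K1(1) c0(1) by linarith+
    moreover have "[n = c] (mod M)" unfolding cc k(1) by (simp add: cong_iff_dvd_diff)
    ultimately show "n \<in> {n\<in>{1..X}. [n = c] (mod M)}" by simp
  qed
  have "card {n\<in>{1..X}. [n = c] (mod M)} = card {0..<K}"
    unfolding eq using assms by (intro card_image) (auto simp: inj_on_def)
  hence card: "card {n\<in>{1..X}. [n = c] (mod M)} = nat K" by simp
  have "M * K > - M" using K1 assms c0 by linarith
  hence "M * K > M * (-1)" by simp
  hence "K \<ge> 0" using assms by (simp only: mult_less_cancel_left_pos)
  hence rK: "real (card {n\<in>{1..X}. [n = c] (mod M)}) = of_int K" using card by simp
  have "X - M \<le> M * K" "M * K \<le> X + M" using K1 c0 by (auto simp: algebra_simps)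
  hence "real_of_int (X - M) \<le> of_int (M * K)" "real_of_int (M * K) \<le> of_int (X + M)" by (simp_all only: of_int_le_iff)
  hence "of_int X / of_int M - 1 \<le> real_of_int K" "real_of_int K \<le> of_int X / of_int M + 1"
    using assms(2) by (auto simp: field_simps)
  thus ?thesis unfolding rK by linarith
qed

text \<open>Induction by the Chinese remainder theorem: each residue allowed modulo \<open>q\<close>
  is merged with \<open>c\<close> into one class modulo \<open>M * q\<close>. The rounding errors
  add up to the number of classes.\<close>

lemma card_residue_classes:
  fixes X M c :: int and R :: "nat \<Rightarrow> int set"
  assumes "finite D" "X \<ge> 0" "M > 0" "\<And>q. q \<in> D \<Longrightarrow> prime q \<and> coprime (int q) M \<and> R q \<subseteq> {0..<int q}"
  shows "\<bar>real (card {n\<in>{1..X}. [n = c] (mod M) \<and> (\<forall>q\<in>D. n mod int q \<in> R q)})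
      - of_int X / of_int M * (\<Prod>q\<in>D. real (card (R q)) / real q)\<bar> \<le> (\<Prod>q\<in>D. real (card (R q)))"
  using assms(1,3,4)
proof (induction D arbitrary: M c rule: finite_induct)
  case empty
  thus ?case using card_cong_class[OF assms(2) empty(1), of c] by simp
next
  case (insert q D)
  have q: "prime q" "coprime (int q) M" "R q \<subseteq> {0..<int q}" using insert.prems by auto
  have q0: "int q > 0" using prime_gt_0_nat[OF q(1)] by simp
  have fin: "finite (R q)" using q(3) finite_subset by blast
  have "\<exists>c'. [c' = c] (mod M) \<and> [c' = w] (mod int q)" for w
    using binary_chinese_remainder_int[of M "int q" c w] q(2) by (simp add: coprime_commute)
  then obtain c' where c': "\<And>w. [c' w = c] (mod M)" "\<And>w. [c' w = w] (mod int q)" by metis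
  let ?C = "\<lambda>w. {n\<in>{1..X}. [n = c' w] (mod (M * int q)) \<and> (\<forall>q\<in>D. n mod int q \<in> R q)}"
  let ?g = "\<Prod>q\<in>D. real (card (R q)) / real q"
  have iff: "[n = c' w] (mod (M * int q)) \<longleftrightarrow> [n = c] (mod M) \<and> [n = w] (mod int q)" for n w
  proof -
    have "[n = c' w] (mod (M * int q)) \<longleftrightarrow> [n = c' w] (mod M) \<and> [n = c' w] (mod int q)"
      using q(2) by (auto simp: cong_iff_dvd_diff coprime_commute intro: divides_mult dvd_mult_left dvd_mult_right)
    thus ?thesis using c'[of w] by (metis cong_sym cong_trans)
  qed
  have set_eq: "{n\<in>{1..X}. [n = c] (mod M) \<and> (\<forall>q\<in>insert q D. n mod int q \<in> R q)} = (\<Union>w\<in>R q. ?C w)"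
  proof (rule Set.set_eqI, rule iffI)
    fix n assume n: "n \<in> {n\<in>{1..X}. [n = c] (mod M) \<and> (\<forall>q\<in>insert q D. n mod int q \<in> R q)}"
    hence "n \<in> ?C (n mod int q)" unfolding mem_Collect_eq iff by (simp add: cong_def)
    thus "n \<in> (\<Union>w\<in>R q. ?C w)" using n by blast
  next
    fix n assume "n \<in> (\<Union>w\<in>R q. ?C w)"
    then obtain w where w: "w \<in> R q" "n \<in> ?C w" by blast
    have "[n = w] (mod int q)" using w(2) iff by blast
    hence "n mod int q = w" using w(1) q(3) by (auto simp: cong_def)
    thus "n \<in> {n\<in>{1..X}. [n = c] (mod M) \<and> (\<forall>q\<in>insert q D. n mod int q \<in> R q)}"
      using w iff by auto
  qed
  have disj: "?C w \<inter> ?C w' = {}" if "w \<in> R q" "w' \<in> R q" "w \<noteq> w'" for w w'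
  proof (rule ccontr)
    assume "?C w \<inter> ?C w' \<noteq> {}"
    then obtain n where "[n = w] (mod int q)" "[n = w'] (mod int q)" using iff by blast
    hence "w mod int q = w' mod int q" by (simp add: cong_def)
    moreover have "w \<in> {0..<int q}" "w' \<in> {0..<int q}" using that q(3) by blast+
    ultimately show False using that(3) by simp
  qed
  have finC: "finite (?C w)" for w by (rule finite_subset[of _ "{1..X}"]) auto
  have "card {n\<in>{1..X}. [n = c] (mod M) \<and> (\<forall>q\<in>insert q D. n mod int q \<in> R q)} = (\<Sum>w\<in>R q. card (?C w))"
    unfolding set_eq by (rule card_UN_disjoint[OF fin]) (use disj finC in blast)+
  hence card: "real (card {n\<in>{1..X}. [n = c] (mod M) \<and> (\<forall>q\<in>insert q D. n mod int q \<in> R q)})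
      = (\<Sum>w\<in>R q. real (card (?C w)))" by simp
  have IH: "\<bar>real (card (?C w)) - of_int X / of_int (M * int q) * ?g\<bar> \<le> (\<Prod>q\<in>D. real (card (R q)))" for w
  proof (rule insert.IH)
    show "M * int q > 0" using insert.prems(1) q0 by simp
    fix p assume p: "p \<in> D"
    hence "prime p" "p \<noteq> q" using insert by auto
    hence "coprime (int p) (int q)" using q(1) by (simp add: primes_coprime)
    thus "prime p \<and> coprime (int p) (M * int q) \<and> R p \<subseteq> {0..<int p}"
      using insert.prems(2)[of p] p by simp
  qed
  have "of_int X / of_int M * (\<Prod>q\<in>insert q D. real (card (R q)) / real q)
      = (\<Sum>w\<in>R q. of_int X / of_int (M * int q) * ?g)"
    using insert.hyps by simp
  hence "\<bar>real (card {n\<in>{1..X}. [n = c] (mod M) \<and> (\<forall>q\<in>insert q D. n mod int q \<in> R q)})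
      - of_int X / of_int M * (\<Prod>q\<in>insert q D. real (card (R q)) / real q)\<bar>
      = \<bar>\<Sum>w\<in>R q. real (card (?C w)) - of_int X / of_int (M * int q) * ?g\<bar>"
    unfolding card sum_subtractf by simp
  also have "\<dots> \<le> (\<Sum>w\<in>R q. \<Prod>q\<in>D. real (card (R q)))"
    by (rule order_trans[OF sum_abs sum_mono[OF IH]])
  also have "\<dots> = (\<Prod>q\<in>insert q D. real (card (R q)))" using insert.hyps by simp
  finally show ?case .
qed

lemma sum_Pow_prod:
  fixes f :: "'a \<Rightarrow> real" assumes "finite P"
  shows "(\<Sum>D\<in>Pow P. \<Prod>q\<in>D. f q) = (\<Prod>q\<in>P. 1 + f q)"
  using prod_add[OF assms, of f "\<lambda>_. 1"] by (simp add: add.commute)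

text \<open>Inclusion-exclusion over subsets with at most 2r primes. The three terms on the right
  are the full product, the sets left out of it, and the accumulated rounding errors;
  \<open>B\<close> is a free parameter in the last.\<close>

lemma brun_sieve:
  fixes X M c :: int and R :: "nat \<Rightarrow> int set" and B :: real
  assumes "finite P" "X \<ge> 0" "M > 0" "B \<ge> 1"
    and P: "\<And>q. q \<in> P \<Longrightarrow> prime q \<and> coprime (int q) M \<and> R q \<subseteq> {0..<int q} \<and> card (R q) = 3"
  shows "real (card {n\<in>{1..X}. [n = c] (mod M) \<and> (\<forall>q\<in>P. n mod int q \<notin> R q)})
    \<le> of_int X / of_int M * ((\<Prod>q\<in>P. 1 - 3 / real q) + exp (- real (2 * r)) * (\<Prod>q\<in>P. 1 + 3 * exp 1 / real q))
      + B ^ (2 * r) * (1 + 3 / B) ^ card P"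
proof -
  define A where "A = {n\<in>{1..X}. [n = c] (mod M)}"
  have finA: "finite A" by (rule finite_subset[of _ "{1..X}"]) (auto simp: A_def)
  define S where "S = {D\<in>Pow P. card D \<le> 2 * r}"
  have finS: "finite S" using assms(1) by (simp add: S_def)
  define W where "W D = {n\<in>A. \<forall>q\<in>D. n mod int q \<in> R q}" for D
  define g where "g D = (\<Prod>q\<in>D. 3 / real q)" for D
  have finD: "finite D" if "D \<in> Pow P" for D using that assms(1) finite_subset by auto
  have W: "\<bar>real (card (W D)) - of_int X / of_int M * g D\<bar> \<le> 3 ^ card D" if D: "D \<in> Pow P" for D
  proof -
    have "\<bar>real (card {n\<in>{1..X}. [n = c] (mod M) \<and> (\<forall>q\<in>D. n mod int q \<in> R q)})
      - of_int X / of_int M * (\<Prod>q\<in>D. real (card (R q)) / real q)\<bar> \<le> (\<Prod>q\<in>D. real (card (R q)))"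
      by (rule card_residue_classes[OF finD[OF D] assms(2,3)]) (use P D in auto)
    moreover have "(\<Prod>q\<in>D. real (card (R q)) / real q) = g D" "(\<Prod>q\<in>D. real (card (R q))) = 3 ^ card D"
      unfolding g_def using P D by (auto intro!: prod.cong simp: prod_constant[symmetric] simp del: prod_constant)
    moreover have "W D = {n\<in>{1..X}. [n = c] (mod M) \<and> (\<forall>q\<in>D. n mod int q \<in> R q)}"
      by (auto simp: W_def A_def)
    ultimately show ?thesis by simp
  qed
  have "real (card {n\<in>{1..X}. [n = c] (mod M) \<and> (\<forall>q\<in>P. n mod int q \<notin> R q)})
      = (\<Sum>n\<in>A. if {q\<in>P. n mod int q \<in> R q} = {} then 1 else 0)"
  proof -
    have "{n\<in>{1..X}. [n = c] (mod M) \<and> (\<forall>q\<in>P. n mod int q \<notin> R q)} = {n\<in>A. {q\<in>P. n mod int q \<in> R q} = {}}"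
      by (auto simp: A_def)
    thus ?thesis using finA by (simp add: sum.If_cases Int_def)
  qed
  also have "\<dots> \<le> (\<Sum>n\<in>A. \<Sum>D\<in>{D\<in>Pow {q\<in>P. n mod int q \<in> R q}. card D \<le> 2 * r}. (-1) ^ card D)"
    using assms(1) by (intro sum_mono bonferroni) auto
  also have "\<dots> = (\<Sum>n\<in>A. \<Sum>D\<in>S. if n \<in> W D then (-1) ^ card D else 0)"
  proof (rule sum.cong[OF refl])
    fix n assume n: "n \<in> A"
    have "{D\<in>Pow {q\<in>P. n mod int q \<in> R q}. card D \<le> 2 * r} = {D\<in>S. n \<in> W D}"
      using n by (auto simp: S_def W_def)
    thus "(\<Sum>D\<in>{D\<in>Pow {q\<in>P. n mod int q \<in> R q}. card D \<le> 2 * r}. (-1) ^ card D)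
        = (\<Sum>D\<in>S. if n \<in> W D then (-1) ^ card D else (0::real))"
      using finS by (simp add: sum.inter_filter)
  qed
  also have "\<dots> = (\<Sum>D\<in>S. \<Sum>n\<in>A. if n \<in> W D then (-1) ^ card D else 0)" by (rule sum.swap)
  also have "\<dots> = (\<Sum>D\<in>S. (-1) ^ card D * real (card (W D)))"
  proof (rule sum.cong[OF refl])
    fix D
    have "{n\<in>A. n \<in> W D} = W D" by (auto simp: W_def)
    hence "(\<Sum>n\<in>A. if n \<in> W D then (-1) ^ card D else 0) = (\<Sum>n\<in>W D. (-1) ^ card D :: real)"
      using sum.inter_filter[OF finA, of "\<lambda>_. (-1) ^ card D :: real" "\<lambda>n. n \<in> W D"] by simp
    thus "(\<Sum>n\<in>A. if n \<in> W D then (-1) ^ card D else 0) = (-1) ^ card D * real (card (W D))" by simp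
  qed
  also have "\<dots> \<le> (\<Sum>D\<in>S. of_int X / of_int M * ((-1) ^ card D * g D) + 3 ^ card D)"
  proof (rule sum_mono)
    fix D assume "D \<in> S"
    hence D: "D \<in> Pow P" by (simp add: S_def)
    have "(-1) ^ card D * (real (card (W D)) - of_int X / of_int M * g D) \<le> 3 ^ card D"
      using W[OF D] abs_ge_self[of "(-1) ^ card D * (real (card (W D)) - of_int X / of_int M * g D)"]
      by (simp add: abs_mult)
    thus "(-1) ^ card D * real (card (W D)) \<le> of_int X / of_int M * ((-1) ^ card D * g D) + 3 ^ card D"
      by (simp add: algebra_simps)
  qed
  also have "\<dots> = of_int X / of_int M * (\<Sum>D\<in>S. (-1) ^ card D * g D) + (\<Sum>D\<in>S. 3 ^ card D)"
    by (simp add: sum.distrib sum_distrib_left)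
  finally have F1: "real (card {n\<in>{1..X}. [n = c] (mod M) \<and> (\<forall>q\<in>P. n mod int q \<notin> R q)})
    \<le> of_int X / of_int M * (\<Sum>D\<in>S. (-1) ^ card D * g D) + (\<Sum>D\<in>S. 3 ^ card D)" .
  have F2: "(\<Sum>D\<in>S. (-1) ^ card D * g D) \<le> (\<Prod>q\<in>P. 1 - 3 / real q)
      + exp (- real (2 * r)) * (\<Prod>q\<in>P. 1 + 3 * exp 1 / real q)"
  proof -
    have g0: "g D \<ge> 0" for D by (auto simp: g_def intro!: prod_nonneg)
    have "(\<Sum>D\<in>Pow P. (-1) ^ card D * g D) = (\<Sum>D\<in>S. (-1) ^ card D * g D) + (\<Sum>D\<in>Pow P - S. (-1) ^ card D * g D)"
      using assms(1) by (subst sum.subset_diff[of S]) (auto simp: S_def)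
    moreover have "(\<Sum>D\<in>Pow P. (-1) ^ card D * g D) = (\<Prod>q\<in>P. 1 - 3 / real q)"
    proof -
      have "(-1) ^ card D * g D = (\<Prod>q\<in>D. - (3 / real q))" for D
        unfolding g_def prod_constant[symmetric] prod.distrib[symmetric] by simp
      thus ?thesis using sum_Pow_prod[OF assms(1), of "\<lambda>q. - (3 / real q)"] by simp
    qed
    moreover have "- (\<Sum>D\<in>Pow P - S. (-1) ^ card D * g D) \<le> exp (- real (2 * r)) * (\<Prod>q\<in>P. 1 + 3 * exp 1 / real q)"
    proof -
      have "- (\<Sum>D\<in>Pow P - S. (-1) ^ card D * g D) \<le> \<bar>\<Sum>D\<in>Pow P - S. (-1) ^ card D * g D\<bar>" by simp
      also have "\<dots> \<le> (\<Sum>D\<in>Pow P - S. \<bar>(-1) ^ card D * g D\<bar>)" by (rule sum_abs)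
      also have "\<dots> = (\<Sum>D\<in>Pow P - S. g D)" using g0 by (simp add: abs_mult)
      \<comment> \<open>An omitted set has more than 2r elements, so the inserted weight exp(card D
        - 2r) is at least 1, and the sum over all subsets is again a product.\<close>
      also have "\<dots> \<le> (\<Sum>D\<in>Pow P - S. exp (- real (2 * r)) * (exp 1 ^ card D * g D))"
      proof (rule sum_mono)
        fix D assume D: "D \<in> Pow P - S"
        hence "2 * r \<le> card D" by (auto simp: S_def)
        hence "real (2 * r) \<le> real (card D)" by (simp only: of_nat_le_iff)
        hence "real (card D) - real (2 * r) \<ge> 0" by linarith
        hence "1 \<le> exp (real (card D) - real (2 * r))" by simp
        also have "\<dots> = exp (- real (2 * r)) * exp 1 ^ card D" by (simp add: exp_of_nat_mult[symmetric] exp_add[symmetric])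
        finally have "1 * g D \<le> exp (- real (2 * r)) * exp 1 ^ card D * g D" by (intro mult_right_mono g0)
        thus "g D \<le> exp (- real (2 * r)) * (exp 1 ^ card D * g D)" by (simp add: mult_ac)
      qed
      also have "\<dots> \<le> (\<Sum>D\<in>Pow P. exp (- real (2 * r)) * (exp 1 ^ card D * g D))"
        using assms(1) g0 by (intro sum_mono2) auto
      also have "\<dots> = exp (- real (2 * r)) * (\<Sum>D\<in>Pow P. exp 1 ^ card D * g D)" by (simp add: sum_distrib_left)
      also have "(\<Sum>D\<in>Pow P. exp 1 ^ card D * g D) = (\<Sum>D\<in>Pow P. \<Prod>q\<in>D. 3 * exp 1 / real q)"
        unfolding g_def prod_constant[symmetric] prod.distrib[symmetric] by (simp add: mult_ac)
      also have "\<dots> = (\<Prod>q\<in>P. 1 + 3 * exp 1 / real q)" by (rule sum_Pow_prod[OF assms(1)])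
      finally show ?thesis .
    qed
    ultimately show ?thesis by linarith
  qed
  have F3: "(\<Sum>D\<in>S. 3 ^ card D) \<le> B ^ (2 * r) * (1 + 3 / B) ^ card P"
  proof -
    \<comment> \<open>Since card D \<le> 2r, 3^(card D) \<le> B^(2r) (3/B)^(card D), which extends
      to a product over all of \<open>P\<close>.\<close>
    have "(\<Sum>D\<in>S. 3 ^ card D) \<le> (\<Sum>D\<in>S. B ^ (2 * r) * (3 / B) ^ card D)"
    proof (rule sum_mono)
      fix D assume "D \<in> S"
      hence "B ^ card D \<le> B ^ (2 * r)" using assms(4) by (intro power_increasing) (auto simp: S_def)
      hence "B ^ card D * 3 ^ card D \<le> B ^ (2 * r) * 3 ^ card D" by (intro mult_right_mono) auto
      thus "(3::real) ^ card D \<le> B ^ (2 * r) * (3 / B) ^ card D"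
        using assms(4) by (simp add: power_divide field_simps)
    qed
    also have "\<dots> \<le> (\<Sum>D\<in>Pow P. B ^ (2 * r) * (3 / B) ^ card D)"
      using assms(1,4) by (intro sum_mono2) (auto simp: S_def)
    also have "\<dots> = B ^ (2 * r) * (\<Sum>D\<in>Pow P. \<Prod>q\<in>D. 3 / B)" by (simp add: sum_distrib_left)
    also have "(\<Sum>D\<in>Pow P. \<Prod>q\<in>D. 3 / B) = (1 + 3 / B) ^ card P"
      by (subst sum_Pow_prod[OF assms(1)]) simp
    finally show ?thesis .
  qed
  have "0 \<le> real_of_int X / of_int M" using assms(2,3) by simp
  from order_trans[OF F1 add_mono[OF mult_left_mono[OF F2 this] F3]] show ?thesis .
qed

text \<open>Truncating inclusion-exclusion at about \<open>26 log log x\<close> primes, the remainder of Brun's sieve is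
  of size \<open>sieve_z x\<close> to the power \<open>27 log log x\<close>, that is \<open>x\<^bsup>1/8\<^esup>\<close>.\<close>

definition sieve_z :: "real \<Rightarrow> real" where
  "sieve_z x = exp (ln x / (216 * ln (ln x)))"

text \<open>\<open>a\<close> and \<open>b\<close> stand for the smooth parts of \<open>n + 2\<close>
  and \<open>n - 2\<close>; n \<ge> 3 makes the truncated difference genuine. Sieving starts at 5
  because modulo 3 the classes 0, 2, -2 exhaust everything and modulo 2 they coincide.\<close>

definition sieve_set :: "real \<Rightarrow> nat \<Rightarrow> nat \<Rightarrow> nat set" where
  "sieve_set x a b = {n\<in>{3..nat \<lfloor>x\<rfloor>}. a dvd n + 2 \<and> b dvd n - 2 \<and>
     (\<forall>q. prime q \<longrightarrow> 5 \<le> q \<longrightarrow> real q \<le> sieve_z x \<longrightarrow> \<not> q dvd a * b \<longrightarrow>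
        \<not> q dvd n \<and> \<not> q dvd n + 2 \<and> \<not> q dvd n - 2)}"

section \<open>The sieve applied to n, n + 2 and n - 2\<close>

lemma hfac_ge_1: "sieve_weight n \<ge> 1"
  unfolding sieve_weight_def by (rule prod_ge_1) auto

text \<open>Bernoulli gives 1 - 3/q \<le> (1 - 1/q)^3. Leaving out the primes 2 and 3 costs the
  factor 3 = 1/(1/2 * 2/3), cubed to 27.\<close>

lemma prod_primes_ge_5_le:
  assumes "N \<ge> 3"
  shows "(\<Prod>q\<in>{q\<in>primes_upto N. 5 \<le> q}. 1 - 3 / real q) \<le> 27 * (1 / ln (real N + 1)) ^ 3"
proof -
  let ?Q = "{q\<in>primes_upto N. 5 \<le> q}"
  have small: "primes_upto N - ?Q = {2, 3}"
  proof (rule Set.set_eqI)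
    fix q :: nat
    have "prime q \<and> q < 5 \<longleftrightarrow> q = 2 \<or> q = 3"
    proof
      assume q: "prime q \<and> q < 5"
      hence "q \<ge> 2" "q \<noteq> 4" using prime_ge_2_nat by auto
      thus "q = 2 \<or> q = 3" using q by linarith
    qed auto
    thus "q \<in> primes_upto N - ?Q \<longleftrightarrow> q \<in> {2, 3}" using assms by (auto simp: primes_upto_def)
  qed
  have "(\<Prod>q\<in>primes_upto N. 1 - 1 / real q) = (\<Prod>q\<in>{2,3}. 1 - 1 / real q) * (\<Prod>q\<in>?Q. 1 - 1 / real q)"
    by (subst prod.subset_diff[of ?Q]) (auto simp: small[symmetric])
  hence "1/3 * (\<Prod>q\<in>?Q. 1 - 1 / real q) \<le> 1 / ln (real N + 1)"
    using prod_one_minus_inverse_primes_le[of N] assms by simp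
  hence 1: "(\<Prod>q\<in>?Q. 1 - 1 / real q) \<le> 3 * (1 / ln (real N + 1))" by simp
  have "(\<Prod>q\<in>?Q. 1 - 3 / real q) \<le> (\<Prod>q\<in>?Q. (1 - 1 / real q) ^ 3)"
  proof (intro prod_mono conjI)
    fix q assume q: "q \<in> ?Q"
    show "0 \<le> 1 - 3 / real q" using q by simp
    have "1 + real 3 * (- (1 / real q)) \<le> (1 + - (1 / real q)) ^ 3"
      using q by (intro Bernoulli_inequality) auto
    thus "1 - 3 / real q \<le> (1 - 1 / real q) ^ 3" by simp
  qed
  also have "\<dots> = (\<Prod>q\<in>?Q. 1 - 1 / real q) ^ 3" by (simp add: prod_power_distrib)
  also have "\<dots> \<le> (3 * (1 / ln (real N + 1))) ^ 3"
    by (intro power_mono 1 prod_nonneg) auto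
  also have "\<dots> = 27 * (1 / ln (real N + 1)) ^ 3" by (simp add: power_divide)
  finally show ?thesis .
qed

lemma prod_sieve_le:
  assumes "N \<ge> 3" "a > 0" "b > 0" "coprime a b"
  shows "(\<Prod>q\<in>{q\<in>primes_upto N. 5 \<le> q \<and> \<not> q dvd a * b}. 1 - 3 / real q)
     \<le> 27 * (1 / ln (real N + 1)) ^ 3 * (sieve_weight a * sieve_weight b)"
proof -
  let ?Q = "{q\<in>primes_upto N. 5 \<le> q}" and ?P = "{q\<in>primes_upto N. 5 \<le> q \<and> \<not> q dvd a * b}"
  let ?f = "\<lambda>q::nat. 1 - 3 / real q" and ?g = "\<lambda>q::nat. 1 + 8 / real q"
  have fin: "finite ?Q" "finite ?P" by auto
  have fg: "1 \<le> ?f q * ?g q" "?f q \<ge> 0" if "q \<in> ?Q" for q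
  proof -
    have q: "real q \<ge> 5" using that by simp
    have "?f q * ?g q = 1 + (5 * real q - 24) / real q ^ 2" using q by (simp add: field_simps power2_eq_square)
    thus "1 \<le> ?f q * ?g q" using q by simp
    show "?f q \<ge> 0" using q by simp
  qed
  have "(\<Prod>q\<in>?P. ?f q) = (\<Prod>q\<in>?P. ?f q) * 1" by simp
  also have "\<dots> \<le> (\<Prod>q\<in>?P. ?f q) * (\<Prod>q\<in>?Q - ?P. ?f q * ?g q)"
    by (intro mult_left_mono prod_ge_1 prod_nonneg) (use fg in auto)
  also have "\<dots> = ((\<Prod>q\<in>?Q - ?P. ?f q) * (\<Prod>q\<in>?P. ?f q)) * (\<Prod>q\<in>?Q - ?P. ?g q)"
    by (simp add: prod.distrib mult_ac)
  also have "(\<Prod>q\<in>?Q - ?P. ?f q) * (\<Prod>q\<in>?P. ?f q) = (\<Prod>q\<in>?Q. ?f q)"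
    by (rule prod.subset_diff[symmetric]) auto
  also have "(\<Prod>q\<in>?Q. ?f q) * (\<Prod>q\<in>?Q - ?P. ?g q) \<le> (\<Prod>q\<in>?Q. ?f q) * sieve_weight (a * b)"
  proof (intro mult_left_mono prod_nonneg)
    show "(\<Prod>q\<in>?Q - ?P. ?g q) \<le> sieve_weight (a * b)"
      unfolding sieve_weight_def
    proof (rule prod_mono2)
      show "?Q - ?P \<subseteq> prime_factors (a * b)" using assms by (auto simp: prime_factors_dvd primes_upto_def)
    qed (auto intro: add_nonneg_nonneg)
  qed (use fg in auto)
  also have "sieve_weight (a * b) = sieve_weight a * sieve_weight b" using mult_funD[OF mult_fun_hfac assms(2-4)] .
  also have "(\<Prod>q\<in>?Q. ?f q) * (sieve_weight a * sieve_weight b) \<le> 27 * (1 / ln (real N + 1)) ^ 3 * (sieve_weight a * sieve_weight b)"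
    by (intro mult_right_mono prod_primes_ge_5_le assms) (use hfac_pos[of a] hfac_pos[of b] in simp)
  finally show ?thesis .
qed

text \<open>If the set has an element \<open>c\<close>, the divisibility conditions put all its
  elements into one class modulo \<open>a * b\<close>, as \<open>a\<close> and \<open>b\<close> are
  coprime. The sieve then removes the residues 0, 2 and -2.\<close>

lemma card_sieve_set_le_brun:
  assumes "N = nat \<lfloor>sieve_z x\<rfloor>" "N \<ge> 3" "a > 0" "b > 0" "coprime a b" "x \<ge> 0"
  shows "real (card (sieve_set x a b)) \<le>
     x / real (a * b) * (27 * (1 / ln (real N + 1)) ^ 3 * (sieve_weight a * sieve_weight b)
        + exp (- real (2 * r) + 3 * exp 1 * (exp 1 * ln (1 + ln (real N)))))
     + (3 * real N) ^ (2 * r) * exp 1"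
proof (cases "sieve_set x a b = {}")
  case True
  have "ln (real N + 1) \<ge> 0" using assms by simp
  thus ?thesis unfolding True using assms hfac_pos[of a] hfac_pos[of b]
    by (auto intro!: add_nonneg_nonneg mult_nonneg_nonneg)
next
  case False
  then obtain c where c: "c \<in> sieve_set x a b" by blast
  let ?P = "{q\<in>primes_upto N. 5 \<le> q \<and> \<not> q dvd a * b}"
  let ?R = "\<lambda>q::nat. {0, 2, int q - 2}"
  let ?X = "\<lfloor>x\<rfloor>" and ?M = "int (a * b)"
  let ?W = "{n\<in>{1..?X}. [n = int c] (mod ?M) \<and> (\<forall>q\<in>?P. n mod int q \<notin> ?R q)}"
  have finW: "finite ?W" by (rule finite_subset[of _ "{1..?X}"]) auto
  have "int ` sieve_set x a b \<subseteq> ?W"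
  proof (rule image_subsetI)
    fix n assume n: "n \<in> sieve_set x a b"
    have n3: "n \<ge> 3" "c \<ge> 3" "int n \<le> ?X" using n c by (auto simp: sieve_set_def)
    have d: "a dvd n + 2" "b dvd n - 2" "a dvd c + 2" "b dvd c - 2" using n c by (auto simp: sieve_set_def)
    have i: "int (n - 2) = int n - 2" "int (c - 2) = int c - 2" using n3 by auto
    have "int a dvd int (n + 2) - int (c + 2)" using d by (intro dvd_diff) (simp_all only: of_nat_dvd_iff)
    hence da: "int a dvd int n - int c" by simp
    have "int b dvd int (n - 2) - int (c - 2)" using d by (intro dvd_diff) (simp_all only: of_nat_dvd_iff)
    hence db: "int b dvd int n - int c" unfolding i by simp
    have "coprime (int a) (int b)" using assms(5) by simp
    hence "int a * int b dvd int n - int c" using da db by (rule divides_mult[rotated 2])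
    hence 1: "[int n = int c] (mod ?M)" by (simp add: cong_iff_dvd_diff)
    have 2: "int n mod int q \<notin> ?R q" if q: "q \<in> ?P" for q
    proof -
      have q5: "prime q" "5 \<le> q" "\<not> q dvd a * b" "q \<le> N" using q by (auto simp: primes_upto_def)
      have "real q \<le> sieve_z x" using q5(4) assms(1)
        by (metis le_nat_floor of_nat_floor of_nat_le_iff order_trans order_less_imp_le exp_gt_zero sieve_z_def)
      hence nd: "\<not> q dvd n" "\<not> q dvd n + 2" "\<not> q dvd n - 2" using n q5 by (auto simp: sieve_set_def)
      have "\<not> int q dvd int n" using nd(1) by simp
      hence "int n mod int q \<noteq> 0" by (simp add: dvd_eq_mod_eq_0)
      moreover have "int n mod int q \<noteq> 2"
      proof
        assume "int n mod int q = 2"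
        hence "int q dvd int n - 2" by (metis dvd_minus_mod)
        hence "int q dvd int (n - 2)" unfolding i .
        thus False using nd(3) by (simp only: of_nat_dvd_iff)
      qed
      moreover have "int n mod int q \<noteq> int q - 2"
      proof
        assume "int n mod int q = int q - 2"
        hence "int q dvd int n - (int q - 2)" by (metis dvd_minus_mod)
        hence "int q dvd int n - (int q - 2) + int q" by (intro dvd_add) auto
        hence "int q dvd int (n + 2)" by (simp add: add.commute)
        thus False using nd(2) by (simp only: of_nat_dvd_iff)
      qed
      ultimately show ?thesis by simp
    qed
    show "int n \<in> ?W" using n3 1 2 by simp
  qed
  hence "card (int ` sieve_set x a b) \<le> card ?W" by (rule card_mono[OF finW])
  hence "real (card (sieve_set x a b)) \<le> real (card ?W)" by (simp add: card_image)
  \<comment> \<open>With B = 3N the last factor is (1 + 1/N)^(card ?P) \<le> e, because card ?P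
    \<le> N.\<close>
  also have "\<dots> \<le> of_int ?X / of_int ?M * ((\<Prod>q\<in>?P. 1 - 3 / real q)
      + exp (- real (2 * r)) * (\<Prod>q\<in>?P. 1 + 3 * exp 1 / real q))
      + (3 * real N) ^ (2 * r) * (1 + 3 / (3 * real N)) ^ card ?P"
  proof (rule brun_sieve)
    fix q assume q: "q \<in> ?P"
    hence q5: "prime q" "5 \<le> q" "\<not> q dvd a * b" by (auto simp: primes_upto_def)
    have "coprime q (a * b)" by (rule prime_imp_coprime_nat[OF q5(1,3)])
    hence "coprime (int q) (int (a * b))" by (simp only: coprime_int_iff)
    thus "prime q \<and> coprime (int q) ?M \<and> ?R q \<subseteq> {0..<int q} \<and> card (?R q) = 3"
      using q5 by (auto simp: card_insert_if)
  qed (use assms in auto)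
  also have "\<dots> \<le> x / real (a * b) * (27 * (1 / ln (real N + 1)) ^ 3 * (sieve_weight a * sieve_weight b)
        + exp (- real (2 * r) + 3 * exp 1 * (exp 1 * ln (1 + ln (real N)))))
     + (3 * real N) ^ (2 * r) * exp 1"
  proof (intro add_mono mult_mono)
    show "real_of_int ?X / real_of_int ?M \<le> x / real (a * b)"
      using assms by (simp add: divide_right_mono)
    show "(\<Prod>q\<in>?P. 1 - 3 / real q) \<le> 27 * (1 / ln (real N + 1)) ^ 3 * (sieve_weight a * sieve_weight b)"
      by (rule prod_sieve_le[OF assms(2-5)])
    have "(\<Prod>q\<in>?P. 1 + 3 * exp 1 / real q) \<le> (\<Prod>q\<in>?P. exp (3 * exp 1 / real q))"
      by (intro prod_mono conjI exp_ge_add_one_self) (auto intro: add_nonneg_nonneg)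
    also have "\<dots> = exp (\<Sum>q\<in>?P. 3 * exp 1 * (1 / real q))" by (subst exp_sum) auto
    also have "(\<Sum>q\<in>?P. 3 * exp 1 * (1 / real q)) \<le> (\<Sum>q\<in>primes_upto N. 3 * exp 1 * (1 / real q))"
      by (intro sum_mono2) auto
    also have "\<dots> = 3 * exp 1 * (\<Sum>q\<in>primes_upto N. 1 / real q)" by (simp add: sum_distrib_left)
    also have "\<dots> \<le> 3 * exp 1 * (exp 1 * ln (1 + ln (real N)))"
      using assms(2) by (intro mult_left_mono sum_inverse_primes_le) auto
    finally have "(\<Prod>q\<in>?P. 1 + 3 * exp 1 / real q) \<le> exp (3 * exp 1 * (exp 1 * ln (1 + ln (real N))))" by simp
    thus "exp (- real (2 * r)) * (\<Prod>q\<in>?P. 1 + 3 * exp 1 / real q)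
        \<le> exp (- real (2 * r) + 3 * exp 1 * (exp 1 * ln (1 + ln (real N))))"
      unfolding exp_add by (intro mult_left_mono) auto
    have "card ?P \<le> card {1..N}"
      by (rule card_mono) (auto simp: primes_upto_def prime_ge_1_nat)
    hence cP: "card ?P \<le> N" by simp
    have "(1 + 3 / (3 * real N)) ^ card ?P \<le> (1 + 1 / real N) ^ N"
      using assms(2) cP power_increasing[of "card ?P" N "1 + 1 / real N"] by simp
    also have "\<dots> \<le> exp (1 / real N) ^ N" by (intro power_mono exp_ge_add_one_self) auto
    also have "\<dots> = exp 1" using assms(2) by (simp add: exp_of_nat_mult[symmetric])
    finally show "(1 + 3 / (3 * real N)) ^ card ?P \<le> exp 1" .
    show "0 \<le> (\<Prod>q\<in>?P. 1 - 3 / real q) + exp (- real (2 * r)) * (\<Prod>q\<in>?P. 1 + 3 * exp 1 / real q)"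
      by (intro add_nonneg_nonneg mult_nonneg_nonneg prod_nonneg) (auto intro: add_nonneg_nonneg)
  qed (use assms in auto)
  finally show ?thesis .
qed

text \<open>As a, b \<le> x^(1/4), the main term keeps x/(ab) \<ge> x^(1/2), far above the sieve
  remainder. In \<open>C\<close> the first summand comes from the product over primes and the 2 from
  the truncation error and the remainder.\<close>

lemma card_sieve_set_le:
  "\<exists>C>0. \<forall>\<^sub>F x in at_top. \<forall>a b. a > 0 \<longrightarrow> b > 0 \<longrightarrow> coprime a b \<longrightarrow>
     real a \<le> x powr (1/4) \<longrightarrow> real b \<le> x powr (1/4) \<longrightarrow>
     real (card (sieve_set x a b)) \<le> C * x * (ln (ln x) / ln x) ^ 3 * (sieve_weight a / real a) * (sieve_weight b / real b)"
proof -
  define C :: real where "C = 27 * 216 ^ 3 + 2"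
  have ev: "\<forall>\<^sub>F x in at_top. x > (1::real) \<and> ln x \<ge> 1 \<and> ln (ln x) \<ge> 2 \<and> ln x / (216 * ln (ln x)) \<ge> 2
      \<and> 1 + ln x / (216 * ln (ln x)) \<le> ln x
      \<and> 1 + 27 * 2 * ln (ln x) + ln x / 8 + 3 * ln (ln x) \<le> ln x / 2"
    by (intro eventually_conj; real_asymp)
  have "\<forall>\<^sub>F x in at_top. \<forall>a b. a > 0 \<longrightarrow> b > 0 \<longrightarrow> coprime a b \<longrightarrow>
     real a \<le> x powr (1/4) \<longrightarrow> real b \<le> x powr (1/4) \<longrightarrow>
     real (card (sieve_set x a b)) \<le> C * x * (ln (ln x) / ln x) ^ 3 * (sieve_weight a / real a) * (sieve_weight b / real b)"
    using ev
  proof (eventually_elim, intro allI impI)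
    fix x :: real and a b :: nat
    assume x: "x > (1::real) \<and> ln x \<ge> 1 \<and> ln (ln x) \<ge> 2 \<and> ln x / (216 * ln (ln x)) \<ge> 2
      \<and> 1 + ln x / (216 * ln (ln x)) \<le> ln x
      \<and> 1 + 27 * 2 * ln (ln x) + ln x / 8 + 3 * ln (ln x) \<le> ln x / 2"
    assume ab: "a > 0" "b > 0" "coprime a b" "real a \<le> x powr (1/4)" "real b \<le> x powr (1/4)"
    define L where "L = ln x"
    define l where "l = ln L"
    define w where "w = L / (216 * l)"
    have L: "x > 1" "L \<ge> 1" "l \<ge> 2" "w \<ge> 2" "1 + w \<le> L" "1 + 27 * 2 * l + L / 8 + 3 * l \<le> L / 2"
      using x by (auto simp: L_def l_def w_def)
    define N where "N = nat \<lfloor>sieve_z x\<rfloor>"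
    have zw: "sieve_z x = exp w" by (simp add: sieve_z_def w_def L_def l_def)
    have e2: "exp w \<ge> 3" using exp_ge_add_one_self[of w] L by linarith
    have N: "N \<ge> 3" "real N \<le> exp w" "exp w \<le> real N + 1"
      using e2 unfolding N_def zw by linarith+
    \<comment> \<open>The omitted sets cost at most exp(23l), since 3e^2 < 23; with 2r \<ge> 26l a
      factor exp(-3l) = (log x)^(-3) is left. Rounding up is absorbed into 27l because l \<ge>
      2.\<close>
    define r where "r = nat \<lceil>13 * l\<rceil>"
    have r: "26 * l \<le> real (2 * r)" "real (2 * r) \<le> 27 * l"
      using L(3) unfolding r_def by linarith+
    let ?h = "sieve_weight a * sieve_weight b"
    have h1: "?h \<ge> 1" using mult_mono[of 1 "sieve_weight a" 1 "sieve_weight b"] hfac_ge_1[of a] hfac_ge_1[of b] by simp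
    have lL: "l / L \<ge> 0" using L by simp
    have t1: "27 * (1 / ln (real N + 1)) ^ 3 * ?h \<le> 27 * 216 ^ 3 * (l / L) ^ 3 * ?h"
    proof -
      have "w \<le> ln (real N + 1)" using N(3) by (subst ln_ge_iff) auto
      hence "1 / ln (real N + 1) \<le> 1 / w" using L N(1) by (intro divide_left_mono mult_pos_pos) auto
      also have "\<dots> = 216 * (l / L)" using L by (simp add: w_def)
      finally have "(1 / ln (real N + 1)) ^ 3 \<le> (216 * (l / L)) ^ 3"
        using N by (intro power_mono) auto
      also have "\<dots> = 216 ^ 3 * (l / L) ^ 3" by (rule power_mult_distrib)
      finally show ?thesis using h1 by (simp add: mult_right_mono)
    qed
    have L3: "exp (- 3 * l) = (1 / L) ^ 3"
    proof -
      have "exp (- l) = 1 / L" using L(2) by (simp add: l_def exp_minus divide_inverse)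
      moreover have "exp (- 3 * l) = exp (- l) ^ 3" using exp_of_nat_mult[of 3 "- l"] by simp
      ultimately show ?thesis by simp
    qed
    have L3': "(1 / L) ^ 3 \<le> (l / L) ^ 3 * ?h"
    proof -
      have "(1 / L) ^ 3 \<le> (l / L) ^ 3" using L by (intro power_mono divide_right_mono) auto
      also have "\<dots> \<le> (l / L) ^ 3 * ?h" using mult_left_mono[OF h1, of "(l / L) ^ 3"] lL by simp
      finally show ?thesis .
    qed
    have t2: "exp (- real (2 * r) + 3 * exp 1 * (exp 1 * ln (1 + ln (real N)))) \<le> (l / L) ^ 3 * ?h"
    proof -
      have "ln (real N) \<le> ln (exp w)" using N(1,2) by (subst ln_le_cancel_iff) auto
      hence "ln (real N) \<le> w" by simp
      hence "1 + ln (real N) \<le> L" using L by linarith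
      moreover have "ln (real N) \<ge> 0" using N by simp
      ultimately have "ln (1 + ln (real N)) \<le> l" unfolding l_def by (subst ln_le_cancel_iff) auto
      hence "3 * exp 1 * (exp 1 * ln (1 + ln (real N))) \<le> 3 * exp 1 * (exp 1 * l)" by (intro mult_left_mono) auto
      also have "\<dots> = 3 * (exp 1 * exp 1) * l" by simp
      also have "\<dots> \<le> 3 * (272/100 * (272/100)) * l"
        using e_less_272 L by (intro mult_right_mono mult_left_mono mult_mono) auto
      also have "\<dots> \<le> 23 * l" using L by (intro mult_right_mono) auto
      finally have "exp (- real (2 * r) + 3 * exp 1 * (exp 1 * ln (1 + ln (real N)))) \<le> exp (- 3 * l)"
        using r by (subst exp_le_cancel_iff) linarith
      thus ?thesis using L3 L3' by linarith
    qed
    have x4: "x / real (a * b) \<ge> exp (L / 2)"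
    proof -
      have "real a * real b \<le> x powr (1/4) * x powr (1/4)" using ab by (intro mult_mono) auto
      also have "\<dots> = x powr (1/2)" by (simp flip: powr_add)
      finally have "x / x powr (1/2) \<le> x / real (a * b)" using L ab by (intro divide_left_mono) auto
      moreover have "x / x powr (1/2) = x powr (1/2)" using L powr_diff[of x 1 "1/2"] by simp
      moreover have "x powr (1/2) = exp (L / 2)" using L by (simp add: powr_def L_def)
      ultimately show ?thesis by simp
    qed
    have t3: "(3 * real N) ^ (2 * r) * exp 1 \<le> x / real (a * b) * ((l / L) ^ 3 * ?h)"
    proof -
      have "(3 * real N) ^ (2 * r) \<le> (exp 2 * exp w) ^ (2 * r)"
        using N(2) exp_ge_add_one_self[of "2::real"] by (intro power_mono mult_mono) auto
      also have "\<dots> = exp (real (2 * r) * (2 + w))" by (simp only: exp_add[symmetric] exp_of_nat_mult)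
      also have "\<dots> \<le> exp (27 * l * (2 + w))" using r L by (subst exp_le_cancel_iff, intro mult_right_mono) auto
      also have "27 * l * (2 + w) = 27 * 2 * l + L / 8" using L by (simp add: w_def field_simps)
      finally have "(3 * real N) ^ (2 * r) * exp 1 \<le> exp (27 * 2 * l + L / 8) * exp 1"
        by (intro mult_right_mono) auto
      also have "\<dots> = exp (1 + 27 * 2 * l + L / 8)" by (simp add: exp_add)
      also have "\<dots> \<le> exp (L / 2 + - 3 * l)" using L by simp
      also have "\<dots> = exp (L / 2) * exp (- 3 * l)" by (rule exp_add)
      also have "\<dots> \<le> x / real (a * b) * ((l / L) ^ 3 * ?h)"
        using x4 L3' L(1,2) unfolding L3 by (intro mult_mono) auto
      finally show ?thesis .
    qed
    have "real (card (sieve_set x a b)) \<le> x / real (a * b) * (27 * (1 / ln (real N + 1)) ^ 3 * ?h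
        + exp (- real (2 * r) + 3 * exp 1 * (exp 1 * ln (1 + ln (real N)))))
     + (3 * real N) ^ (2 * r) * exp 1"
      by (rule card_sieve_set_le_brun[OF N_def N(1) ab(1-3)]) (use L in simp)
    also have "\<dots> \<le> x / real (a * b) * (27 * 216 ^ 3 * (l / L) ^ 3 * ?h + (l / L) ^ 3 * ?h)
        + x / real (a * b) * ((l / L) ^ 3 * ?h)"
      using L by (intro add_mono mult_left_mono t1 t2 t3) auto
    also have "\<dots> = C * x * (l / L) ^ 3 * (sieve_weight a / real a) * (sieve_weight b / real b)"
      unfolding C_def using ab by (simp add: field_simps)
    finally show "real (card (sieve_set x a b)) \<le> C * x * (ln (ln x) / ln x) ^ 3 * (sieve_weight a / real a) * (sieve_weight b / real b)"
      by (simp add: L_def l_def)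
  qed
  thus ?thesis by (intro exI[of _ C]) (auto simp: C_def)
qed

section \<open>Smooth and rough parts\<close>

lemma smooth_rough_split:
  assumes "n > 0"
  shows "\<exists>a b. n = a * b \<and> a > 0 \<and> b > 0 \<and> coprime a b \<and> (\<forall>q. prime q \<longrightarrow> q dvd a \<longrightarrow> q \<le> Z)
     \<and> (\<forall>q. prime q \<longrightarrow> q dvd b \<longrightarrow> (Z::nat) < q)"
  using assms
proof (induction n rule: prime_power_induct)
  case one
  show ?case by (intro exI[of _ 1]) auto
next
  case (mult q k m)
  then obtain a b where ab: "m = a * b" "a > 0" "b > 0" "coprime a b"
    "\<forall>q. prime q \<longrightarrow> q dvd a \<longrightarrow> q \<le> Z" "\<forall>q. prime q \<longrightarrow> q dvd b \<longrightarrow> Z < q" by blast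
  have nd: "\<not> q dvd a" "\<not> q dvd b" using mult(4) ab(1) by auto
  have cop: "coprime (q ^ k) a" "coprime (q ^ k) b"
    by (rule coprime_prime_power_nat[OF mult(1) nd(1)], rule coprime_prime_power_nat[OF mult(1) nd(2)])
  have q0: "q ^ k > 0" using mult(1) prime_gt_0_nat by simp
  have pd: "p dvd q ^ k * c \<Longrightarrow> prime p \<Longrightarrow> p = q \<or> p dvd c" for p c
    using mult(1) by (metis prime_dvd_mult_iff prime_dvd_power primes_dvd_imp_eq)
  show ?case
  proof (cases "q \<le> Z")
    case True
    have "\<forall>p. prime p \<longrightarrow> p dvd q ^ k * a \<longrightarrow> p \<le> Z" using pd[of _ a] ab(5) True by blast
    moreover have "coprime (q ^ k * a) b" using cop ab by simp
    moreover have "q ^ k * m = q ^ k * a * b" by (simp add: ab(1))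
    ultimately show ?thesis using ab q0 by (intro exI[of _ "q ^ k * a"] exI[of _ b]) simp
  next
    case False
    have "\<forall>p. prime p \<longrightarrow> p dvd q ^ k * b \<longrightarrow> Z < p" using pd[of _ b] ab(6) False by (metis not_le)
    moreover have "coprime a (q ^ k * b)" using cop ab by (simp add: coprime_commute)
    moreover have "q ^ k * m = a * (q ^ k * b)" by (simp add: ab(1))
    ultimately show ?thesis using ab q0 by (intro exI[of _ a] exI[of _ "q ^ k * b"]) simp
  qed
qed

text \<open>The value at \<open>n = 0\<close> is junk.\<close>

definition smooth_part :: "nat \<Rightarrow> nat \<Rightarrow> nat" where
  "smooth_part Z n = (SOME a. \<exists>b. n = a * b \<and> a > 0 \<and> b > 0 \<and> coprime a b \<and>
     (\<forall>q. prime q \<longrightarrow> q dvd a \<longrightarrow> q \<le> Z) \<and> (\<forall>q. prime q \<longrightarrow> q dvd b \<longrightarrow> Z < q))"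

lemma smooth_partE:
  assumes "n > 0"
  obtains b where "n = smooth_part Z n * b" "smooth_part Z n > 0" "b > 0" "coprime (smooth_part Z n) b"
    "\<And>q. prime q \<Longrightarrow> q dvd smooth_part Z n \<Longrightarrow> q \<le> Z" "\<And>q. prime q \<Longrightarrow> q dvd b \<Longrightarrow> Z < q"
  using someI_ex[OF smooth_rough_split[OF assms, of Z]] that unfolding smooth_part_def[symmetric] by blast

text \<open>An integer without primes below \<open>z\<close> has at most ln b / ln z prime factors
  with multiplicity, and each costs at most a factor 2 because k + 1 \<le> 2^k.\<close>

lemma hecke_rough_le:
  assumes "even M" "b > 0" "z > 1" "\<And>q. prime q \<Longrightarrow> q dvd b \<Longrightarrow> z \<le> real q"
  shows "\<bar>hecke M b\<bar> \<le> real b powr (ln 2 / ln z)"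
proof (rule mult_fun_le[of "\<lambda>n. \<bar>hecke M n\<bar>" "\<lambda>n. real n powr (ln 2 / ln z)"])
  show "mult_fun (\<lambda>n. \<bar>hecke M n\<bar>)" by (intro mult_fun_abs mult_fun_hecke assms)
  fix q k :: nat assume q: "prime q" "k > 0" "q dvd b"
  have zq: "z \<le> real q" using assms(4) q by blast
  have "\<bar>hecke M (q ^ k)\<bar> \<le> real (k + 1)" using hecke_prime_power_le[OF q(1), of M k] by simp
  also have "\<dots> \<le> real (2 ^ k)" by (subst of_nat_le_iff) (metis Suc_eq_plus1 Suc_leI less_exp)
  also have "\<dots> = exp (real k * ln 2)" by (simp add: exp_of_nat_mult)
  also have "\<dots> \<le> exp (real k * (ln (real q) * ln 2 / ln z))"
  proof (subst exp_le_cancel_iff, rule mult_left_mono)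
    have "ln z \<le> ln (real q)" using zq assms(3) by simp
    hence "ln 2 * ln z \<le> ln 2 * ln (real q)" by (intro mult_left_mono) auto
    thus "ln 2 \<le> ln (real q) * ln 2 / ln z" using assms(3) by (simp add: field_simps)
  qed simp
  also have "\<dots> = real (q ^ k) powr (ln 2 / ln z)"
    using prime_gt_0_nat[OF q(1)] by (simp add: powr_def ln_realpow mult_ac)
  finally show "\<bar>hecke M (q ^ k)\<bar> \<le> real (q ^ k) powr (ln 2 / ln z)" .
qed (use assms mult_fun_powr in auto)

section \<open>Integers with a large smooth part\<close>

text \<open>The condition \<eta> ln Z \<le> K keeps q^\<eta> bounded for q \<le> Z, so the sum of
  q^(\<eta> - 1) exceeds that of 1/q by a bounded amount. The condition \<eta> \<le> 1/4 makes the
  squares of the terms summable.\<close>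

lemma rankin_smooth:
  assumes "K \<ge> 0"
  shows "\<exists>C>0. \<forall>Z\<ge>2. \<forall>\<eta>. 0 < \<eta> \<longrightarrow> \<eta> \<le> 1/4 \<longrightarrow> \<eta> * ln (real Z) \<le> K \<longrightarrow>
     (\<lambda>n. real n powr (\<eta> - 1)) summable_on smooth (primes_upto Z) \<and>
     infsum (\<lambda>n. real n powr (\<eta> - 1)) (smooth (primes_upto Z)) \<le> C * (1 + ln (real Z)) powr exp 1"
proof -
  define S where "S = (\<Sum>n. real n powr (-3/2))"
  have sS: "summable (\<lambda>n. real n powr (-3/2))" by (simp add: summable_real_powr_iff)
  define C where "C = exp (2 * K * exp K + 4 * S)"
  have "(\<lambda>n. real n powr (\<eta> - 1)) summable_on smooth (primes_upto Z) \<and>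
     infsum (\<lambda>n. real n powr (\<eta> - 1)) (smooth (primes_upto Z)) \<le> C * (1 + ln (real Z)) powr exp 1"
    if Z: "Z \<ge> 2" and eta: "0 < \<eta>" "\<eta> \<le> 1/4" "\<eta> * ln (real Z) \<le> K" for Z \<eta>
  proof -
    let ?P = "primes_upto Z" and ?f = "\<lambda>n. real n powr (\<eta> - 1)"
    define t where "t q = real q powr (\<eta> - 1)" for q :: nat
    have lnZ: "ln (real Z) > 0" using Z by simp
    have q2: "real q \<ge> 2" "real q \<le> real Z" if "q \<in> ?P" for q
      using that prime_ge_2_nat[of q] by (auto simp: primes_upto_def)
    have t: "0 < t q" "t q \<le> 3/4" "t q ^ 2 \<le> real q powr (-3/2)" if "q \<in> ?P" for q
    proof -
      show "0 < t q" using q2[OF that] by (simp add: t_def)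
      have "t q \<le> real q powr (-1/2)" unfolding t_def using q2[OF that] eta by (intro powr_mono) auto
      also have "\<dots> \<le> 2 powr (-1/2)" using q2[OF that] by (intro powr_mono2') auto
      also have "\<dots> \<le> 3/4"
      proof (rule ccontr)
        define w :: real where "w = 2 powr (-1/2)"
        assume "\<not> 2 powr (-1/2) \<le> (3/4 :: real)"
        hence "3/4 * (3/4) < w * w" unfolding w_def by (intro mult_strict_mono) auto
        moreover have "w * w = 2 powr (-1/2 + -1/2)" unfolding w_def by (rule powr_add[symmetric])
        hence "w * w = 1/2" by (simp add: powr_minus)
        ultimately show False by simp
      qed
      finally show "t q \<le> 3/4" .
      have "t q ^ 2 = real q powr (2 * (\<eta> - 1))"
        unfolding t_def power2_eq_square powr_add[symmetric] mult_2 ..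
      also have "\<dots> \<le> real q powr (-3/2)" using q2[OF that] eta by (intro powr_mono) auto
      finally show "t q ^ 2 \<le> real q powr (-3/2)" .
    qed
    have fq: "?f (q ^ k) = t q ^ k" for q k
      by (induction k) (auto simp: t_def powr_mult)
    have E: "(\<lambda>n. norm (?f n)) summable_on smooth ?P \<and> infsum ?f (smooth ?P) = (\<Prod>q\<in>?P. \<Sum>k. ?f (q ^ k))"
    proof (rule euler_product)
      show "mult_fun ?f" by (rule mult_fun_powr)
      show "summable (\<lambda>k. \<bar>?f (q ^ k)\<bar>)" if "q \<in> ?P" for q
      proof -
        have "\<bar>t q\<bar> < 1" using t[OF that] by simp
        hence "summable (\<lambda>k. t q ^ k)" by (simp add: summable_geometric)
        thus ?thesis unfolding fq using t[OF that] by simp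
      qed
    qed (auto simp: primes_upto_def)
    have "(\<Prod>q\<in>?P. \<Sum>k. ?f (q ^ k)) \<le> (\<Prod>q\<in>?P. exp (t q + 4 * real q powr (-3/2)))"
    proof (intro prod_mono conjI)
      fix q assume q: "q \<in> ?P"
      note tq = t[OF q]
      have "(\<Sum>k. ?f (q ^ k)) = 1 / (1 - t q)" unfolding fq using tq by (intro suminf_geometric) auto
      also have "\<dots> = 1 + t q / (1 - t q)" using tq by (simp add: field_simps)
      also have "\<dots> \<le> exp (t q / (1 - t q))" by (rule exp_ge_add_one_self)
      also have "t q / (1 - t q) = t q + t q ^ 2 / (1 - t q)" using tq by (simp add: field_simps power2_eq_square)
      also have "t q ^ 2 / (1 - t q) \<le> t q ^ 2 / (1/4)" using tq by (intro divide_left_mono) auto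
      also have "t q + t q ^ 2 / (1/4) \<le> t q + 4 * real q powr (-3/2)" using tq by simp
      finally show "(\<Sum>k. ?f (q ^ k)) \<le> exp (t q + 4 * real q powr (-3/2))" by simp
      show "0 \<le> (\<Sum>k. ?f (q ^ k))" unfolding fq using tq by (subst suminf_geometric) auto
    qed
    also have "\<dots> = exp ((\<Sum>q\<in>?P. t q) + 4 * (\<Sum>q\<in>?P. real q powr (-3/2)))"
      by (simp add: exp_sum[symmetric] sum.distrib sum_distrib_left)
    also have "\<dots> \<le> exp ((exp 1 * ln (1 + ln (real Z)) + 2 * K * exp K) + 4 * S)"
    proof (subst exp_le_cancel_iff, intro add_mono mult_left_mono)
      show "(\<Sum>q\<in>?P. real q powr (-3/2)) \<le> S" unfolding S_def by (intro sum_le_suminf sS) auto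
      have "(\<Sum>q\<in>?P. t q) \<le> (\<Sum>q\<in>?P. 1 / real q + \<eta> * exp K * (ln (real q) / real q))"
      proof (rule sum_mono)
        fix q assume q: "q \<in> ?P"
        note q2 = q2[OF q]
        define u where "u = \<eta> * ln (real q)"
        have "u \<le> \<eta> * ln (real Z)" unfolding u_def using q2 eta by (intro mult_left_mono) auto
        hence uK: "u \<le> K" using eta(3) by linarith
        have u0: "0 \<le> u" using eta(1) q2 by (auto simp: u_def)
        note u = u0 uK
        \<comment> \<open>Linearising in u = \<eta> ln q reduces the excess to the sum of ln q / q,
          at most 2 ln Z.\<close>
        have "exp u \<le> 1 + u * exp u"
        proof -
          have "exp u * (1 - u) \<le> exp u * exp (- u)" using exp_ge_add_one_self[of "-u"] by (intro mult_left_mono) auto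
          thus ?thesis by (simp add: algebra_simps exp_minus)
        qed
        also have "\<dots> \<le> 1 + u * exp K" using u by (intro add_left_mono mult_left_mono) auto
        finally have "exp u / real q \<le> (1 + u * exp K) / real q" by (intro divide_right_mono) auto
        moreover have "t q = exp u / real q"
          using q2 by (simp add: t_def powr_def u_def left_diff_distrib exp_diff)
        ultimately show "t q \<le> 1 / real q + \<eta> * exp K * (ln (real q) / real q)"
          by (simp add: u_def add_divide_distrib mult_ac)
      qed
      also have "\<dots> = (\<Sum>q\<in>?P. 1 / real q) + \<eta> * exp K * (\<Sum>q\<in>?P. ln (real q) / real q)"
        by (simp add: sum.distrib sum_distrib_left)
      also have "\<dots> \<le> exp 1 * ln (1 + ln (real Z)) + \<eta> * exp K * (2 * ln (real Z))"
        using Z eta by (intro add_mono mult_left_mono sum_inverse_primes_le sum_ln_div_primes_le) auto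
      also have "\<eta> * exp K * (2 * ln (real Z)) = 2 * (\<eta> * ln (real Z)) * exp K" by simp
      also have "\<dots> \<le> 2 * K * exp K" using eta by (intro mult_right_mono) auto
      finally show "(\<Sum>q\<in>?P. t q) \<le> exp 1 * ln (1 + ln (real Z)) + 2 * K * exp K" by simp
    qed auto
    also have "\<dots> = C * (1 + ln (real Z)) powr exp 1"
    proof -
      have "1 + ln (real Z) \<noteq> 0" using lnZ by linarith
      thus ?thesis by (simp add: C_def powr_def exp_add mult_ac)
    qed
    finally show ?thesis using E abs_summable_summable by auto
  qed
  thus ?thesis by (intro exI[of _ C]) (auto simp: C_def)
qed

lemma card_multiples_le:
  fixes X a :: nat assumes "a > 0"
  shows "real (card {m\<in>{1..X}. a dvd m}) \<le> real X / real a"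
proof -
  have "{m\<in>{1..X}. a dvd m} \<subseteq> (\<lambda>k. a * k) ` {1..X div a}"
  proof
    fix m assume m: "m \<in> {m\<in>{1..X}. a dvd m}"
    then obtain k where k: "m = a * k" by auto
    have "k \<le> X div a" using m k assms by (simp add: less_eq_div_iff_mult_less_eq mult.commute)
    moreover have "k \<ge> 1" using m k by (cases k) auto
    ultimately show "m \<in> (\<lambda>k. a * k) ` {1..X div a}" using k by auto
  qed
  hence "card {m\<in>{1..X}. a dvd m} \<le> card {1..X div a}"
    by (intro order_trans[OF card_mono card_image_le]) auto
  hence "real (card {m\<in>{1..X}. a dvd m}) \<le> real (X div a)" by simp
  also have "\<dots> \<le> real X / real a"
  proof -
    have "real (X div a * a) \<le> real X" by (subst of_nat_le_iff) simp
    thus ?thesis using assms by (simp add: field_simps)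
  qed
  finally show ?thesis .
qed

text \<open>Every counted \<open>m\<close> is a multiple of its own smooth part a > y, and the count
  X/a of multiples may be enlarged by (a/y)^\<eta> \<ge> 1.\<close>

lemma card_large_smooth_part_le:
  fixes y \<eta> :: real
  assumes "y > 0" "0 < \<eta>" "(\<lambda>n. real n powr (\<eta> - 1)) summable_on smooth (primes_upto Z)"
  shows "real (card {m\<in>{1..X}. y < real (smooth_part Z m)})
    \<le> real X * y powr (-\<eta>) * infsum (\<lambda>n. real n powr (\<eta> - 1)) (smooth (primes_upto Z))"
proof -
  define A where "A = {a\<in>{1..X}. a \<in> smooth (primes_upto Z) \<and> y < real a}"
  have finA: "finite A" by (simp add: A_def)
  have "{m\<in>{1..X}. y < real (smooth_part Z m)} \<subseteq> (\<Union>a\<in>A. {m\<in>{1..X}. a dvd m})"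
  proof
    fix m assume m: "m \<in> {m\<in>{1..X}. y < real (smooth_part Z m)}"
    hence m0: "m > 0" by simp
    obtain b where b: "m = smooth_part Z m * b" "smooth_part Z m > 0" "b > 0"
      "\<And>q. prime q \<Longrightarrow> q dvd smooth_part Z m \<Longrightarrow> q \<le> Z" by (rule smooth_partE[OF m0, of Z]) blast
    have d: "smooth_part Z m dvd m" by (metis b(1) dvd_triv_left)
    hence "smooth_part Z m \<le> X" using m m0 dvd_imp_le[OF d m0] by simp
    hence "smooth_part Z m \<in> A" using m b by (auto simp: A_def smooth_def primes_upto_def prime_factors_dvd)
    thus "m \<in> (\<Union>a\<in>A. {m\<in>{1..X}. a dvd m})" using m d by blast
  qed
  hence "card {m\<in>{1..X}. y < real (smooth_part Z m)} \<le> card (\<Union>a\<in>A. {m\<in>{1..X}. a dvd m})"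
    by (intro card_mono) (use finA in auto)
  also have "\<dots> \<le> (\<Sum>a\<in>A. card {m\<in>{1..X}. a dvd m})" by (rule card_UN_le[OF finA])
  finally have "real (card {m\<in>{1..X}. y < real (smooth_part Z m)}) \<le> real (\<Sum>a\<in>A. card {m\<in>{1..X}. a dvd m})"
    by (simp only: of_nat_le_iff)
  also have "\<dots> = (\<Sum>a\<in>A. real (card {m\<in>{1..X}. a dvd m}))" by (rule of_nat_sum)
  also have "\<dots> \<le> (\<Sum>a\<in>A. real X * y powr (-\<eta>) * real a powr (\<eta> - 1))"
  proof (rule sum_mono)
    fix a assume a: "a \<in> A"
    hence a0: "a > 0" "y < real a" by (auto simp: A_def)
    have "real (card {m\<in>{1..X}. a dvd m}) \<le> real X / real a * 1" using card_multiples_le[OF a0(1), of X] by simp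
    also have "\<dots> \<le> real X / real a * (real a / y) powr \<eta>"
      using a0 assms by (intro mult_left_mono ge_one_powr_ge_zero) auto
    also have "\<dots> = real X * y powr (-\<eta>) * real a powr (\<eta> - 1)"
      using a0 assms by (simp add: powr_divide powr_diff powr_minus field_simps)
    finally show "real (card {m\<in>{1..X}. a dvd m}) \<le> real X * y powr (-\<eta>) * real a powr (\<eta> - 1)" .
  qed
  also have "\<dots> = real X * y powr (-\<eta>) * (\<Sum>a\<in>A. real a powr (\<eta> - 1))" by (simp add: sum_distrib_left)
  also have "\<dots> \<le> real X * y powr (-\<eta>) * infsum (\<lambda>n. real n powr (\<eta> - 1)) (smooth (primes_upto Z))"
    by (intro mult_left_mono finite_sum_le_infsum assms finA) (auto simp: A_def)
  finally show ?thesis .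
qed

section \<open>The correlation sum over primes\<close>

definition prime_range :: "real \<Rightarrow> nat set" where
  "prime_range x = {p. prime p \<and> 3 \<le> p \<and> real p \<le> x}"

lemma finite_prime_range [simp, intro]: "finite (prime_range x)"
proof (rule finite_subset)
  show "prime_range x \<subseteq> {..nat \<lfloor>x\<rfloor>}" by (auto simp: prime_range_def le_nat_floor)
qed simp

definition corr_sum :: "nat \<Rightarrow> nat \<Rightarrow> real \<Rightarrow> real" where
  "corr_sum M N x = (\<Sum>p\<in>prime_range x. \<bar>hecke M (p + 2)\<bar> * \<bar>hecke N (p - 2)\<bar>)"

text \<open>Two demands meet here: a number up to x^2 has at most (log log x)/10 prime factors above
  this bound, and the bound is small enough that a smooth part beyond x^(1/4) is rare.\<close>

definition smooth_z :: "real \<Rightarrow> nat" where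
  "smooth_z x = nat \<lfloor>exp (20 * ln x / ln (ln x))\<rfloor>"

text \<open>The condition \<open>sieve_z x < real p\<close> keeps \<open>p\<close> itself from being
  sieved out; the bounds x^(1/4) are those under which the sieve estimate holds.\<close>

definition good_primes :: "real \<Rightarrow> nat set" where
  "good_primes x = {p\<in>prime_range x. sieve_z x < real p \<and>
     real (smooth_part (smooth_z x) (p + 2)) \<le> x powr (1/4) \<and>
     real (smooth_part (smooth_z x) (p - 2)) \<le> x powr (1/4)}"

text \<open>The rough part contributes at most 2^((log log x)/10). The range up to x^2 is chosen to
  cover \<open>p + 2\<close>.\<close>

lemma rough_bound:
  assumes "even M" "n > 0" "real n \<le> x ^ 2" "x > 1" "ln x \<ge> 1" "ln (ln x) \<ge> 1"
  shows "\<bar>hecke M n\<bar> \<le> \<bar>hecke M (smooth_part (smooth_z x) n)\<bar> * ln x powr (1/10)"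
proof -
  define z where "z = exp (20 * ln x / ln (ln x))"
  have "20 * ln x / ln (ln x) > 0"
    by (rule divide_pos_pos) (use assms(5,6) in linarith)+
  hence z: "z > 1" by (simp add: z_def)
  obtain b where b: "n = smooth_part (smooth_z x) n * b" "smooth_part (smooth_z x) n > 0" "b > 0"
     "coprime (smooth_part (smooth_z x) n) b" "\<And>q. prime q \<Longrightarrow> q dvd b \<Longrightarrow> smooth_z x < q"
    by (rule smooth_partE[OF assms(2), of "smooth_z x"]) blast
  have "\<bar>hecke M b\<bar> \<le> real b powr (ln 2 / ln z)"
  proof (rule hecke_rough_le[OF assms(1) b(3) z])
    fix q assume "prime q" "q dvd b"
    hence "smooth_z x < q" using b(5) by blast
    thus "z \<le> real q" unfolding smooth_z_def z_def[symmetric] by linarith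
  qed
  also have "\<dots> \<le> (x ^ 2) powr (ln 2 / ln z)"
  proof (rule powr_mono2)
    have "b dvd n" by (metis b(1) dvd_triv_right)
    hence "real b \<le> real n" using assms(2) by (simp add: dvd_imp_le)
    thus "real b \<le> x ^ 2" using assms(3) by linarith
    show "0 \<le> ln 2 / ln z" using z by simp
  qed simp
  also have "\<dots> = exp (ln 2 * ln (ln x) / 10)"
    using assms by (simp add: powr_def ln_realpow z_def field_simps)
  also have "\<dots> \<le> exp (1 * ln (ln x) / 10)"
    using assms ln_2_less_1 by (subst exp_le_cancel_iff) (intro divide_right_mono mult_right_mono, auto)
  also have "\<dots> = ln x powr (1/10)" using assms by (simp add: powr_def)
  finally have "\<bar>hecke M b\<bar> \<le> ln x powr (1/10)" .
  hence "\<bar>hecke M (smooth_part (smooth_z x) n)\<bar> * \<bar>hecke M b\<bar>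
      \<le> \<bar>hecke M (smooth_part (smooth_z x) n)\<bar> * ln x powr (1/10)" by (intro mult_left_mono) auto
  moreover have "hecke M n = hecke M (smooth_part (smooth_z x) n) * hecke M b"
    by (subst b(1)) (rule hecke_mult[OF b(2-4)])
  ultimately show ?thesis by (simp add: abs_mult)
qed

text \<open>A common divisor divides the difference 4 of the shifts and the odd number
  \<open>p + 2\<close>.\<close>

lemma odd_shift_coprime:
  fixes p a b :: nat
  assumes "odd p" "p \<ge> 3" "a dvd p + 2" "b dvd p - 2"
  shows "coprime a b"
proof (rule coprimeI)
  fix c assume c: "c dvd a" "c dvd b"
  have c1: "c dvd p + 2" "c dvd p - 2" using c assms dvd_trans by blast+
  hence "c dvd (p + 2) - (p - 2)" by (rule dvd_diff_nat)
  moreover have "(p + 2) - (p - 2) = 2 * 2" using assms(2) by simp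
  ultimately have c4: "c dvd 2 * 2" by simp
  have "coprime 2 (p + 2)" using assms(1) by simp
  hence "coprime (2 * 2) (p + 2)" by (simp only: coprime_mult_left_iff)
  thus "is_unit c" using c4 c1(1) coprime_common_divisor by blast
qed

lemma good_in_sieve_set:
  assumes "p \<in> good_primes x" "x > 1" "ln x \<ge> 1" "ln (ln x) \<ge> 1"
    "a = smooth_part (smooth_z x) (p + 2)" "b = smooth_part (smooth_z x) (p - 2)"
  shows "p \<in> sieve_set x a b" "coprime a b" "a > 0" "b > 0"
proof -
  have p: "prime p" "3 \<le> p" "real p \<le> x" "sieve_z x < real p"
    using assms(1) by (auto simp: good_primes_def prime_range_def)
  have pos: "p + 2 > 0" "p - 2 > 0" using p by auto
  obtain b1 where b1: "p + 2 = a * b1" "a > 0" "\<And>q. prime q \<Longrightarrow> q dvd b1 \<Longrightarrow> smooth_z x < q"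
    unfolding assms(5) by (rule smooth_partE[OF pos(1), of "smooth_z x"]) blast
  obtain b2 where b2: "p - 2 = b * b2" "b > 0" "\<And>q. prime q \<Longrightarrow> q dvd b2 \<Longrightarrow> smooth_z x < q"
    unfolding assms(6) by (rule smooth_partE[OF pos(2), of "smooth_z x"]) blast
  show "a > 0" "b > 0" using b1(2) b2(2) .
  have odd: "odd p" using p prime_odd_nat by auto
  have dv: "a dvd p + 2" "b dvd p - 2" using b1(1) b2(1) by auto
  show "coprime a b" by (rule odd_shift_coprime[OF odd p(2) dv])
  \<comment> \<open>Since the sieving range ends below the smoothness bound, a small prime not
    dividing the smooth parts cannot divide the shifted numbers at all.\<close>
  have zz: "sieve_z x \<le> exp (20 * ln x / ln (ln x))"
  proof -
    have "0 \<le> ln x / ln (ln x)" using assms(3,4) by simp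
    moreover have "ln x / (216 * ln (ln x)) = (ln x / ln (ln x)) / 216" by simp
    moreover have "20 * ln x / ln (ln x) = 20 * (ln x / ln (ln x))" by simp
    ultimately show ?thesis unfolding sieve_z_def exp_le_cancel_iff by linarith
  qed
  have rough: "\<not> q dvd c" if "prime q" "real q \<le> sieve_z x" "\<And>q. prime q \<Longrightarrow> q dvd c \<Longrightarrow> smooth_z x < q" for q c
  proof
    assume "q dvd c"
    hence "smooth_z x < q" using that by blast
    hence "exp (20 * ln x / ln (ln x)) < real q" unfolding smooth_z_def by linarith
    thus False using that(2) zz by linarith
  qed
  have "\<not> q dvd p \<and> \<not> q dvd p + 2 \<and> \<not> q dvd p - 2"
    if q: "prime q" "5 \<le> q" "real q \<le> sieve_z x" "\<not> q dvd a * b" for q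
  proof (intro conjI)
    show "\<not> q dvd p" using p q primes_dvd_imp_eq[of q p] by auto
    show "\<not> q dvd p + 2" unfolding b1(1) using rough[OF q(1,3) b1(3)] q(1,4)
      by (auto simp: prime_dvd_mult_iff)
    show "\<not> q dvd p - 2" unfolding b2(1) using rough[OF q(1,3) b2(3)] q(1,4)
      by (auto simp: prime_dvd_mult_iff)
  qed
  moreover have "p \<in> {3..nat \<lfloor>x\<rfloor>}" using p by (simp add: le_nat_floor)
  ultimately show "p \<in> sieve_set x a b" unfolding sieve_set_def using dv by blast
qed

lemma finite_sieve_set [simp]: "finite (sieve_set x a b)"
  by (rule finite_subset[of _ "{3..nat \<lfloor>x\<rfloor>}"]) (auto simp: sieve_set_def)

section \<open>Contribution of the good primes\<close>

text \<open>The primes are grouped by the pair of smooth parts. Each fibre lies in one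
  \<open>sieve_set\<close>, whose bound separates in \<open>a\<close> and \<open>b\<close>, so the
  double sum becomes a product. The exponent 1/5 collects the two rough parts.\<close>

lemma good_sum_le:
  assumes "even M" "even N"
  shows "\<exists>C>0. \<forall>\<^sub>F x in at_top. (\<Sum>p\<in>good_primes x. \<bar>hecke M (p + 2)\<bar> * \<bar>hecke N (p - 2)\<bar>)
     \<le> C * (x * (ln (ln x) / ln x) ^ 3 * ln x powr (1/5) * ln x powr (log_exponent M + log_exponent N))"
proof -
  obtain C0 where C0: "C0 > 0" "\<forall>\<^sub>F x in at_top. \<forall>a b. a > 0 \<longrightarrow> b > 0 \<longrightarrow> coprime a b \<longrightarrow>
     real a \<le> x powr (1/4) \<longrightarrow> real b \<le> x powr (1/4) \<longrightarrow>
     real (card (sieve_set x a b)) \<le> C0 * x * (ln (ln x) / ln x) ^ 3 * (sieve_weight a / real a) * (sieve_weight b / real b)"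
    using card_sieve_set_le by blast
  obtain C1 where C1: "C1 > 0" "\<And>K. K \<ge> 3 \<Longrightarrow> (\<Sum>n=1..K. \<bar>hecke M n\<bar> * sieve_weight n / real n) \<le> C1 * ln (real K) powr log_exponent M"
    using hecke_hfac_sum_le[OF assms(1)] by blast
  obtain C2 where C2: "C2 > 0" "\<And>K. K \<ge> 3 \<Longrightarrow> (\<Sum>n=1..K. \<bar>hecke N n\<bar> * sieve_weight n / real n) \<le> C2 * ln (real K) powr log_exponent N"
    using hecke_hfac_sum_le[OF assms(2)] by blast
  have ev: "\<forall>\<^sub>F x in at_top. x > (1::real) \<and> ln x \<ge> 1 \<and> ln (ln x) \<ge> 1 \<and> x powr (1/4) \<ge> 4 \<and> x + 2 \<le> x ^ 2"
    by (intro eventually_conj; real_asymp)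
  have "\<forall>\<^sub>F x in at_top. (\<Sum>p\<in>good_primes x. \<bar>hecke M (p + 2)\<bar> * \<bar>hecke N (p - 2)\<bar>)
     \<le> (C0 * C1 * C2) * (x * (ln (ln x) / ln x) ^ 3 * ln x powr (1/5) * ln x powr (log_exponent M + log_exponent N))"
    using C0(2) ev
  proof eventually_elim
    case (elim x)
    define L where "L = ln x"
    have x: "x > 1" "ln x \<ge> 1" "ln (ln x) \<ge> 1" "x powr (1/4) \<ge> 4" "x + 2 \<le> x ^ 2" using elim by auto
    define Y where "Y = nat \<lfloor>x powr (1/4)\<rfloor>"
    have Y: "Y \<ge> 3" "real Y \<le> x powr (1/4)" using x(4) unfolding Y_def by linarith+
    let ?G = "good_primes x"
    let ?a = "\<lambda>p. smooth_part (smooth_z x) (p + 2)" and ?b = "\<lambda>p. smooth_part (smooth_z x) (p - 2)"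
    have finG: "finite ?G" by (rule finite_subset[of _ "prime_range x"]) (auto simp: good_primes_def)
    define E where "E = C0 * x * (ln (ln x) / ln x) ^ 3"
    have E0: "E \<ge> 0" using C0 x by (simp add: E_def)
    have inY: "(?a p, ?b p) \<in> {1..Y} \<times> {1..Y}" if p: "p \<in> ?G" for p
    proof -
      have "?a p > 0" "?b p > 0" using good_in_sieve_set[OF p x(1-3) refl refl] by auto
      moreover have "?a p \<le> Y" "?b p \<le> Y"
        using p unfolding Y_def by (auto simp: good_primes_def intro: le_nat_floor)
      ultimately show ?thesis by simp
    qed
    have "(\<Sum>p\<in>?G. \<bar>hecke M (p + 2)\<bar> * \<bar>hecke N (p - 2)\<bar>)
        \<le> (\<Sum>p\<in>?G. L powr (1/5) * (\<bar>hecke M (?a p)\<bar> * \<bar>hecke N (?b p)\<bar>))"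
    proof (rule sum_mono)
      fix p assume p: "p \<in> ?G"
      hence pr: "3 \<le> p" "real p \<le> x" by (auto simp: good_primes_def prime_range_def)
      have "real (p + 2) \<le> x ^ 2" "real (p - 2) \<le> x ^ 2" using pr x(5) by auto
      hence "\<bar>hecke M (p + 2)\<bar> * \<bar>hecke N (p - 2)\<bar>
          \<le> (\<bar>hecke M (?a p)\<bar> * L powr (1/10)) * (\<bar>hecke N (?b p)\<bar> * L powr (1/10))"
        unfolding L_def using pr x assms by (intro mult_mono rough_bound) auto
      also have "\<dots> = (L powr (1/10) * L powr (1/10)) * (\<bar>hecke M (?a p)\<bar> * \<bar>hecke N (?b p)\<bar>)" by simp
      also have "L powr (1/10) * L powr (1/10) = L powr (1/5)" by (simp flip: powr_add)
      finally show "\<bar>hecke M (p + 2)\<bar> * \<bar>hecke N (p - 2)\<bar> \<le> L powr (1/5) * (\<bar>hecke M (?a p)\<bar> * \<bar>hecke N (?b p)\<bar>)" .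
    qed
    also have "\<dots> = L powr (1/5) * (\<Sum>p\<in>?G. \<bar>hecke M (?a p)\<bar> * \<bar>hecke N (?b p)\<bar>)" by (simp add: sum_distrib_left)
    also have "(\<Sum>p\<in>?G. \<bar>hecke M (?a p)\<bar> * \<bar>hecke N (?b p)\<bar>)
        = (\<Sum>ab\<in>{1..Y} \<times> {1..Y}. \<Sum>p\<in>{p\<in>?G. (?a p, ?b p) = ab}. \<bar>hecke M (?a p)\<bar> * \<bar>hecke N (?b p)\<bar>)"
      by (rule sum.group[symmetric, OF finG]) (use inY in auto)
    also have "\<dots> \<le> (\<Sum>ab\<in>{1..Y} \<times> {1..Y}. E * ((\<bar>hecke M (fst ab)\<bar> * sieve_weight (fst ab) / real (fst ab))
          * (\<bar>hecke N (snd ab)\<bar> * sieve_weight (snd ab) / real (snd ab))))"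
    proof (rule sum_mono)
      fix ab assume ab: "ab \<in> {1..Y} \<times> {1..Y}"
      obtain a b where [simp]: "ab = (a, b)" by (cases ab)
      let ?S = "{p\<in>?G. (?a p, ?b p) = ab}"
      have "(\<Sum>p\<in>?S. \<bar>hecke M (?a p)\<bar> * \<bar>hecke N (?b p)\<bar>) = (\<Sum>p\<in>?S. \<bar>hecke M a\<bar> * \<bar>hecke N b\<bar>)"
        by (rule sum.cong) auto
      also have "\<dots> = real (card ?S) * (\<bar>hecke M a\<bar> * \<bar>hecke N b\<bar>)" by simp
      also have "real (card ?S) \<le> E * (sieve_weight a / real a) * (sieve_weight b / real b)"
      \<comment> \<open>Coprimality of \<open>a\<close> and \<open>b\<close> is known only for pairs
        coming from an actual prime; for all other pairs the fibre is empty.\<close>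
      proof (cases "?S = {}")
        case True
        thus ?thesis using E0 hfac_pos[of a] hfac_pos[of b] by (simp only: card.empty) auto
      next
        case False
        then obtain p0 where p0: "p0 \<in> ?G" "a = ?a p0" "b = ?b p0" by auto
        note c = good_in_sieve_set[OF p0(1) x(1-3) p0(2,3)]
        have "?S \<subseteq> sieve_set x a b" using good_in_sieve_set[OF _ x(1-3) refl refl] by auto
        hence "card ?S \<le> card (sieve_set x a b)" by (rule card_mono[rotated]) simp
        moreover have "real a \<le> x powr (1/4)" "real b \<le> x powr (1/4)" using p0 by (auto simp: good_primes_def)
        hence "real (card (sieve_set x a b)) \<le> E * (sieve_weight a / real a) * (sieve_weight b / real b)"
          unfolding E_def using elim(1) c by blast
        ultimately show ?thesis by (meson of_nat_mono order_trans)
      qed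
      hence "real (card ?S) * (\<bar>hecke M a\<bar> * \<bar>hecke N b\<bar>) \<le> E * (sieve_weight a / real a) * (sieve_weight b / real b) * (\<bar>hecke M a\<bar> * \<bar>hecke N b\<bar>)"
        by (intro mult_right_mono) auto
      finally show "(\<Sum>p\<in>?S. \<bar>hecke M (?a p)\<bar> * \<bar>hecke N (?b p)\<bar>) \<le>
         E * ((\<bar>hecke M (fst ab)\<bar> * sieve_weight (fst ab) / real (fst ab)) * (\<bar>hecke N (snd ab)\<bar> * sieve_weight (snd ab) / real (snd ab)))"
        by (simp add: mult_ac)
    qed
    also have "\<dots> = E * ((\<Sum>a=1..Y. \<bar>hecke M a\<bar> * sieve_weight a / real a) * (\<Sum>b=1..Y. \<bar>hecke N b\<bar> * sieve_weight b / real b))"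
      by (subst sum_product, subst sum.cartesian_product, subst sum_distrib_left) (simp only: case_prod_unfold)
    also have "\<dots> \<le> E * ((C1 * L powr log_exponent M) * (C2 * L powr log_exponent N))"
    proof (intro mult_left_mono mult_mono E0)
      have "real Y \<le> x powr 1" using Y(2) x(1) powr_mono[of "1/4" 1 x] by linarith
      hence lY: "0 \<le> ln (real Y)" "ln (real Y) \<le> L" unfolding L_def using Y x(1) by auto
      have log_exponent: "log_exponent M \<ge> 0" "log_exponent N \<ge> 0" by (auto simp: log_exponent_def)
      show "(\<Sum>a=1..Y. \<bar>hecke M a\<bar> * sieve_weight a / real a) \<le> C1 * L powr log_exponent M"
        by (rule order_trans[OF C1(2)[OF Y(1)] mult_left_mono[OF powr_mono2]]) (use lY log_exponent C1 in auto)
      show "(\<Sum>b=1..Y. \<bar>hecke N b\<bar> * sieve_weight b / real b) \<le> C2 * L powr log_exponent N"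
        by (rule order_trans[OF C2(2)[OF Y(1)] mult_left_mono[OF powr_mono2]]) (use lY log_exponent C2 in auto)
      show "0 \<le> C1 * L powr log_exponent M" using C1 by simp
      show "0 \<le> (\<Sum>b=1..Y. \<bar>hecke N b\<bar> * sieve_weight b / real b)"
        by (intro sum_nonneg divide_nonneg_nonneg mult_nonneg_nonneg) (use hfac_pos less_imp_le in auto)
    qed
    finally have "(\<Sum>p\<in>?G. \<bar>hecke M (p + 2)\<bar> * \<bar>hecke N (p - 2)\<bar>)
        \<le> L powr (1/5) * (E * ((C1 * L powr log_exponent M) * (C2 * L powr log_exponent N)))" by (simp add: mult_left_mono)
    also have "\<dots> = (C0 * C1 * C2) * (x * (ln (ln x) / ln x) ^ 3 * L powr (1/5) * L powr (log_exponent M + log_exponent N))"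
      unfolding E_def powr_add by (simp add: mult_ac)
    finally show ?case by (simp add: L_def)
  qed
  thus ?thesis using C0(1) C1(1) C2(1) by (intro exI[of _ "C0 * C1 * C2"]) auto
qed

section \<open>Contribution of the exceptional primes\<close>

text \<open>Above the threshold, uv \<le> (uv)^2/V. Summed over a sparse set, \<open>V\<close> is
  paid for by rarity and the quotient by fourth moments.\<close>

lemma prod_le_threshold:
  fixes u v V :: real assumes "V > 0" "u \<ge> 0" "v \<ge> 0"
  shows "u * v \<le> V + (u ^ 4 + v ^ 4) / V"
proof (cases "u * v \<le> V")
  case True
  thus ?thesis using assms by (simp add: add_increasing2)
next
  case False
  have "(u * v) * V \<le> (u * v) * (u * v)" using False assms by (intro mult_left_mono) auto
  also have "\<dots> = u^2 * v^2" by (simp add: power2_eq_square mult_ac)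
  also have "\<dots> \<le> u ^ 4 + v ^ 4"
  proof -
    have "0 \<le> (u^2 - v^2)^2" by simp
    hence "2 * (u^2 * v^2) \<le> u ^ 4 + v ^ 4" by (simp add: power2_eq_square power4_eq_xxxx algebra_simps)
    moreover have "0 \<le> u^2 * v^2" by simp
    ultimately show ?thesis by linarith
  qed
  finally have "u * v \<le> (u ^ 4 + v ^ 4) / V" using assms by (simp add: field_simps)
  thus ?thesis using assms by linarith
qed

text \<open>With \<eta> = 240 log log x / log x the saving x^(-\<eta>/4) is (log x)^(-60), of which
  Rankin's sum takes back less than three powers. Then \<eta> times the logarithm of the smoothness
  bound is 240 * 20 = 4800.\<close>

lemma bad_card_le:
  "\<exists>C>0. \<forall>\<^sub>F x in at_top. real (card (prime_range x - good_primes x)) \<le> sieve_z x + C * x * ln x powr (-57)"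
proof -
  define K :: real where "K = 4800"
  obtain C where C: "C > 0" "\<And>Z \<eta>. Z \<ge> 2 \<Longrightarrow> 0 < \<eta> \<Longrightarrow> \<eta> \<le> 1/4 \<Longrightarrow> \<eta> * ln (real Z) \<le> K \<Longrightarrow>
     (\<lambda>n. real n powr (\<eta> - 1)) summable_on smooth (primes_upto Z) \<and>
     infsum (\<lambda>n. real n powr (\<eta> - 1)) (smooth (primes_upto Z)) \<le> C * (1 + ln (real Z)) powr exp 1"
    using rankin_smooth[of K] unfolding K_def by auto
  have ev: "\<forall>\<^sub>F x in at_top. x > (2::real) \<and> ln x \<ge> 1 \<and> ln (ln x) \<ge> 1 \<and> 20 * ln x / ln (ln x) \<ge> 1
      \<and> 1 + 20 * ln x / ln (ln x) \<le> ln x \<and> 4800 * ln (ln x) / (20 * ln x) \<le> 1/4"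
    by (intro eventually_conj; real_asymp)
  have "\<forall>\<^sub>F x in at_top. real (card (prime_range x - good_primes x)) \<le> sieve_z x + (4 * C) * x * ln x powr (-57)"
    using ev
  proof eventually_elim
    case (elim x)
    define L where "L = ln x"
    define l where "l = ln L"
    define w where "w = 20 * L / l"
    define Z where "Z = smooth_z x"
    define y where "y = x powr (1/4)"
    define \<eta> where "\<eta> = K * l / (20 * L)"
    have x: "x > 2" "L \<ge> 1" "l \<ge> 1" "w \<ge> 1" "1 + w \<le> L" "\<eta> \<le> 1/4"
      using elim by (auto simp: L_def l_def w_def \<eta>_def K_def)
    have eta0: "\<eta> > 0" using x(2,3) by (simp add: \<eta>_def K_def)
    have "exp w \<ge> 2" using exp_ge_add_one_self[of w] x(4) by linarith
    moreover have Zw: "Z = nat \<lfloor>exp w\<rfloor>" by (simp add: Z_def smooth_z_def w_def L_def l_def)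
    ultimately have Z: "Z \<ge> 2" "real Z \<le> exp w" by linarith+
    have "ln (real Z) \<le> ln (exp w)" using Z by (subst ln_le_cancel_iff) auto
    hence lZ: "ln (real Z) \<le> w" by simp
    have "\<eta> * ln (real Z) \<le> \<eta> * w" using eta0 lZ by (intro mult_left_mono) auto
    also have "\<eta> * w = K" using x(2,3) by (simp add: \<eta>_def w_def)
    finally have etaK: "\<eta> * ln (real Z) \<le> K" .
    define I where "I = infsum (\<lambda>n. real n powr (\<eta> - 1)) (smooth (primes_upto Z))"
    note R = C(2)[OF Z(1) eta0 x(6) etaK]
    have I: "I \<le> C * L powr 3"
    proof -
      have "I \<le> C * (1 + ln (real Z)) powr exp 1" using R by (simp add: I_def)
      also have "\<dots> \<le> C * L powr exp 1"
        using C(1) lZ x(5) Z(1) by (intro mult_left_mono powr_mono2) auto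
      also have "\<dots> \<le> C * L powr 3" using C(1) x(2) exp_le by (intro mult_left_mono powr_mono) auto
      finally show ?thesis .
    qed
    have yL: "y powr (-\<eta>) = L powr (-60)"
    proof -
      have "y powr (-\<eta>) = exp (- \<eta> * (L / 4))" using x(1) by (simp add: y_def L_def powr_def)
      also have "- \<eta> * (L / 4) = -60 * l" using x(2) by (simp add: \<eta>_def K_def)
      also have "exp (-60 * l) = L powr (-60)" using x(2) by (simp add: l_def powr_def)
      finally show ?thesis .
    qed
    define X where "X = nat \<lfloor>x\<rfloor> + 2"
    have X: "real X \<le> 2 * x" using x(1) unfolding X_def by linarith
    let ?W = "{m\<in>{1..X}. y < real (smooth_part Z m)}"
    have W: "real (card ?W) \<le> 2 * C * x * L powr (-57)"
    proof -
      have "real (card ?W) \<le> real X * y powr (-\<eta>) * I"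
        unfolding I_def by (rule card_large_smooth_part_le) (use x(1) eta0 R in \<open>auto simp: y_def\<close>)
      also have "\<dots> \<le> real X * y powr (-\<eta>) * (C * L powr 3)" by (intro mult_left_mono I) auto
      also have "\<dots> \<le> (2 * x) * L powr (-60) * (C * L powr 3)"
        unfolding yL using X C(1) by (intro mult_right_mono) auto
      also have "\<dots> = 2 * C * x * (L powr (-60) * L powr 3)" by simp
      also have "L powr (-60) * L powr 3 = L powr (-57)" by (simp flip: powr_add)
      finally show ?thesis .
    qed
    let ?S1 = "{1..nat \<lfloor>sieve_z x\<rfloor>}" and ?S2 = "(\<lambda>m. m - 2) ` ?W" and ?S3 = "(\<lambda>m. m + 2) ` ?W"
    have sub: "prime_range x - good_primes x \<subseteq> ?S1 \<union> ?S2 \<union> ?S3"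
    proof
      fix p assume "p \<in> prime_range x - good_primes x"
      hence p: "prime p" "3 \<le> p" "real p \<le> x"
        "real p \<le> sieve_z x \<or> y < real (smooth_part Z (p + 2)) \<or> y < real (smooth_part Z (p - 2))"
        unfolding y_def Z_def by (auto simp: prime_range_def good_primes_def not_less not_le)
      have pX: "p + 2 \<le> X" using p(3) by (simp add: X_def le_nat_floor)
      from p(4) show "p \<in> ?S1 \<union> ?S2 \<union> ?S3"
      proof (elim disjE)
        assume "real p \<le> sieve_z x"
        thus ?thesis using p(2) by (simp add: le_nat_floor)
      next
        assume "y < real (smooth_part Z (p + 2))"
        hence "p + 2 \<in> ?W" using pX by simp
        moreover have "p = (p + 2) - 2" by simp
        ultimately show ?thesis by blast
      next
        assume "y < real (smooth_part Z (p - 2))"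
        moreover have "1 \<le> p - 2" "p - 2 \<le> X" using pX p(2) by linarith+
        ultimately have "p - 2 \<in> ?W" by simp
        moreover have "p = (p - 2) + 2" using p(2) by simp
        ultimately show ?thesis by blast
      qed
    qed
    have "card (prime_range x - good_primes x) \<le> card (?S1 \<union> ?S2 \<union> ?S3)"
      by (rule card_mono[OF _ sub]) auto
    also have "\<dots> \<le> card ?S1 + card ?S2 + card ?S3"
      by (rule order_trans[OF card_Un_le add_right_mono[OF card_Un_le]])
    also have "\<dots> \<le> card ?S1 + card ?W + card ?W"
      by (intro add_mono card_image_le order_refl) auto
    finally have "real (card (prime_range x - good_primes x)) \<le> real (card ?S1) + real (card ?W) + real (card ?W)"
      by (simp only: of_nat_add[symmetric] of_nat_le_iff)
    also have "real (card ?S1) \<le> sieve_z x" by (simp add: sieve_z_def)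
    finally show ?case using W by (simp add: L_def)
  qed
  thus ?thesis using C(1) by (intro exI[of _ "4 * C"]) auto
qed

text \<open>The exponent 44 exceeds 16e, as e < 2.72.\<close>

lemma fourth_moment_le:
  assumes "even M"
  shows "\<exists>C>0. \<forall>\<^sub>F x in at_top. (\<Sum>n=1..nat \<lfloor>x\<rfloor> + 2. hecke M n ^ 4) \<le> C * x * ln x powr 44"
proof -
  obtain C where C: "C > 0" "\<And>N. N \<ge> 3 \<Longrightarrow> (\<Sum>n=1..N. hecke M n ^ 4) \<le> C * real N * (1 + ln (real N)) powr (16 * exp 1)"
    using hecke_fourth_moment_le[OF assms] by blast
  have ev: "\<forall>\<^sub>F x in at_top. x > (2::real) \<and> ln x \<ge> 1 \<and> 1 + ln (2 * x) \<le> 2 * ln x"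
    by (intro eventually_conj; real_asymp)
  have "\<forall>\<^sub>F x in at_top. (\<Sum>n=1..nat \<lfloor>x\<rfloor> + 2. hecke M n ^ 4) \<le> (C * 2 * 2 powr 44) * x * ln x powr 44"
    using ev
  proof eventually_elim
    case (elim x)
    define X where "X = nat \<lfloor>x\<rfloor> + 2"
    have X: "real X \<le> 2 * x" "X \<ge> 3" using elim unfolding X_def by linarith+
    have "ln (real X) \<le> ln (2 * x)" using X elim by (subst ln_le_cancel_iff) auto
    hence 1: "1 + ln (real X) \<le> 2 * ln x" using elim by linarith
    have 0: "0 \<le> ln (real X)" using X by simp
    have "(\<Sum>n=1..X. hecke M n ^ 4) \<le> C * real X * (1 + ln (real X)) powr (16 * exp 1)" by (rule C(2)[OF X(2)])
    also have "\<dots> \<le> C * (2 * x) * (2 * ln x) powr 44"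
    proof (intro mult_mono order_refl)
      show "real X \<le> 2 * x" by (rule X)
      have "(1 + ln (real X)) powr (16 * exp 1) \<le> (1 + ln (real X)) powr 44"
        using 0 e_less_272 by (intro powr_mono) auto
      also have "\<dots> \<le> (2 * ln x) powr 44" using 0 1 by (intro powr_mono2) auto
      finally show "(1 + ln (real X)) powr (16 * exp 1) \<le> (2 * ln x) powr 44" .
    qed (use C(1) elim in auto)
    also have "\<dots> = (C * 2 * 2 powr 44) * x * ln x powr 44"
      using elim by (simp add: powr_mult)
    finally show ?case by (simp add: X_def)
  qed
  thus ?thesis using C(1) by (intro exI[of _ "C * 2 * 2 powr 44"]) auto
qed

lemma bad_sum_le:
  assumes "even M" "even N"
  shows "\<exists>C>0. \<forall>\<^sub>F x in at_top. (\<Sum>p\<in>prime_range x - good_primes x. \<bar>hecke M (p + 2)\<bar> * \<bar>hecke N (p - 2)\<bar>)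
     \<le> ln x powr 50 * sieve_z x + C * x * ln x powr (-6)"
proof -
  obtain C1 where C1: "C1 > 0" "\<forall>\<^sub>F x in at_top. real (card (prime_range x - good_primes x)) \<le> sieve_z x + C1 * x * ln x powr (-57)"
    using bad_card_le by blast
  obtain C2 where C2: "C2 > 0" "\<forall>\<^sub>F x in at_top. (\<Sum>n=1..nat \<lfloor>x\<rfloor> + 2. hecke M n ^ 4) \<le> C2 * x * ln x powr 44"
    using fourth_moment_le[OF assms(1)] by blast
  obtain C3 where C3: "C3 > 0" "\<forall>\<^sub>F x in at_top. (\<Sum>n=1..nat \<lfloor>x\<rfloor> + 2. hecke N n ^ 4) \<le> C3 * x * ln x powr 44"
    using fourth_moment_le[OF assms(2)] by blast
  have ev: "\<forall>\<^sub>F x in at_top. x > (2::real) \<and> ln x \<ge> 1" by (intro eventually_conj; real_asymp)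
  have "\<forall>\<^sub>F x in at_top. (\<Sum>p\<in>prime_range x - good_primes x. \<bar>hecke M (p + 2)\<bar> * \<bar>hecke N (p - 2)\<bar>)
     \<le> ln x powr 50 * sieve_z x + (C1 + C2 + C3) * x * ln x powr (-6)"
    using C1(2) C2(2) C3(2) ev
  proof eventually_elim
    case (elim x)
    define L where "L = ln x"
    have L: "L \<ge> 1" "x > 2" using elim by (auto simp: L_def)
    \<comment> \<open>Any exponent well between the moment's 44 and the rarity's 57 would serve; 50
      leaves L^(-7) and L^(-6).\<close>
    define V where "V = L powr 50"
    have V: "V > 0" using L by (simp add: V_def)
    define X where "X = nat \<lfloor>x\<rfloor> + 2"
    let ?B = "prime_range x - good_primes x"
    have finB: "finite ?B" by simp
    have pB: "3 \<le> p \<and> p + 2 \<le> X" if "p \<in> ?B" for p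
      using that by (auto simp: prime_range_def X_def le_nat_floor)
    have s1: "(\<Sum>p\<in>?B. \<bar>hecke M (p + 2)\<bar> ^ 4) \<le> (\<Sum>n=1..X. hecke M n ^ 4)"
    proof -
      have "(\<Sum>p\<in>?B. \<bar>hecke M (p + 2)\<bar> ^ 4) = (\<Sum>n\<in>(\<lambda>p. p + 2) ` ?B. hecke M n ^ 4)"
        by (subst sum.reindex) (auto simp: inj_on_def)
      also have "\<dots> \<le> (\<Sum>n=1..X. hecke M n ^ 4)"
      proof (rule sum_mono2)
        show "(\<lambda>p. p + 2) ` ?B \<subseteq> {1..X}" using pB by fastforce
      qed auto
      finally show ?thesis .
    qed
    have s2: "(\<Sum>p\<in>?B. \<bar>hecke N (p - 2)\<bar> ^ 4) \<le> (\<Sum>n=1..X. hecke N n ^ 4)"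
    proof -
      have "inj_on (\<lambda>p. p - 2) ?B"
      proof (rule inj_onI)
        fix p q assume "p \<in> ?B" "q \<in> ?B" "p - 2 = q - 2"
        thus "p = q" using pB[of p] pB[of q] by linarith
      qed
      hence "(\<Sum>p\<in>?B. \<bar>hecke N (p - 2)\<bar> ^ 4) = (\<Sum>n\<in>(\<lambda>p. p - 2) ` ?B. hecke N n ^ 4)"
        by (subst sum.reindex) auto
      also have "\<dots> \<le> (\<Sum>n=1..X. hecke N n ^ 4)"
      proof (rule sum_mono2)
        show "(\<lambda>p. p - 2) ` ?B \<subseteq> {1..X}" using pB by fastforce
      qed auto
      finally show ?thesis .
    qed
    have "(\<Sum>p\<in>?B. \<bar>hecke M (p + 2)\<bar> * \<bar>hecke N (p - 2)\<bar>)
        \<le> (\<Sum>p\<in>?B. V + (\<bar>hecke M (p + 2)\<bar> ^ 4 + \<bar>hecke N (p - 2)\<bar> ^ 4) / V)"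
      by (intro sum_mono prod_le_threshold V) auto
    also have "\<dots> = V * real (card ?B) + ((\<Sum>p\<in>?B. \<bar>hecke M (p + 2)\<bar> ^ 4) + (\<Sum>p\<in>?B. \<bar>hecke N (p - 2)\<bar> ^ 4)) / V"
      by (simp add: sum.distrib sum_divide_distrib add_divide_distrib)
    also have "\<dots> \<le> V * (sieve_z x + C1 * x * L powr (-57)) + (C2 * x * L powr 44 + C3 * x * L powr 44) / V"
      using elim(1-3) s1 s2 V
      by (intro add_mono mult_left_mono divide_right_mono) (auto simp: L_def X_def)
    also have "\<dots> = V * sieve_z x + C1 * x * (V * L powr (-57)) + (C2 + C3) * x * (L powr 44 / V)"
      by (simp add: algebra_simps add_divide_distrib)
    also have "V * L powr (-57) = L powr (-7)" by (simp add: V_def flip: powr_add)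
    also have "L powr 44 / V = L powr (-6)" by (simp add: V_def flip: powr_diff)
    also have "V * sieve_z x + C1 * x * L powr (-7) + (C2 + C3) * x * L powr (-6)
        \<le> V * sieve_z x + C1 * x * L powr (-6) + (C2 + C3) * x * L powr (-6)"
      using C1(1) L by (intro add_mono mult_left_mono powr_mono order_refl) auto
    also have "\<dots> = L powr 50 * sieve_z x + (C1 + C2 + C3) * x * L powr (-6)"
      by (simp add: V_def algebra_simps)
    finally show ?case by (simp add: L_def)
  qed
  thus ?thesis using C1(1) C2(1) C3(1) by (intro exI[of _ "C1 + C2 + C3"]) auto
qed

text \<open>For the good primes, relative to x / log x, the exponent of log x is -3 + 1/5 + 7/4 + 1
  = -1/20, which beats the factor (log log x)^3. The worst case 7/4 = 1 + 3/4 occurs when one of the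
  two frequencies is 0.\<close>

theorem corr_sum_small:
  assumes "even M" "even N" "M \<noteq> 0 \<or> N \<noteq> 0"
  shows "((\<lambda>x. corr_sum M N x * ln x / x) \<longlongrightarrow> 0) at_top"
proof -
  obtain C1 where C1: "C1 > 0" "\<forall>\<^sub>F x in at_top. (\<Sum>p\<in>good_primes x. \<bar>hecke M (p + 2)\<bar> * \<bar>hecke N (p - 2)\<bar>)
     \<le> C1 * (x * (ln (ln x) / ln x) ^ 3 * ln x powr (1/5) * ln x powr (log_exponent M + log_exponent N))"
    using good_sum_le[OF assms(1,2)] by blast
  obtain C2 where C2: "C2 > 0" "\<forall>\<^sub>F x in at_top. (\<Sum>p\<in>prime_range x - good_primes x. \<bar>hecke M (p + 2)\<bar> * \<bar>hecke N (p - 2)\<bar>)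
     \<le> ln x powr 50 * sieve_z x + C2 * x * ln x powr (-6)"
    using bad_sum_le[OF assms(1,2)] by blast
  have log_exponent: "log_exponent M + log_exponent N \<le> 7/4" using assms(3) by (auto simp: log_exponent_def)
  define h where "h x = C1 * ((ln (ln x) / ln x) ^ 3 * ln x powr (1/5) * ln x powr (7/4) * ln x)
     + (ln x powr 50 * exp (ln x / (216 * ln (ln x))) * ln x / x + C2 * ln x powr (-6) * ln x)" for x :: real
  have h: "(h \<longlongrightarrow> 0) at_top"
  proof -
    have 1: "((\<lambda>x. (ln (ln x) / ln x) ^ 3 * ln x powr (1/5) * ln x powr (7/4) * ln x :: real) \<longlongrightarrow> 0) at_top"
      by real_asymp
    have 2: "((\<lambda>x. ln x powr 50 * exp (ln x / (216 * ln (ln x))) * ln x / x :: real) \<longlongrightarrow> 0) at_top"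
      by real_asymp
    have 3: "((\<lambda>x. ln x powr (-6) * ln x :: real) \<longlongrightarrow> 0) at_top" by real_asymp
    show ?thesis unfolding h_def
      using tendsto_add[OF tendsto_mult_right_zero[OF 1, of C1]
        tendsto_add[OF 2 tendsto_mult_right_zero[OF 3, of C2]]] by (simp add: mult.assoc)
  qed
  have ev: "\<forall>\<^sub>F x in at_top. x > (2::real) \<and> ln x \<ge> 1 \<and> ln (ln x) \<ge> 1" by (intro eventually_conj; real_asymp)
  show ?thesis
  proof (rule tendsto_sandwich[OF _ _ tendsto_const h])
    show "\<forall>\<^sub>F x in at_top. 0 \<le> corr_sum M N x * ln x / x"
      using ev by eventually_elim (auto simp: corr_sum_def intro!: divide_nonneg_nonneg mult_nonneg_nonneg sum_nonneg)
    show "\<forall>\<^sub>F x in at_top. corr_sum M N x * ln x / x \<le> h x"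
      using C1(2) C2(2) ev
    proof eventually_elim
      case (elim x)
      have x: "x > 2" "ln x \<ge> 1" "ln (ln x) \<ge> 1" using elim by auto
      have "corr_sum M N x = (\<Sum>p\<in>prime_range x - good_primes x. \<bar>hecke M (p + 2)\<bar> * \<bar>hecke N (p - 2)\<bar>)
          + (\<Sum>p\<in>good_primes x. \<bar>hecke M (p + 2)\<bar> * \<bar>hecke N (p - 2)\<bar>)"
        unfolding corr_sum_def by (rule sum.subset_diff) (auto simp: good_primes_def)
      also have "\<dots> \<le> (ln x powr 50 * sieve_z x + C2 * x * ln x powr (-6))
          + C1 * (x * (ln (ln x) / ln x) ^ 3 * ln x powr (1/5) * ln x powr (log_exponent M + log_exponent N))"
        using elim(1,2) by (intro add_mono) auto
      also have "\<dots> \<le> (ln x powr 50 * sieve_z x + C2 * x * ln x powr (-6))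
          + C1 * (x * (ln (ln x) / ln x) ^ 3 * ln x powr (1/5) * ln x powr (7/4))"
        using x log_exponent C1(1) by (intro add_left_mono mult_left_mono powr_mono) auto
      finally have "corr_sum M N x * (ln x / x) \<le> ((ln x powr 50 * sieve_z x + C2 * x * ln x powr (-6))
          + C1 * (x * (ln (ln x) / ln x) ^ 3 * ln x powr (1/5) * ln x powr (7/4))) * (ln x / x)"
        using x by (intro mult_right_mono) auto
      also have "\<dots> = h x"
      proof -
        have aux: "((A + c2 * x * E) + c1 * (x * B * D * F)) * (l / x) = c1 * (B * D * F * l) + (A * l / x + c2 * E * l)"
          for A E B D F l c1 c2 :: real using x(1) by (simp add: field_simps)
        show ?thesis unfolding h_def sieve_z_def by (rule aux)
      qed
      finally show ?case by simp
    qed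
  qed
qed

section \<open>Cartan angles and Weyl sums\<close>

definition cartan_u :: "int \<times> int \<times> int \<times> int \<Rightarrow> complex" where
  "cartan_u g = (case g of (a,b,c,d) \<Rightarrow> Complex (of_int (a + d)) (of_int (b - c)))"

definition cartan_v :: "int \<times> int \<times> int \<times> int \<Rightarrow> complex" where
  "cartan_v g = (case g of (a,b,c,d) \<Rightarrow> Complex (of_int (a - d)) (of_int (b + c)))"

lemma norm_uu_vv:
  assumes "g \<in> SL2Z"
  shows "cmod (cartan_u g) ^ 2 = of_int (nuH g + 2)" "cmod (cartan_v g) ^ 2 = of_int (nuH g - 2)"
proof -
  obtain a b c d where g: "g = (a,b,c,d)" by (cases g)
  have det: "a * d - b * c = 1" using assms by (simp add: g SL2Z_def)
  have "(a + d)^2 + (b - c)^2 = nuH g + 2 * (a * d - b * c)"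
    "(a - d)^2 + (b + c)^2 = nuH g - 2 * (a * d - b * c)"
    by (simp_all add: g nuH_def power2_eq_square algebra_simps)
  hence 1: "(a + d)^2 + (b - c)^2 = nuH g + 2" and 2: "(a - d)^2 + (b + c)^2 = nuH g - 2"
    unfolding det by simp_all
  have "cmod (cartan_u g) ^ 2 = of_int ((a + d)^2 + (b - c)^2)"
    by (simp add: cartan_u_def g cmod_power2)
  thus "cmod (cartan_u g) ^ 2 = of_int (nuH g + 2)" unfolding 1 .
  have "cmod (cartan_v g) ^ 2 = of_int ((a - d)^2 + (b + c)^2)"
    by (simp add: cartan_v_def g cmod_power2)
  thus "cmod (cartan_v g) ^ 2 = of_int (nuH g - 2)" unfolding 2 .
qed

lemma real_mat_cartan_iff:
  "real_mat (a,b,c,d) = kmat t1 ** amat r ** kmat t2 \<longleftrightarrow>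
    real_of_int a = cos t1 * cos t2 * exp (- r / 2) - sin t1 * sin t2 * exp (r / 2) \<and>
    real_of_int b = cos t1 * sin t2 * exp (- r / 2) + sin t1 * cos t2 * exp (r / 2) \<and>
    real_of_int c = - sin t1 * cos t2 * exp (- r / 2) - cos t1 * sin t2 * exp (r / 2) \<and>
    real_of_int d = - sin t1 * sin t2 * exp (- r / 2) + cos t1 * cos t2 * exp (r / 2)"
  by (auto simp: real_mat_def kmat_def amat_def matrix_matrix_mult_def vec_eq_iff forall_2 sum_2 algebra_simps)

lemma cartan_uu_vv:
  assumes "real_mat g = kmat t1 ** amat r ** kmat t2"
  shows "cartan_u g = of_real (exp (r / 2) + exp (- r / 2)) * cis (t1 + t2)"
    "cartan_v g = - of_real (exp (r / 2) - exp (- r / 2)) * cis (t2 - t1)"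
proof -
  obtain a b c d where g: "g = (a,b,c,d)" by (cases g)
  note e = assms[unfolded g real_mat_cartan_iff]
  show "cartan_u g = of_real (exp (r / 2) + exp (- r / 2)) * cis (t1 + t2)"
    using e by (simp add: g cartan_u_def complex_eq_iff cos_add sin_add algebra_simps)
  show "cartan_v g = - of_real (exp (r / 2) - exp (- r / 2)) * cis (t2 - t1)"
    using e by (simp add: g cartan_v_def complex_eq_iff cos_diff sin_diff algebra_simps)
qed

text \<open>The moduli P and Q of \<open>cartan_u g\<close> and \<open>cartan_v g\<close> satisfy
  P^2 - Q^2 = 4, so (P + Q)/2 and (P - Q)/2 are reciprocal and serve as exp(r/2) and
  exp(-r/2).\<close>

lemma cartan_exists:
  assumes "g \<in> SL2Z"
  shows "\<exists>t1 t2. \<exists>r\<ge>0. real_mat g = kmat t1 ** amat r ** kmat t2"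
proof -
  obtain a b c d where g: "g = (a,b,c,d)" by (cases g)
  define P where "P = cmod (cartan_u g)"
  define Q where "Q = cmod (cartan_v g)"
  have PQ: "P^2 - Q^2 = 4" using norm_uu_vv[OF assms] by (simp add: P_def Q_def)
  have pos: "P \<ge> 0" "Q \<ge> 0" by (simp_all add: P_def Q_def)
  have "Q^2 < P^2" using PQ by linarith
  hence QP: "Q < P" using pos by (simp add: power_less_imp_less_base)
  have "4 \<le> P^2" using PQ zero_le_power2[of Q] by linarith
  hence "2^2 \<le> P^2" by simp
  hence P2: "P \<ge> 2" using pos(1) by (rule power2_le_imp_le)
  define B where "B = (P + Q) / 2"
  define A where "A = (P - Q) / 2"
  have AB: "A * B = 1" using PQ by (simp add: A_def B_def power2_eq_square algebra_simps)
  have B1: "B \<ge> 1" using P2 pos by (simp add: B_def)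
  define r where "r = 2 * ln B"
  have r: "r \<ge> 0" "exp (r / 2) = B" using B1 by (auto simp: r_def)
  have "exp (- (r / 2)) = inverse B" by (simp only: exp_minus r(2))
  also have "\<dots> = A" using AB by (intro inverse_unique) (simp only: mult.commute)
  finally have rA: "exp (- r / 2) = A" by (simp only: minus_divide_left)
  obtain s where s: "cartan_u g = of_real P * cis s" by (metis P_def rcis_cmod_Arg rcis_def)
  obtain s' where s': "cartan_v g = of_real Q * cis s'" by (metis Q_def rcis_cmod_Arg rcis_def)
  \<comment> \<open>The sum of the angles is the argument of \<open>cartan_u g\<close>; their
    difference is the argument of \<open>cartan_v g\<close> shifted by pi, which absorbs the minus
    sign in \<open>cartan_uu_vv\<close>.\<close>
  define t1 where "t1 = (s - (s' + pi)) / 2"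
  define t2 where "t2 = (s + (s' + pi)) / 2"
  have t: "s = t1 + t2" "s' = t2 - t1 - pi" by (simp_all add: t1_def t2_def field_simps)
  have u: "of_int (a + d) = P * cos (t1 + t2)" "of_int (b - c) = P * sin (t1 + t2)"
    using s by (simp_all add: g cartan_u_def complex_eq_iff t)
  have v: "of_int (a - d) = - Q * cos (t2 - t1)" "of_int (b + c) = - Q * sin (t2 - t1)"
    using s' by (simp_all add: g cartan_v_def complex_eq_iff t(2))
  have P: "P = B + A" and Q: "Q = B - A" by (simp_all add: A_def B_def field_simps)
  have "real_mat g = kmat t1 ** amat r ** kmat t2"
    unfolding g real_mat_cartan_iff rA r(2)
    using u v unfolding P Q cos_add sin_add cos_diff sin_diff
    by (simp add: algebra_simps)
  thus ?thesis using r(1) by blast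
qed

lemma cartan_angles:
  assumes "g \<in> SL2Z"
  shows "\<exists>r\<ge>0. real_mat g = kmat (theta1 g) ** amat r ** kmat (theta2 g)"
proof -
  have "\<exists>z. case z of (t1, t2) \<Rightarrow> \<exists>r\<ge>0. real_mat g = kmat t1 ** amat r ** kmat t2"
    using cartan_exists[OF assms] by auto
  from someI_ex[OF this] show ?thesis
    by (simp add: theta1_def theta2_def cartan_angles_def case_prod_unfold)
qed

text \<open>\<open>nuH g > 2\<close> makes \<open>cartan_v g\<close> nonzero and hence r > 0.
  Whatever angles the choice operator returns, their sum and difference are then determined modulo 2
  pi.\<close>

lemma sgn_uu_vv:
  assumes "g \<in> SL2Z" "nuH g > 2"
  shows "cis (theta1 g + theta2 g) = sgn (cartan_u g)" "cis (theta2 g - theta1 g) = - sgn (cartan_v g)"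
proof -
  obtain r where r: "r \<ge> 0" "real_mat g = kmat (theta1 g) ** amat r ** kmat (theta2 g)"
    using cartan_angles[OF assms(1)] by blast
  note uv = cartan_uu_vv[OF r(2)]
  have sg: "sgn (of_real x * cis t) = cis t" if "x > 0" for x t
    using that by (simp add: sgn_eq norm_mult)
  have "exp (r / 2) + exp (- r / 2) > 0" by (intro add_pos_pos) auto
  thus "cis (theta1 g + theta2 g) = sgn (cartan_u g)" unfolding uv(1) by (rule sg[symmetric])
  have "cartan_v g \<noteq> 0" using norm_uu_vv(2)[OF assms(1)] assms(2) by auto
  hence "r \<noteq> 0" using uv(2) by auto
  hence "exp (r / 2) - exp (- r / 2) > 0" using r(1) by simp
  from sg[OF this] show "cis (theta2 g - theta1 g) = - sgn (cartan_v g)"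
    unfolding uv(2) by (simp only: mult_minus_left sgn_minus minus_minus)
qed

section \<open>Matrices of given norm and their Weyl sums\<close>

definition nu_fiber :: "nat \<Rightarrow> (int \<times> int \<times> int \<times> int) set" where
  "nu_fiber p = {g\<in>SL2Z. nuH g = int p}"

lemma finite_nu_fiber: "finite (nu_fiber p)"
proof (rule finite_subset)
  let ?I = "{-int p..int p}"
  show "nu_fiber p \<subseteq> ?I \<times> ?I \<times> ?I \<times> ?I"
  proof
    fix g assume g: "g \<in> nu_fiber p"
    obtain a b c d where abcd: "g = (a,b,c,d)" by (cases g)
    have s: "a^2 + b^2 + c^2 + d^2 = int p" using g by (simp add: abcd nu_fiber_def nuH_def)
    have aux: "x^2 \<le> int p \<Longrightarrow> x \<in> ?I" for x :: int
    proof -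
      assume "x^2 \<le> int p"
      hence "\<bar>x\<bar> \<le> int p" using abs_le_square_int[of x] by linarith
      thus "x \<in> ?I" by auto
    qed
    have "a \<in> ?I" "b \<in> ?I" "c \<in> ?I" "d \<in> ?I"
      using s zero_le_power2[of a] zero_le_power2[of b] zero_le_power2[of c] zero_le_power2[of d]
      by (intro aux; linarith)+
    thus "g \<in> ?I \<times> ?I \<times> ?I \<times> ?I" by (simp add: abcd)
  qed
qed simp

text \<open>For odd \<open>p\<close> exactly one of a + d and b - c is odd, and a - d, b + c have
  the same parities. So both points are 1 modulo 2, or both are \<i> times such points. Conversely
  matching parities make a, b, c, d integral, and the norms p + 2 and p - 2 give determinant 1 by
  their difference and \<open>nuH\<close> by their sum.\<close>

lemma nu_fiber_bij:
  assumes "odd p" "p \<ge> 3"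
  shows "bij_betw (\<lambda>g. (cartan_u g, cartan_v g)) (nu_fiber p)
    (osphere (p + 2) \<times> osphere (p - 2) \<union> (\<lambda>(u, v). (\<i> * u, \<i> * v)) ` (osphere (p + 2) \<times> osphere (p - 2)))"
    (is "bij_betw ?F _ (?E \<union> ?I ` ?E)")
proof (rule bij_betw_imageI)
  show "inj_on ?F (nu_fiber p)"
  proof (rule inj_onI)
    fix g h assume "?F g = ?F h"
    obtain a b c d where g: "g = (a,b,c,d)" by (cases g)
    obtain a' b' c' d' where h: "h = (a',b',c',d')" by (cases h)
    have "a + d = a' + d'" "b - c = b' - c'" "a - d = a' - d'" "b + c = b' + c'"
      using \<open>?F g = ?F h\<close> by (simp_all add: g h cartan_u_def cartan_v_def del: of_int_add of_int_diff)
    thus "g = h" unfolding g h by auto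
  qed
  have surj: "\<exists>g\<in>nu_fiber p. cartan_u g = u \<and> cartan_v g = v"
    if uv: "Re u = of_int x" "Im u = of_int y" "Re v = of_int x'" "Im v = of_int y'"
      "even (x + x')" "even (y + y')" "cmod u ^ 2 = real (p + 2)" "cmod v ^ 2 = real (p - 2)" for u v x y x' y'
  proof -
    obtain a b where ab: "x + x' = 2 * a" "y + y' = 2 * b" using uv(5,6) unfolding dvd_def by blast
    define d where "d = x - a"
    define c where "c = b - y"
    have e: "a + d = x" "a - d = x'" "b - c = y" "b + c = y'" using ab by (auto simp: d_def c_def)
    have "real_of_int (x^2 + y^2) = of_int (int (p + 2))" using uv by (simp add: cmod_power2)
    hence "x^2 + y^2 = int (p + 2)" by (simp only: of_int_eq_iff)
    hence 1: "x^2 + y^2 = int p + 2" by simp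
    have "real_of_int (x'^2 + y'^2) = of_int (int (p - 2))" using uv by (simp add: cmod_power2)
    hence "x'^2 + y'^2 = int (p - 2)" by (simp only: of_int_eq_iff)
    hence 2: "x'^2 + y'^2 = int p - 2" using assms(2) by simp
    have h: "x^2 + y^2 - (x'^2 + y'^2) = 4 * (a * d - b * c)" "x^2 + y^2 + (x'^2 + y'^2) = 2 * (a^2 + b^2 + c^2 + d^2)"
      unfolding e[symmetric] by (simp_all add: power2_eq_square algebra_simps)
    have "4 * (a * d - b * c) = 4 * 1" using h(1) unfolding 1 2 by simp
    hence "a * d - b * c = 1" unfolding mult_cancel_left by simp
    moreover have "2 * (a^2 + b^2 + c^2 + d^2) = 2 * int p" using h(2) unfolding 1 2 by simp
    hence "a^2 + b^2 + c^2 + d^2 = int p" unfolding mult_cancel_left by simp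
    ultimately have "(a,b,c,d) \<in> nu_fiber p" by (simp add: nu_fiber_def SL2Z_def nuH_def)
    moreover have "cartan_u (a,b,c,d) = u" "cartan_v (a,b,c,d) = v"
      unfolding cartan_u_def cartan_v_def prod.case e using uv by (simp_all add: complex_eq_iff)
    ultimately show ?thesis by blast
  qed
  show "?F ` nu_fiber p = ?E \<union> ?I ` ?E"
  proof (rule subset_antisym)
    show "?F ` nu_fiber p \<subseteq> ?E \<union> ?I ` ?E"
    proof (rule image_subsetI)
      fix g assume g: "g \<in> nu_fiber p"
      obtain a b c d where abcd: "g = (a,b,c,d)" by (cases g)
      have gS: "g \<in> SL2Z" "nuH g = int p" using g by (auto simp: nu_fiber_def)
      have n: "cmod (cartan_u g) ^ 2 = real (p + 2)" "cmod (cartan_v g) ^ 2 = real (p - 2)"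
        using norm_uu_vv[OF gS(1)] gS(2) assms(2) by auto
      have "a^2 + b^2 + c^2 + d^2 = int p" using gS(2) by (simp add: abcd nuH_def)
      hence "odd (a^2 + b^2 + c^2 + d^2)" using assms(1) by simp
      hence par: "odd (a + d) \<longleftrightarrow> even (b - c)" by auto
      show "?F g \<in> ?E \<union> ?I ` ?E"
      proof (cases "odd (a + d)")
        case True
        have "cartan_u g \<in> odd_gauss" by (rule odd_gaussI[of _ "a + d" "b - c"]) (use True par in \<open>auto simp: abcd cartan_u_def\<close>)
        moreover have "cartan_v g \<in> odd_gauss" by (rule odd_gaussI[of _ "a - d" "b + c"]) (use True par in \<open>auto simp: abcd cartan_v_def\<close>)
        ultimately show ?thesis using n by (auto simp: osphere_def)
      next
        case False
        have "- \<i> * cartan_u g \<in> odd_gauss" by (rule odd_gaussI[of _ "b - c" "- (a + d)"]) (use False par in \<open>auto simp: abcd cartan_u_def\<close>)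
        hence "- \<i> * cartan_u g \<in> osphere (p + 2)" using n by (simp add: osphere_def norm_mult)
        moreover have "- \<i> * cartan_v g \<in> odd_gauss" by (rule odd_gaussI[of _ "b + c" "- (a - d)"]) (use False par in \<open>auto simp: abcd cartan_v_def\<close>)
        hence "- \<i> * cartan_v g \<in> osphere (p - 2)" using n by (simp add: osphere_def norm_mult)
        moreover have "?F g = ?I (- \<i> * cartan_u g, - \<i> * cartan_v g)" by (simp add: mult.assoc[symmetric])
        ultimately show ?thesis by blast
      qed
    qed
    show "?E \<union> ?I ` ?E \<subseteq> ?F ` nu_fiber p"
    proof (intro Un_least subsetI)
      fix z assume "z \<in> ?E"
      then obtain u v where z: "z = (u, v)" "u \<in> osphere (p + 2)" "v \<in> osphere (p - 2)" by auto
      obtain x y where 1: "Re u = of_int x" "Im u = of_int y" "odd x" "even y" using z(2) by (auto simp: osphere_def elim: odd_gaussE)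
      obtain x' y' where 2: "Re v = of_int x'" "Im v = of_int y'" "odd x'" "even y'" using z(3) by (auto simp: osphere_def elim: odd_gaussE)
      have "\<exists>g\<in>nu_fiber p. cartan_u g = u \<and> cartan_v g = v"
        by (rule surj[OF 1(1,2) 2(1,2)]) (use 1 2 z in \<open>auto simp: osphere_def\<close>)
      thus "z \<in> ?F ` nu_fiber p" using z(1) by force
    next
      fix z assume "z \<in> ?I ` ?E"
      then obtain u v where z: "z = (\<i> * u, \<i> * v)" "u \<in> osphere (p + 2)" "v \<in> osphere (p - 2)" by auto
      obtain x y where 1: "Re u = of_int x" "Im u = of_int y" "odd x" "even y" using z(2) by (auto simp: osphere_def elim: odd_gaussE)
      obtain x' y' where 2: "Re v = of_int x'" "Im v = of_int y'" "odd x'" "even y'" using z(3) by (auto simp: osphere_def elim: odd_gaussE)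
      have "\<exists>g\<in>nu_fiber p. cartan_u g = \<i> * u \<and> cartan_v g = \<i> * v"
        by (rule surj[of _ "- y" x _ "- y'" x']) (use 1 2 z in \<open>auto simp: osphere_def norm_mult\<close>)
      thus "z \<in> ?F ` nu_fiber p" using z(1) by force
    qed
  qed
qed

lemma osphere_disjoint_times_i:
  "(osphere m \<times> osphere n) \<inter> (\<lambda>(u, v). (\<i> * u, \<i> * v)) ` (osphere m \<times> osphere n) = {}"
proof -
  have "\<i> * u \<notin> odd_gauss" if uo: "u \<in> odd_gauss" for u
  proof
    assume "\<i> * u \<in> odd_gauss"
    moreover obtain x y where "Re u = of_int x" "Im u = of_int y" "odd x" "even y" using uo by (rule odd_gaussE)
    ultimately show False by (auto elim!: odd_gaussE)
  qed
  thus ?thesis by (auto simp: osphere_def)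
qed

lemma hecke_odd: "odd M \<Longrightarrow> hecke M n = 0"
proof -
  assume M: "odd M"
  have "(\<Sum>z\<in>osphere n. Re (sgn z ^ M)) = (\<Sum>z\<in>osphere n. Re (sgn (- z) ^ M))"
    by (rule sum.reindex_bij_witness[of _ uminus uminus]) (auto intro: osphere_uminus)
  also have "\<dots> = - (\<Sum>z\<in>osphere n. Re (sgn z ^ M))" using M by (simp add: sgn_minus sum_negf)
  finally show ?thesis by (simp add: hecke_def)
qed

lemma norm_sum_osphere_powi: "cmod (\<Sum>z\<in>osphere n. sgn z powi m) = 2 * \<bar>hecke (nat \<bar>m\<bar>) n\<bar>"
proof (cases "m \<ge> 0")
  case True
  hence "(\<Sum>z\<in>osphere n. sgn z powi m) = (\<Sum>z\<in>osphere n. sgn z ^ nat \<bar>m\<bar>)"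
    by (simp add: power_int_def)
  thus ?thesis by (simp add: sum_osphere_sgn abs_mult)
next
  case False
  have "sgn z powi m = cnj (sgn z ^ nat \<bar>m\<bar>)" if "z \<in> osphere n" for z
  proof -
    have "cmod (sgn z) = 1" using osphere_nonzero[OF that] by (simp add: norm_sgn)
    hence "sgn z * cnj (sgn z) = 1" using complex_norm_square[of "sgn z"] by simp
    hence "inverse (sgn z) = cnj (sgn z)" by (rule inverse_unique)
    thus ?thesis using False by (simp add: power_int_def)
  qed
  hence "(\<Sum>z\<in>osphere n. sgn z powi m) = cnj (\<Sum>z\<in>osphere n. sgn z ^ nat \<bar>m\<bar>)" by simp
  thus ?thesis by (simp add: sum_osphere_sgn abs_mult)
qed

lemma sgn_times_i: "sgn (\<i> * u) = \<i> * sgn u"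
  by (simp add: sgn_mult sgn_eq norm_mult)

text \<open>The frequencies in the sum and the difference of the angles are j + k and k - j; the
  sign stems from the minus sign of \<open>cartan_v\<close>.\<close>

lemma weyl_term:
  assumes "g \<in> SL2Z" "nuH g > 2"
  shows "cis (2 * (of_int j * theta1 g + of_int k * theta2 g))
    = (-1) powi (k - j) * (sgn (cartan_u g) powi (j + k) * sgn (cartan_v g) powi (k - j))"
proof -
  have "2 * (of_int j * theta1 g + of_int k * theta2 g)
      = of_int (j + k) * (theta1 g + theta2 g) + of_int (k - j) * (theta2 g - theta1 g)"
    by (simp add: algebra_simps)
  hence "cis (2 * (of_int j * theta1 g + of_int k * theta2 g))
      = cis (theta1 g + theta2 g) powi (j + k) * cis (theta2 g - theta1 g) powi (k - j)"
    by (simp only: cis_power_int cis_mult)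
  also have "\<dots> = sgn (cartan_u g) powi (j + k) * (- 1 * sgn (cartan_v g)) powi (k - j)"
    using sgn_uu_vv[OF assms] by simp
  also have "(- 1 * sgn (cartan_v g)) powi (k - j) = (-1) powi (k - j) * sgn (cartan_v g) powi (k - j)"
    by (rule power_int_mult_distrib)
  finally show ?thesis by simp
qed

text \<open>The sum over pairs factors, and the second copy of the pairs differs from the first only
  by a power of \<i>. The 8 is 2 copies times 2 * 2 from the normalisation of
  \<open>hecke\<close>.\<close>

lemma weyl_fiber_le:
  assumes "odd p" "p \<ge> 3"
  shows "cmod (\<Sum>g\<in>nu_fiber p. cis (2 * (of_int j * theta1 g + of_int k * theta2 g)))
    \<le> 8 * (\<bar>hecke (nat \<bar>j + k\<bar>) (p + 2)\<bar> * \<bar>hecke (nat \<bar>k - j\<bar>) (p - 2)\<bar>)"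
proof -
  define F where "F z = sgn (fst z) powi (j + k) * sgn (snd z) powi (k - j)" for z :: "complex \<times> complex"
  let ?E = "osphere (p + 2) \<times> osphere (p - 2)"
  let ?I = "\<lambda>(u, v). (\<i> * u, \<i> * v) :: complex \<times> complex"
  have "(\<Sum>g\<in>nu_fiber p. cis (2 * (of_int j * theta1 g + of_int k * theta2 g)))
      = (\<Sum>g\<in>nu_fiber p. (-1) powi (k - j) * F (cartan_u g, cartan_v g))"
  proof (rule sum.cong[OF refl])
    fix g assume "g \<in> nu_fiber p"
    hence "g \<in> SL2Z" "nuH g > 2" using assms(2) by (auto simp: nu_fiber_def)
    from weyl_term[OF this, of j k]
    show "cis (2 * (of_int j * theta1 g + of_int k * theta2 g)) = (-1) powi (k - j) * F (cartan_u g, cartan_v g)"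
      by (simp only: F_def fst_conv snd_conv)
  qed
  also have "\<dots> = (-1) powi (k - j) * (\<Sum>g\<in>nu_fiber p. F (cartan_u g, cartan_v g))" by (simp add: sum_distrib_left)
  also have "(\<Sum>g\<in>nu_fiber p. F (cartan_u g, cartan_v g)) = (\<Sum>z\<in>?E \<union> ?I ` ?E. F z)"
    by (rule sum.reindex_bij_betw[OF nu_fiber_bij[OF assms]])
  also have "\<dots> = (\<Sum>z\<in>?E. F z) + (\<Sum>z\<in>?I ` ?E. F z)"
    by (rule sum.union_disjoint) (use osphere_disjoint_times_i in auto)
  also have "(\<Sum>z\<in>?I ` ?E. F z) = (\<Sum>z\<in>?E. F (?I z))"
    by (subst sum.reindex) (auto simp: inj_on_def)
  also have "\<dots> = (\<Sum>z\<in>?E. \<i> powi (j + k) * \<i> powi (k - j) * F z)"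
    by (rule sum.cong[OF refl]) (auto simp: F_def sgn_times_i power_int_mult_distrib)
  also have "\<dots> = \<i> powi (j + k) * \<i> powi (k - j) * (\<Sum>z\<in>?E. F z)" by (simp add: sum_distrib_left)
  finally have eq: "(\<Sum>g\<in>nu_fiber p. cis (2 * (of_int j * theta1 g + of_int k * theta2 g)))
     = (-1) powi (k - j) * ((\<Sum>z\<in>?E. F z) + \<i> powi (j + k) * \<i> powi (k - j) * (\<Sum>z\<in>?E. F z))" .
  have "(\<Sum>z\<in>?E. F z) = (\<Sum>u\<in>osphere (p + 2). sgn u powi (j + k)) * (\<Sum>v\<in>osphere (p - 2). sgn v powi (k - j))"
    by (subst sum_product, subst sum.cartesian_product) (simp add: F_def case_prod_unfold)
  hence n: "cmod (\<Sum>z\<in>?E. F z) = 4 * (\<bar>hecke (nat \<bar>j + k\<bar>) (p + 2)\<bar> * \<bar>hecke (nat \<bar>k - j\<bar>) (p - 2)\<bar>)"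
    by (simp add: norm_mult norm_sum_osphere_powi)
  have "cmod (\<Sum>g\<in>nu_fiber p. cis (2 * (of_int j * theta1 g + of_int k * theta2 g)))
      = cmod ((\<Sum>z\<in>?E. F z) + \<i> powi (j + k) * \<i> powi (k - j) * (\<Sum>z\<in>?E. F z))"
    unfolding eq by (simp add: norm_mult norm_power_int)
  also have "\<dots> \<le> cmod (\<Sum>z\<in>?E. F z) + cmod (\<Sum>z\<in>?E. F z)"
    by (rule order_trans[OF norm_triangle_ineq]) (simp add: norm_mult norm_power_int)
  finally show ?thesis unfolding n by simp
qed

lemma primeSet_decomp: "primeSet x = (\<Union>p\<in>{p. prime p \<and> real p \<le> x}. nu_fiber p)"
proof (rule Set.set_eqI, rule iffI)
  fix g assume g: "g \<in> primeSet x"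
  hence p: "prime (nuH g)" "real_of_int (nuH g) \<le> x" "g \<in> SL2Z" by (auto simp: primeSet_def)
  have "nuH g > 0" using p(1) prime_gt_0_int by blast
  hence e: "nuH g = int (nat (nuH g))" by simp
  have "prime (nat (nuH g))" using p(1) by (metis e prime_nat_int_transfer)
  moreover have "real (nat (nuH g)) \<le> x" using p(2) e by (metis of_int_of_nat_eq)
  moreover have "g \<in> nu_fiber (nat (nuH g))" using p(3) e by (simp add: nu_fiber_def)
  ultimately show "g \<in> (\<Union>p\<in>{p. prime p \<and> real p \<le> x}. nu_fiber p)" by blast
qed (auto simp: nu_fiber_def primeSet_def)

lemma finite_primes_le: "finite {p::nat. prime p \<and> real p \<le> x}"
proof (rule finite_subset)
  show "{p::nat. prime p \<and> real p \<le> x} \<subseteq> {..nat \<lfloor>x\<rfloor>}" by (auto simp: le_nat_floor)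
qed simp

text \<open>The prime 2 is split off: its matrices are those fixing the point i, whose angles are
  not well defined, and finitely many of them are bounded trivially.\<close>

lemma weyl_sum_le:
  "cmod (\<Sum>g\<in>primeSet x. cis (2 * (of_int j * theta1 g + of_int k * theta2 g)))
    \<le> real (card (nu_fiber 2)) + 8 * corr_sum (nat \<bar>j + k\<bar>) (nat \<bar>k - j\<bar>) x"
proof -
  let ?P = "{p::nat. prime p \<and> real p \<le> x}"
  define S where "S p = (\<Sum>g\<in>nu_fiber p. cis (2 * (of_int j * theta1 g + of_int k * theta2 g)))" for p
  have "(\<Sum>g\<in>primeSet x. cis (2 * (of_int j * theta1 g + of_int k * theta2 g))) = (\<Sum>p\<in>?P. S p)"
    unfolding primeSet_decomp S_def
    by (rule sum.UNION_disjoint) (use finite_primes_le finite_nu_fiber in \<open>auto simp: nu_fiber_def\<close>)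
  also have "cmod \<dots> \<le> (\<Sum>p\<in>?P. cmod (S p))" by (rule norm_sum)
  also have "\<dots> \<le> (\<Sum>p\<in>insert 2 (prime_range x). cmod (S p))"
  proof (rule sum_mono2)
    show "?P \<subseteq> insert 2 (prime_range x)"
    proof
      fix p assume p: "p \<in> ?P"
      hence "p \<ge> 2" using prime_ge_2_nat by auto
      thus "p \<in> insert 2 (prime_range x)" using p by (cases "p = 2") (auto simp: prime_range_def)
    qed
  qed auto
  also have "\<dots> = cmod (S 2) + (\<Sum>p\<in>prime_range x. cmod (S p))"
    by (rule sum.insert[OF finite_prime_range]) (simp add: prime_range_def)
  also have "cmod (S 2) \<le> real (card (nu_fiber 2))"
    unfolding S_def by (rule order_trans[OF norm_sum]) simp
  also have "(\<Sum>p\<in>prime_range x. cmod (S p)) \<le> (\<Sum>p\<in>prime_range x.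
      8 * (\<bar>hecke (nat \<bar>j + k\<bar>) (p + 2)\<bar> * \<bar>hecke (nat \<bar>k - j\<bar>) (p - 2)\<bar>))"
  proof (rule sum_mono)
    fix p assume p: "p \<in> prime_range x"
    have "odd p" using p prime_odd_nat[of p] by (auto simp: prime_range_def)
    thus "cmod (S p) \<le> 8 * (\<bar>hecke (nat \<bar>j + k\<bar>) (p + 2)\<bar> * \<bar>hecke (nat \<bar>k - j\<bar>) (p - 2)\<bar>)"
      unfolding S_def using p by (intro weyl_fiber_le) (auto simp: prime_range_def)
  qed
  also have "\<dots> = 8 * corr_sum (nat \<bar>j + k\<bar>) (nat \<bar>k - j\<bar>) x"
    by (simp add: corr_sum_def sum_distrib_left)
  finally show ?thesis by simp
qed

lemma weyl_limit:
  assumes "c > 0" "\<forall>\<^sub>F x in at_top. c * (x / ln x) \<le> real (piE x)" "j \<noteq> 0 \<or> k \<noteq> 0"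
  shows "((\<lambda>x. (\<Sum>g\<in>primeSet x. cis (2 * (of_int j * theta1 g + of_int k * theta2 g))) / of_nat (piE x)) \<longlongrightarrow> 0) at_top"
proof -
  define M where "M = nat \<bar>j + k\<bar>"
  define N where "N = nat \<bar>k - j\<bar>"
  \<comment> \<open>j + k and k - j vanish together only for j = k = 0. They have the same parity,
    and in the odd case z and -z cancel, so every coefficient is 0.\<close>
  have MN: "M \<noteq> 0 \<or> N \<noteq> 0" using assms(3) by (auto simp: M_def N_def)
  have corr: "((\<lambda>x. corr_sum M N x * ln x / x) \<longlongrightarrow> 0) at_top"
  proof (cases "even M \<and> even N")
    case True thus ?thesis using corr_sum_small MN by blast
  next
    case False
    hence "corr_sum M N = (\<lambda>_. 0)" by (auto simp: corr_sum_def hecke_odd fun_eq_iff)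
    thus ?thesis by simp
  qed
  define K where "K = real (card (nu_fiber 2))"
  have "((\<lambda>x::real. ln x / x) \<longlongrightarrow> 0) at_top" by real_asymp
  from tendsto_mult_right_zero[OF tendsto_add[OF tendsto_mult_right_zero[OF this, of K] tendsto_mult_right_zero[OF corr, of 8], simplified], of "1 / c"]
  have lim: "((\<lambda>x. 1 / c * (K * (ln x / x) + 8 * (corr_sum M N x * ln x / x))) \<longlongrightarrow> 0) at_top" by simp
  have ev: "\<forall>\<^sub>F x in at_top. x > (2::real) \<and> ln x \<ge> 1" by (intro eventually_conj; real_asymp)
  show ?thesis
  proof (rule Lim_null_comparison[OF _ lim])
    show "\<forall>\<^sub>F x in at_top. norm ((\<Sum>g\<in>primeSet x. cis (2 * (of_int j * theta1 g + of_int k * theta2 g))) / of_nat (piE x))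
       \<le> 1 / c * (K * (ln x / x) + 8 * (corr_sum M N x * ln x / x))"
      using assms(2) ev
    proof eventually_elim
      case (elim x)
      have pos: "c * (x / ln x) > 0" using elim assms(1) by (intro mult_pos_pos divide_pos_pos) auto
      have "norm ((\<Sum>g\<in>primeSet x. cis (2 * (of_int j * theta1 g + of_int k * theta2 g))) / of_nat (piE x))
          \<le> (K + 8 * corr_sum M N x) / real (piE x)"
        using weyl_sum_le[of j k x] by (simp add: norm_divide K_def M_def N_def divide_right_mono)
      also have "\<dots> \<le> (K + 8 * corr_sum M N x) / (c * (x / ln x))"
      proof (rule divide_left_mono)
        show "c * (x / ln x) \<le> real (piE x)" using elim by simp
        hence "real (piE x) > 0" using pos by linarith
        thus "0 < real (piE x) * (c * (x / ln x))" using pos by (rule mult_pos_pos)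
        show "0 \<le> K + 8 * corr_sum M N x"
          by (auto simp: K_def corr_sum_def intro!: add_nonneg_nonneg sum_nonneg)
      qed
      also have "\<dots> = 1 / c * (K * (ln x / x) + 8 * (corr_sum M N x * ln x / x))"
        using elim assms(1) by (simp add: field_simps)
      finally show ?case .
    qed
  qed
qed

section \<open>Trigonometric polynomials on the torus\<close>

definition torus :: "(complex \<times> complex) set" where
  "torus = sphere 0 1 \<times> sphere 0 1"

text \<open>Integer exponents supply the negative frequencies. Adding exponents fails at 0, which is
  why closure under products is stated only on the torus.\<close>

inductive trig_poly :: "(complex \<times> complex \<Rightarrow> complex) \<Rightarrow> bool" where
  mono: "trig_poly (\<lambda>w. c * (fst w powi j * snd w powi k))"
| add: "trig_poly f \<Longrightarrow> trig_poly g \<Longrightarrow> trig_poly (\<lambda>w. f w + g w)"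

lemma torus_nonzero: "w \<in> torus \<Longrightarrow> fst w \<noteq> 0 \<and> snd w \<noteq> 0"
  by (auto simp: torus_def)

lemma compact_torus: "compact torus"
  unfolding torus_def by (intro compact_Times compact_sphere)

lemma trig_poly_mult_mono:
  assumes "trig_poly g"
  shows "\<exists>h. trig_poly h \<and> (\<forall>w\<in>torus. h w = c * (fst w powi j * snd w powi k) * g w)"
  using assms
proof induction
  case (mono c' j' k')
  have "trig_poly (\<lambda>w. (c * c') * (fst w powi (j + j') * snd w powi (k + k')))" by (rule trig_poly.mono)
  thus ?case using torus_nonzero
    by (intro exI[of _ "\<lambda>w. (c * c') * (fst w powi (j + j') * snd w powi (k + k'))"])
       (auto simp: power_int_add mult_ac)
next
  case (add f g)
  then obtain h1 h2 where "trig_poly h1" "trig_poly h2"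
    "\<forall>w\<in>torus. h1 w = c * (fst w powi j * snd w powi k) * f w"
    "\<forall>w\<in>torus. h2 w = c * (fst w powi j * snd w powi k) * g w" by blast
  thus ?case using trig_poly.add by (intro exI[of _ "\<lambda>w. h1 w + h2 w"]) (auto simp: distrib_left)
qed

lemma trig_poly_mult:
  assumes "trig_poly f" "trig_poly g"
  shows "\<exists>h. trig_poly h \<and> (\<forall>w\<in>torus. h w = f w * g w)"
  using assms(1)
proof induction
  case (mono c j k)
  show ?case by (rule trig_poly_mult_mono[OF assms(2)])
next
  case (add f1 f2)
  then obtain h1 h2 where "trig_poly h1" "trig_poly h2"
    "\<forall>w\<in>torus. h1 w = f1 w * g w" "\<forall>w\<in>torus. h2 w = f2 w * g w" by blast
  thus ?case using trig_poly.add by (intro exI[of _ "\<lambda>w. h1 w + h2 w"]) (auto simp: distrib_right)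
qed

lemma continuous_on_trig_poly:
  assumes "trig_poly f" shows "continuous_on torus f"
  using assms
proof induction
  case (mono c j k)
  show ?case using torus_nonzero by (intro continuous_intros) auto
qed (auto intro: continuous_intros)

text \<open>The real functions that agree with a trigonometric polynomial on the torus; they form
  the algebra of real functions to which Stone-Weierstrass is applied.\<close>

definition real_trig :: "(complex \<times> complex \<Rightarrow> real) \<Rightarrow> bool" where
  "real_trig \<phi> \<longleftrightarrow> (\<exists>f. trig_poly f \<and> (\<forall>w\<in>torus. f w = of_real (\<phi> w)))"

lemma unit_circle_Re_Im:
  assumes "cmod z = 1"
  shows "of_real (Re z) = 1/2 * z powi 1 + 1/2 * z powi (-1)"
    "of_real (Im z) = - \<i> / 2 * z powi 1 + \<i> / 2 * z powi (-1)"
proof -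
  have "z * cnj z = 1" using complex_norm_square[of z] assms by simp
  hence "inverse z = cnj z" by (rule inverse_unique)
  hence p: "z powi (-1) = cnj z" by (simp add: power_int_minus)
  show "of_real (Re z) = 1/2 * z powi 1 + 1/2 * z powi (-1)"
    "of_real (Im z) = - \<i> / 2 * z powi 1 + \<i> / 2 * z powi (-1)"
    unfolding p by (simp_all add: complex_eq_iff)
qed

lemma real_trig_coords:
  "real_trig (\<lambda>w. Re (fst w))" "real_trig (\<lambda>w. Im (fst w))"
  "real_trig (\<lambda>w. Re (snd w))" "real_trig (\<lambda>w. Im (snd w))"
proof -
  have n: "cmod (fst w) = 1" "cmod (snd w) = 1" if "w \<in> torus" for w using that by (auto simp: torus_def)
  have 1: "trig_poly (\<lambda>w. c * (fst w powi 1 * snd w powi 0) + d * (fst w powi (-1) * snd w powi 0))" for c d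
    by (intro trig_poly.intros)
  have 2: "trig_poly (\<lambda>w. c * (fst w powi 0 * snd w powi 1) + d * (fst w powi 0 * snd w powi (-1)))" for c d
    by (intro trig_poly.intros)
  show "real_trig (\<lambda>w. Re (fst w))" unfolding real_trig_def
    by (rule exI, rule conjI[OF 1[of "1/2" "1/2"]]) (simp add: unit_circle_Re_Im(1)[OF n(1)])
  show "real_trig (\<lambda>w. Im (fst w))" unfolding real_trig_def
    by (rule exI, rule conjI[OF 1[of "- \<i> / 2" "\<i> / 2"]]) (simp add: unit_circle_Re_Im(2)[OF n(1)])
  show "real_trig (\<lambda>w. Re (snd w))" unfolding real_trig_def
    by (rule exI, rule conjI[OF 2[of "1/2" "1/2"]]) (simp add: unit_circle_Re_Im(1)[OF n(2)])
  show "real_trig (\<lambda>w. Im (snd w))" unfolding real_trig_def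
    by (rule exI, rule conjI[OF 2[of "- \<i> / 2" "\<i> / 2"]]) (simp add: unit_circle_Re_Im(2)[OF n(2)])
qed

lemma continuous_on_real_trig:
  assumes "real_trig \<phi>" shows "continuous_on torus \<phi>"
proof -
  obtain f where f: "trig_poly f" "\<forall>w\<in>torus. f w = of_real (\<phi> w)"
    using assms unfolding real_trig_def by blast
  have "continuous_on torus (\<lambda>w. Re (f w))" by (intro continuous_intros continuous_on_trig_poly f)
  thus ?thesis by (rule continuous_on_eq) (use f(2) in auto)
qed

lemma real_trig_dense:
  assumes "continuous_on torus G" "e > 0"
  shows "\<exists>\<phi>. real_trig \<phi> \<and> (\<forall>w\<in>torus. \<bar>G w - \<phi> w\<bar> < e)"
proof (rule Stone_Weierstrass_HOL[OF compact_torus])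
  show "real_trig (\<lambda>w. c)" for c
    unfolding real_trig_def using trig_poly.mono[of "of_real c" 0 0]
    by (intro exI[of _ "\<lambda>w. of_real c * (fst w powi 0 * snd w powi 0)"]) simp
  show "continuous_on torus \<phi>" if "real_trig \<phi>" for \<phi>
    using that by (rule continuous_on_real_trig)
  show "real_trig (\<lambda>x. \<phi> x + \<psi> x)" if rt: "real_trig \<phi> \<and> real_trig \<psi>" for \<phi> \<psi>
  proof -
    obtain f g where fg: "trig_poly f" "\<forall>w\<in>torus. f w = of_real (\<phi> w)" "trig_poly g" "\<forall>w\<in>torus. g w = of_real (\<psi> w)"
      using rt unfolding real_trig_def by blast
    thus ?thesis unfolding real_trig_def using trig_poly.add[OF fg(1,3)]
      by (intro exI[of _ "\<lambda>w. f w + g w"]) auto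
  qed
  show "real_trig (\<lambda>x. \<phi> x * \<psi> x)" if rt: "real_trig \<phi> \<and> real_trig \<psi>" for \<phi> \<psi>
  proof -
    obtain f g where fg: "trig_poly f" "\<forall>w\<in>torus. f w = of_real (\<phi> w)" "trig_poly g" "\<forall>w\<in>torus. g w = of_real (\<psi> w)"
      using rt unfolding real_trig_def by blast
    obtain h where "trig_poly h" "\<forall>w\<in>torus. h w = f w * g w" using trig_poly_mult[OF fg(1,3)] by blast
    thus ?thesis unfolding real_trig_def using fg(2,4) by (intro exI[of _ h]) auto
  qed
  fix x y :: "complex \<times> complex" assume "x \<in> torus \<and> y \<in> torus \<and> x \<noteq> y"
  hence "Re (fst x) \<noteq> Re (fst y) \<or> Im (fst x) \<noteq> Im (fst y) \<or> Re (snd x) \<noteq> Re (snd y) \<or> Im (snd x) \<noteq> Im (snd y)"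
    by (auto simp: prod_eq_iff complex_eq_iff)
  thus "\<exists>f. real_trig f \<and> f x \<noteq> f y" using real_trig_coords by blast
qed (use assms in auto)

section \<open>Periodic functions as functions on the torus, and their integrals\<close>

definition torus_exp :: "real \<times> real \<Rightarrow> complex \<times> complex" where
  "torus_exp z = (cis (2 * pi * fst z), cis (2 * pi * snd z))"

lemma expi_in_torus: "torus_exp z \<in> torus" by (simp add: torus_exp_def torus_def)

lemma continuous_on_cis_comp: "continuous_on S f \<Longrightarrow> continuous_on S (\<lambda>x. cis (f x))"
  by (simp add: cis_conv_exp) (intro continuous_intros)

lemma continuous_on_expi: "continuous_on S torus_exp"
  unfolding torus_exp_def by (intro continuous_on_Pair continuous_on_cis_comp continuous_intros)

definition unit_square :: "(real \<times> real) set" where "unit_square = {0..1} \<times> {0..1}"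

lemma unit_square_cbox: "unit_square = cbox (0, 0) (1, 1)"
  by (simp add: unit_square_def cbox_Pair_eq)

lemma compact_unit_square: "compact unit_square"
  unfolding unit_square_def by (intro compact_Times compact_Icc)

lemma measure_unit_square: "measure lborel unit_square = 1" "emeasure lborel unit_square = 1"
  unfolding unit_square_cbox by (simp_all add: content_Pair emeasure_lborel_cbox_eq Basis_prod_def inner_Pair)

lemma set_integrable_unit_square:
  fixes f :: "real \<times> real \<Rightarrow> 'a :: {banach, second_countable_topology}"
  assumes "continuous_on unit_square f"
  shows "set_integrable lborel unit_square f"
  unfolding set_integrable_def by (rule borel_integrable_compact[OF compact_unit_square assms])

lemma set_integral_unit_square_const:
  fixes d :: "'a :: {banach, second_countable_topology}"
  shows "(LINT z:unit_square|lborel. d) = d"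
proof -
  have i: "integrable lborel (indicat_real unit_square)"
    using set_integrable_unit_square[of "\<lambda>_. 1::real"] by (simp add: set_integrable_def)
  have "(LINT z|lborel. indicat_real unit_square z) = 1" using measure_unit_square by simp
  thus ?thesis unfolding set_lebesgue_integral_def using integral_scaleR_left[OF i, of d] by simp
qed

lemma expi_image: "torus_exp ` unit_square = torus"
proof (rule subset_antisym)
  show "torus \<subseteq> torus_exp ` unit_square"
  proof
    have circ: "\<exists>x\<in>{0..1}. cis (2 * pi * x) = w" if "cmod w = 1" for w
    proof -
      have "w = cis (Arg2pi w)" using that Arg2pi_eq[of w] by (simp add: cis_conv_exp)
      moreover have "0 \<le> Arg2pi w" "Arg2pi w < 2 * pi" using Arg2pi[of w] by auto
      ultimately show ?thesis by (intro bexI[of _ "Arg2pi w / (2 * pi)"]) auto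
    qed
    fix w assume "w \<in> torus"
    hence "cmod (fst w) = 1" "cmod (snd w) = 1" by (auto simp: torus_def)
    then obtain x y where "x \<in> {0..1}" "cis (2 * pi * x) = fst w" "y \<in> {0..1}" "cis (2 * pi * y) = snd w"
      using circ by meson
    thus "w \<in> torus_exp ` unit_square"
      by (intro image_eqI[of _ _ "(x, y)"]) (auto simp: torus_exp_def unit_square_def prod_eq_iff)
  qed
qed (auto simp: expi_in_torus)

lemma periodic_int:
  fixes h :: "real \<Rightarrow> real" assumes "\<And>x. h (x + 1) = h x" shows "h (x + of_int n) = h x"
proof -
  have nat: "h (x + of_nat m) = h x" for m x
  proof (induction m arbitrary: x)
    case (Suc m)
    have "h (x + of_nat (Suc m)) = h ((x + of_nat m) + 1)" by (simp add: add_ac)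
    thus ?case using assms Suc by simp
  qed simp
  show ?thesis
  proof (cases "n \<ge> 0")
    case True
    thus ?thesis using nat[of x "nat n"] by simp
  next
    case False
    thus ?thesis using nat[of "x + of_int n" "nat (- n)"] by simp
  qed
qed

lemma cis_eq_imp_int_diff:
  assumes "cis (2 * pi * x) = cis (2 * pi * x')" shows "\<exists>n::int. x' = x + of_int n"
proof -
  have "exp (\<i> * of_real (2 * pi * x')) = exp (\<i> * of_real (2 * pi * x))" using assms by (simp add: cis_conv_exp)
  then obtain n :: int where n: "\<i> * of_real (2 * pi * x') = \<i> * of_real (2 * pi * x) + (of_int (2 * n) * pi) * \<i>"
    unfolding exp_eq by blast
  have "2 * pi * x' = 2 * pi * x + of_int (2 * n) * pi" using arg_cong[OF n, of Im] by simp
  hence "(2 * pi) * x' = (2 * pi) * (x + of_int n)" by (simp add: algebra_simps)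
  hence "x' = x + of_int n" by (simp only: mult_cancel_left) simp
  thus ?thesis by blast
qed

text \<open>\<open>torus_exp\<close> maps the compact unit square onto the torus and is therefore a
  quotient map; a function on the torus is continuous once its pullback, here \<open>f\<close>,
  is.\<close>

lemma periodic_factor:
  fixes f :: "real \<times> real \<Rightarrow> real"
  assumes cont: "continuous_on UNIV f"
    and per1: "\<And>x y. f (x + 1, y) = f (x, y)" and per2: "\<And>x y. f (x, y + 1) = f (x, y)"
  obtains G where "continuous_on torus G" "\<And>z. G (torus_exp z) = f z"
proof -
  have inv: "f z = f z'" if "torus_exp z = torus_exp z'" for z z'
  proof -
    have c: "cis (2 * pi * fst z) = cis (2 * pi * fst z')" "cis (2 * pi * snd z) = cis (2 * pi * snd z')"
      using that by (auto simp: torus_exp_def)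
    obtain n m :: int where nm: "fst z' = fst z + of_int n" "snd z' = snd z + of_int m"
      using cis_eq_imp_int_diff[OF c(1)] cis_eq_imp_int_diff[OF c(2)] by blast
    have "f z' = f (fst z + of_int n, snd z + of_int m)" using nm by (metis prod.collapse)
    also have "\<dots> = f (fst z, snd z + of_int m)" by (rule periodic_int[of "\<lambda>x. f (x, snd z + of_int m)"]) (rule per1)
    also have "\<dots> = f (fst z, snd z)" by (rule periodic_int[of "\<lambda>y. f (fst z, y)"]) (rule per2)
    finally show ?thesis by simp
  qed
  define G where "G w = f (SOME z. torus_exp z = w)" for w
  have G: "G (torus_exp z) = f z" for z
  proof -
    have "torus_exp (SOME z'. torus_exp z' = torus_exp z) = torus_exp z" by (rule someI[of _ z]) simp
    thus ?thesis unfolding G_def by (rule inv)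
  qed
  have "continuous_on torus G"
  proof (subst continuous_openin_preimage_eq, intro allI impI)
    fix U :: "real set" assume U: "open U"
    have "openin (top_of_set unit_square) (unit_square \<inter> f -` U)"
      using continuous_on_subset[OF cont subset_UNIV] U by (simp add: continuous_openin_preimage_gen)
    also have "unit_square \<inter> f -` U = unit_square \<inter> torus_exp -` (torus \<inter> G -` U)"
    proof (rule Set.set_eqI)
      fix z show "z \<in> unit_square \<inter> f -` U \<longleftrightarrow> z \<in> unit_square \<inter> torus_exp -` (torus \<inter> G -` U)"
        using expi_in_torus[of z] G[of z] by simp
    qed
    finally show "openin (top_of_set torus) (torus \<inter> G -` U)"
      using Abstract_Topology_2.continuous_imp_quotient_map[OF continuous_on_expi expi_image compact_unit_square, of "torus \<inter> G -` U"]
      by simp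
  qed
  thus ?thesis using that G by blast
qed

lemma integral_cis:
  fixes j :: int assumes "j \<noteq> 0"
  shows "(LINT x|lborel. indicator {0..1} x *\<^sub>R cis (2 * pi * x) powi j) = (0::complex)"
proof -
  define A where "A = \<i> * of_real (2 * pi * of_int j)"
  have nz: "A \<noteq> 0" using assms by (simp add: A_def)
  have c: "cis (2 * pi * of_int j * x) = exp (x *\<^sub>R A)" for x
    by (simp add: A_def cis_conv_exp scaleR_conv_of_real mult_ac)
  define F where "F x = exp (x *\<^sub>R A) * inverse A" for x :: real
  have "(LINT x|lborel. indicator {0..1} x *\<^sub>R cis (2 * pi * of_int j * x)) = F 1 - F 0"
  proof (rule integral_FTC_Icc)
    show "continuous_on {0..1} (\<lambda>x. cis (2 * pi * of_int j * x))"
      by (intro continuous_on_cis_comp continuous_intros)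
    fix x :: real
    have "(F has_vector_derivative (exp (x *\<^sub>R A) * A) * inverse A) (at x within {0..1})"
      unfolding F_def by (intro has_vector_derivative_mult_left exp_scaleR_has_vector_derivative_right)
    moreover have "(exp (x *\<^sub>R A) * A) * inverse A = cis (2 * pi * of_int j * x)"
      unfolding c using nz by (simp add: mult.assoc)
    ultimately show "(F has_vector_derivative cis (2 * pi * of_int j * x)) (at x within {0..1})"
      by (simp only:)
  qed simp
  also have "F 1 - F 0 = 0"
    using c[of 1] cis_multiple_2pi[of "of_int j"] by (simp add: F_def mult_ac)
  finally have "(LINT x|lborel. indicator {0..1} x *\<^sub>R cis (2 * pi * of_int j * x)) = 0" .
  moreover have "cis (2 * pi * x) powi j = cis (2 * pi * of_int j * x)" for x
    by (simp add: cis_power_int mult_ac)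
  ultimately show ?thesis by simp
qed

lemma integral_mono_zero:
  assumes "j \<noteq> 0 \<or> k \<noteq> 0"
  shows "(LINT z:unit_square|lborel. c * (fst (torus_exp z) powi j * snd (torus_exp z) powi k)) = 0"
proof -
  define A where "A x = indicator {0..1} x *\<^sub>R cis (2 * pi * x) powi j" for x :: real
  define B where "B y = indicator {0..1} y *\<^sub>R cis (2 * pi * y) powi k" for y :: real
  let ?f = "\<lambda>z. c * (fst (torus_exp z) powi j * snd (torus_exp z) powi k)"
  have eq: "indicator unit_square z *\<^sub>R ?f z = c * (A (fst z) * B (snd z))" for z
    by (cases z) (auto simp: A_def B_def torus_exp_def unit_square_def indicator_def)
  have ft: "trig_poly (\<lambda>w. c * (fst w powi j * snd w powi k))" by (rule trig_poly.mono)
  have "continuous_on unit_square (\<lambda>z. (\<lambda>w. c * (fst w powi j * snd w powi k)) (torus_exp z))"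
    by (rule continuous_on_compose2[OF continuous_on_trig_poly[OF ft] continuous_on_expi]) (auto simp: expi_in_torus)
  hence int: "integrable lborel (\<lambda>z. c * (A (fst z) * B (snd z)))"
    using set_integrable_unit_square[of ?f] unfolding set_integrable_def eq by simp
  hence int': "integrable (lborel \<Otimes>\<^sub>M lborel) (\<lambda>(x, y). c * (A x * B y))"
    by (simp add: lborel_prod case_prod_unfold)
  have "(LINT z:unit_square|lborel. ?f z) = (LINT z|lborel. c * (A (fst z) * B (snd z)))"
    unfolding set_lebesgue_integral_def eq ..
  also have "\<dots> = (LINT z|(lborel \<Otimes>\<^sub>M lborel). (case z of (x, y) \<Rightarrow> c * (A x * B y)))"
    by (simp add: lborel_prod case_prod_unfold)
  also have "\<dots> = (LINT x|lborel. LINT y|lborel. c * (A x * B y))"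
    using lborel_pair.integral_fst'[OF int'] by simp
  also have "\<dots> = (LINT x|lborel. c * (A x * (LINT y|lborel. B y)))" by simp
  also have "\<dots> = c * ((LINT x|lborel. A x) * (LINT y|lborel. B y))" by simp
  also have "\<dots> = 0" using assms integral_cis[of j] integral_cis[of k] unfolding A_def B_def by auto
  finally show ?thesis .
qed

section \<open>Equidistribution\<close>

definition weyl_mean :: "(complex \<times> complex \<Rightarrow> complex) \<Rightarrow> real \<Rightarrow> complex" where
  "weyl_mean f x = (\<Sum>g\<in>primeSet x. f (torus_exp (theta1 g / pi, theta2 g / pi))) / of_nat (piE x)"

text \<open>Weyl's criterion: nonconstant monomials have mean and integral 0, and both sides are
  additive.\<close>

lemma trig_poly_mean:
  assumes "trig_poly f" "c > 0" "\<forall>\<^sub>F x in at_top. c * (x / ln x) \<le> real (piE x)"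
  shows "(weyl_mean f \<longlongrightarrow> (LINT z:unit_square|lborel. f (torus_exp z))) at_top"
  using assms(1)
proof induction
  case (mono d j k)
  show ?case
  proof (cases "j \<noteq> 0 \<or> k \<noteq> 0")
    case True
    have "weyl_mean (\<lambda>w. d * (fst w powi j * snd w powi k))
       = (\<lambda>x. d * ((\<Sum>g\<in>primeSet x. cis (2 * (of_int j * theta1 g + of_int k * theta2 g))) / of_nat (piE x)))"
    proof
      fix x
      have "fst (torus_exp (theta1 g / pi, theta2 g / pi)) powi j * snd (torus_exp (theta1 g / pi, theta2 g / pi)) powi k
          = cis (2 * (of_int j * theta1 g + of_int k * theta2 g))" for g
        by (simp add: torus_exp_def cis_power_int cis_mult algebra_simps)
      thus "weyl_mean (\<lambda>w. d * (fst w powi j * snd w powi k)) x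
         = d * ((\<Sum>g\<in>primeSet x. cis (2 * (of_int j * theta1 g + of_int k * theta2 g))) / of_nat (piE x))"
        by (simp add: weyl_mean_def sum_distrib_left[symmetric])
    qed
    thus ?thesis unfolding integral_mono_zero[OF True]
      using tendsto_mult_right_zero[OF weyl_limit[OF assms(2,3) True], of d] by (simp only:)
  next
    case False
    hence jk: "j = 0" "k = 0" by auto
    have ev: "\<forall>\<^sub>F x in at_top. x > (2::real) \<and> ln x \<ge> 1" by (intro eventually_conj; real_asymp)
    have lim: "\<forall>\<^sub>F x in at_top. weyl_mean (\<lambda>w. d * (fst w powi j * snd w powi k)) x = d"
      using assms(3) ev
    proof eventually_elim
      case (elim x)
      \<comment> \<open>The lower bound makes \<open>piE x\<close> positive eventually; otherwise
        the quotient would be 0 instead of \<open>d\<close>.\<close>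
      have "c * (x / ln x) > 0" using elim assms(2) by (intro mult_pos_pos divide_pos_pos) auto
      hence "piE x > 0" using elim by linarith
      thus ?case by (simp add: weyl_mean_def jk piE_def)
    qed
    have int: "(LINT z:unit_square|lborel. d * (fst (torus_exp z) powi j * snd (torus_exp z) powi k)) = d"
      using set_integral_unit_square_const[of d] unfolding jk by simp
    show ?thesis unfolding int by (rule tendsto_eventually[OF lim])
  qed
next
  case (add f g)
  have int: "set_integrable lborel unit_square (\<lambda>z. h (torus_exp z))" if "trig_poly h" for h
    by (rule set_integrable_unit_square,
        rule continuous_on_compose2[OF continuous_on_trig_poly[OF that] continuous_on_expi])
       (auto simp: expi_in_torus)
  have m: "weyl_mean (\<lambda>w. f w + g w) = (\<lambda>x. weyl_mean f x + weyl_mean g x)"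
    by (auto simp: weyl_mean_def fun_eq_iff sum.distrib add_divide_distrib)
  have i: "(LINT z:unit_square|lborel. f (torus_exp z) + g (torus_exp z))
      = (LINT z:unit_square|lborel. f (torus_exp z)) + (LINT z:unit_square|lborel. g (torus_exp z))"
    by (rule set_integral_add(2)[OF int[OF add.hyps(1)] int[OF add.hyps(2)]])
  show ?case unfolding m i by (rule tendsto_add[OF add.IH])
qed

lemma real_trig_mean:
  assumes "real_trig \<phi>" "c > 0" "\<forall>\<^sub>F x in at_top. c * (x / ln x) \<le> real (piE x)"
  shows "((\<lambda>x. (\<Sum>g\<in>primeSet x. \<phi> (torus_exp (theta1 g / pi, theta2 g / pi))) / real (piE x))
     \<longlongrightarrow> (LINT z:unit_square|lborel. \<phi> (torus_exp z))) at_top"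
proof -
  obtain f where f: "trig_poly f" "\<And>w. w \<in> torus \<Longrightarrow> f w = of_real (\<phi> w)"
    using assms(1) unfolding real_trig_def by blast
  have "weyl_mean f = (\<lambda>x. of_real ((\<Sum>g\<in>primeSet x. \<phi> (torus_exp (theta1 g / pi, theta2 g / pi))) / real (piE x)))"
    by (simp add: weyl_mean_def fun_eq_iff f(2) expi_in_torus)
  moreover have "(LINT z:unit_square|lborel. f (torus_exp z)) = of_real (LINT z:unit_square|lborel. \<phi> (torus_exp z))"
    unfolding f(2)[OF expi_in_torus] by (rule set_integral_complex_of_real)
  ultimately show ?thesis using trig_poly_mean[OF f(1) assms(2,3)] by (simp only: tendsto_of_real_iff)
qed

theorem theorem1p3:
  fixes f :: "real \<times> real \<Rightarrow> real"
  assumes asymp: "\<exists>c1 c2. 0 < c1 \<and> c1 \<le> c2 \<and>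
     (\<forall>\<^sub>F x in at_top. c1 * (x / ln x) \<le> real (piE x) \<and> real (piE x) \<le> c2 * (x / ln x))"
    and cont: "continuous_on UNIV f"
    and per1: "\<And>x y. f (x + 1, y) = f (x, y)"
    and per2: "\<And>x y. f (x, y + 1) = f (x, y)"
  shows "((\<lambda>x. (\<Sum>g\<in>primeSet x. f (theta1 g / pi, theta2 g / pi)) / real (piE x))
          \<longlongrightarrow> (LINT z:{0..1} \<times> {0..1}|lborel. f z)) at_top"
proof -
  obtain c c2 where c: "c > 0"
    "\<forall>\<^sub>F x in at_top. c * (x / ln x) \<le> real (piE x) \<and> real (piE x) \<le> c2 * (x / ln x)"
    using asymp by blast
  have c': "\<forall>\<^sub>F x in at_top. c * (x / ln x) \<le> real (piE x)" using c(2) by (rule eventually_mono) simp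
  obtain G where G: "continuous_on torus G" "\<And>z. G (torus_exp z) = f z"
    using periodic_factor[OF cont per1 per2] by blast
  define m where "m h x = (\<Sum>g\<in>primeSet x. h (torus_exp (theta1 g / pi, theta2 g / pi))) / real (piE x)"
    for h :: "complex \<times> complex \<Rightarrow> real" and x
  define I where "I h = (LINT z:unit_square|lborel. h (torus_exp z))" for h :: "complex \<times> complex \<Rightarrow> real"
  have int: "set_integrable lborel unit_square (\<lambda>z. h (torus_exp z))" if "continuous_on torus h" for h :: "complex \<times> complex \<Rightarrow> real"
    by (rule set_integrable_unit_square, rule continuous_on_compose2[OF that continuous_on_expi])
       (auto simp: expi_in_torus)
  have "((\<lambda>x. m G x) \<longlongrightarrow> I G) at_top"
  proof (rule tendstoI)
    fix e :: real assume e: "e > 0"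
    obtain \<phi> where \<phi>: "real_trig \<phi>" "\<And>w. w \<in> torus \<Longrightarrow> \<bar>G w - \<phi> w\<bar> < e / 3"
      using real_trig_dense[OF G(1), of "e / 3"] e by auto
    note cphi = continuous_on_real_trig[OF \<phi>(1)]
    \<comment> \<open>Holds for every \<open>x\<close>: if \<open>piE x\<close> is 0, both means are
      0 by convention.\<close>
    have mm: "\<bar>m G x - m \<phi> x\<bar> \<le> e / 3" for x
    proof -
      have "\<bar>\<Sum>g\<in>primeSet x. G (torus_exp (theta1 g / pi, theta2 g / pi)) - \<phi> (torus_exp (theta1 g / pi, theta2 g / pi))\<bar>
          \<le> (\<Sum>g\<in>primeSet x. e / 3)"
        by (rule order_trans[OF sum_abs sum_mono]) (intro less_imp_le \<phi>(2) expi_in_torus)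
      also have "\<dots> = real (piE x) * (e / 3)" by (simp add: piE_def)
      finally have "\<bar>(\<Sum>g\<in>primeSet x. G (torus_exp (theta1 g / pi, theta2 g / pi))) -
          (\<Sum>g\<in>primeSet x. \<phi> (torus_exp (theta1 g / pi, theta2 g / pi)))\<bar> \<le> real (piE x) * (e / 3)"
        by (simp only: sum_subtractf)
      hence "\<bar>(\<Sum>g\<in>primeSet x. G (torus_exp (theta1 g / pi, theta2 g / pi))) -
          (\<Sum>g\<in>primeSet x. \<phi> (torus_exp (theta1 g / pi, theta2 g / pi)))\<bar> / real (piE x) \<le> real (piE x) * (e / 3) / real (piE x)"
        by (rule divide_right_mono) simp
      also have "\<dots> \<le> e / 3" using e by simp
      finally show ?thesis by (simp add: m_def diff_divide_distrib[symmetric])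
    qed
    have II: "\<bar>I G - I \<phi>\<bar> \<le> e / 3"
    proof -
      have "I G - I \<phi> = (LINT z:unit_square|lborel. G (torus_exp z) - \<phi> (torus_exp z))"
        unfolding I_def by (rule set_integral_diff(2)[symmetric, OF int[OF G(1)] int[OF cphi]])
      also have "\<bar>\<dots>\<bar> \<le> (LINT z:unit_square|lborel. \<bar>G (torus_exp z) - \<phi> (torus_exp z)\<bar>)"
        using set_integral_norm_bound[OF set_integral_diff(1)[OF int[OF G(1)] int[OF cphi]]] by simp
      also have "\<dots> \<le> (LINT z:unit_square|lborel. e / 3)"
      proof (rule set_integral_mono)
        show "set_integrable lborel unit_square (\<lambda>z. \<bar>G (torus_exp z) - \<phi> (torus_exp z)\<bar>)"
          using set_integrable_abs[OF set_integral_diff(1)[OF int[OF G(1)] int[OF cphi]]] .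
        show "set_integrable lborel unit_square (\<lambda>z. e / 3)"
          by (rule set_integrable_unit_square) simp
      qed (use \<phi>(2) expi_in_torus less_imp_le in blast)
      also have "\<dots> = e / 3" by (rule set_integral_unit_square_const)
      finally show ?thesis .
    qed
    have "((\<lambda>x. m \<phi> x) \<longlongrightarrow> I \<phi>) at_top"
      using real_trig_mean[OF \<phi>(1) c(1) c'] unfolding m_def I_def .
    hence "\<forall>\<^sub>F x in at_top. dist (m \<phi> x) (I \<phi>) < e / 3" by (rule tendstoD) (use e in simp)
    thus "\<forall>\<^sub>F x in at_top. dist (m G x) (I G) < e"
    proof eventually_elim
      case (elim x)
      thus ?case using mm[of x] II unfolding dist_real_def by linarith
    qed
  qed
  thus ?thesis unfolding m_def I_def G(2) unit_square_def .
qed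

end
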